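(* If $\gamma\in\Sigma_{1/2}$, then $$p^{-\gamma}(n)=-\frac{1}{c_{\gamma,\omega-\gamma}}\,p^{\omega-\gamma}(n)\,p^{H(\gamma)}(n)+\frac13\sum_{\alpha\in\Sigma_{1/2}:\,-\gamma+\alpha\in\pm\Sigma_0}\frac{c_{\alpha,-\gamma}}{c_{\alpha,\omega-\alpha}}\,p^{\omega-\alpha}(n)\,p^{\alpha-\gamma}(n),$$ where $H=H(\gamma)\in\mathfrak a$ is the solution of the linear system $$\omega(H)=-\omega(H_\gamma),\qquad (3\alpha-\omega)(H)=-\alpha(H_\gamma)\quad\text{for all }\alpha\in\tilde\Sigma_{1/2}.$$ Furthermore, let $\gamma\in\Sigma_{1/2}$ be a simple root and $H(\gamma)$ the corresponding solution of this system. If $\gamma'\in\Sigma_{1/2}$ satisfies $\gamma'=\gamma+\delta_1+\delta_2+\dots+\delta_p$ for some simple roots $\delta_1,\dots,\delta_p\in\Sigma_0$, then $$H(\gamma')=H(\gamma)-\tfrac13(H_{\delta_1}+\dots+H_{\delta_p}).$$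
   Context: $\mathfrak g$ is a real split simple Lie algebra of real rank greater than one, $\mathfrak a$ its (split) Cartan subspace, $\Sigma$ the restricted roots (each root space $\mathfrak g_\alpha$ is one-dimensional and the centralizer $\mathfrak m$ of $\mathfrak a$ in the maximal compact subalgebra is $0$), $\Sigma_+$ a positive system, $\omega$ the highest root, $B$ the Killing form, $H_\alpha\in\mathfrak a$ the element with $\alpha(H)=B(H,H_\alpha)$ for all $H\in\mathfrak a$, $(\alpha,\beta)=B(H_\alpha,H_\beta)$. Put $\Sigma_0=\{\beta\in\Sigma_+:(\omega,\beta)=0\}$ and $\Sigma_{1/2}=\{\beta\in\Sigma_+:(\omega,\beta)=\frac12(\omega,\omega)\}$; then $\Sigma_+=\Sigma_0\cup\Sigma_{1/2}\cup\{\omega\}$ and $\alpha\in\Sigma_{1/2}$ implies $\omega-\alpha\in\Sigma_{1/2}$. $\pm\Sigma_0$ denotes $\Sigma_0\cup(-\Sigma_0)$. Let $\alpha\sim\beta$ on $\Sigma_{1/2}$ mean that $\alpha+\beta=\omega$ (each class is a pair $\{\alpha,\omega-\alpha\}$) and let $\tilde\Sigma_{1/2}$ be a set of representatives of the classes. Fix root vectors $X_\alpha\in\mathfrak g_\alpha$ ($\alpha\in\Sigma$) with $B(X_\alpha,X_{-\alpha})=1$ and structure constants $[X_\alpha,X_\beta]=c_{\alpha,\beta}X_{\alpha+\beta}$. Write $Z=X_\omega$ and $Y_\alpha=X_\alpha$ for $\alpha\in\Sigma_{1/2}$. $G=\mathrm{Int}(\mathfrak g)$, $N=\exp\mathfrak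 n$ with $\mathfrak n=\bigoplus_{\alpha\in\Sigma_+}\mathfrak g_\alpha$, $P=MA\overline N$ the minimal parabolic subgroup with Lie algebra $\mathfrak a\oplus\bigoplus_{\alpha\in\Sigma_+}\mathfrak g_{-\alpha}$. $N$ carries coordinates $n=\exp(zZ)\exp(\sum_{\alpha\in\Sigma_{1/2}}y_\alpha Y_\alpha)\exp(\sum_{\beta\in\Sigma_0}x_\beta X_\beta)$. For $X\in\mathfrak g$, $\tau(X)$ is the vector field on $N$ with $\tau(X)f(n)=\frac{d}{dt}f([\exp(tX)n])|_{t=0}$, where $[\exp(tX)n]\in N$ is determined for small $t$ by $\exp(tX)n\in[\exp(tX)n]P$. Expanding $\tau(X)$ in the basis of left-invariant vector fields on $N$ determined by $Z$, the $Y_\alpha$ and the $X_\beta$, the function multiplying $Z$ is a polynomial; it is denoted $p^\alpha$ when $X=X_\alpha$ ($\alpha\in\Sigma$) and $p^H$ when $X=H\in\mathfrak a$. *)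

theory Defs
  imports "HOL-Analysis.Analysis" "HOL-Library.Function_Algebras"
begin

text \<open>
  A finite-dimensional real Lie algebra is a bracket \<open>br\<close> on a type of class \<open>euclidean_space\<close>.
  Every nonzero finite-dimensional real vector space is of this form; the inner product of the
  class only serves to write down the trace and to supply the topology.
\<close>

definition lie_bracket :: "('g::euclidean_space \<Rightarrow> 'g \<Rightarrow> 'g) \<Rightarrow> bool" where
  "lie_bracket br \<longleftrightarrow> bilinear br \<and> (\<forall>x. br x x = 0) \<and>
     (\<forall>x y z. br x (br y z) + br y (br z x) + br z (br x y) = 0)"

definition simple_lie :: "('g::euclidean_space \<Rightarrow> 'g \<Rightarrow> 'g) \<Rightarrow> bool" where
  "simple_lie br \<longleftrightarrow> lie_bracket br \<and> (\<exists>x y. br x y \<noteq> 0) \<and>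
     (\<forall>I. subspace I \<and> (\<forall>x. \<forall>y\<in>I. br x y \<in> I) \<longrightarrow> I = {0} \<or> I = UNIV)"

definition lin_trace :: "('g::euclidean_space \<Rightarrow> 'g) \<Rightarrow> real" where
  "lin_trace f = (\<Sum>b\<in>Basis. f b \<bullet> b)"

definition killing :: "('g::euclidean_space \<Rightarrow> 'g \<Rightarrow> 'g) \<Rightarrow> 'g \<Rightarrow> 'g \<Rightarrow> real" where
  "killing br X Y = lin_trace (br X \<circ> br Y)"

definition cartan_involution :: "('g::euclidean_space \<Rightarrow> 'g \<Rightarrow> 'g) \<Rightarrow> ('g \<Rightarrow> 'g) \<Rightarrow> bool" where
  "cartan_involution br \<theta> \<longleftrightarrow> linear \<theta> \<and> (\<forall>x y. \<theta> (br x y) = br (\<theta> x) (\<theta> y)) \<and>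
     \<theta> \<circ> \<theta> = id \<and> (\<forall>X. X \<noteq> 0 \<longrightarrow> - killing br X (\<theta> X) > 0)"

text \<open>A Cartan subspace is a maximal abelian subspace of the \<open>-1\<close> eigenspace of \<open>\<theta>\<close>.\<close>

definition cartan_subspace ::
  "('g::euclidean_space \<Rightarrow> 'g \<Rightarrow> 'g) \<Rightarrow> ('g \<Rightarrow> 'g) \<Rightarrow> 'g set \<Rightarrow> bool" where
  "cartan_subspace br \<theta> \<aa> \<longleftrightarrow> subspace \<aa> \<and> \<aa> \<subseteq> {X. \<theta> X = - X} \<and>
     (\<forall>H\<in>\<aa>. \<forall>H'\<in>\<aa>. br H H' = 0) \<and>
     (\<forall>X. \<theta> X = - X \<and> (\<forall>H\<in>\<aa>. br H X = 0) \<longrightarrow> X \<in> \<aa>)"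

text \<open>
  Elements of the dual of \<open>\<aa>\<close> are represented by real functions on the whole type that are linear
  on \<open>\<aa>\<close> and zero outside \<open>\<aa>\<close>. This representative is unique and is preserved by the pointwise
  \<open>+\<close>, \<open>-\<close> of \<open>Function_Algebras\<close>.
\<close>

definition dual_space :: "'g::real_vector set \<Rightarrow> ('g \<Rightarrow> real) set" where
  "dual_space \<aa> = {l. (\<forall>x\<in>\<aa>. \<forall>y\<in>\<aa>. l (x + y) = l x + l y) \<and>
     (\<forall>r. \<forall>x\<in>\<aa>. l (r *\<^sub>R x) = r * l x) \<and> (\<forall>x. x \<notin> \<aa> \<longrightarrow> l x = 0)}"

definition root_space ::
  "('g::euclidean_space \<Rightarrow> 'g \<Rightarrow> 'g) \<Rightarrow> 'g set \<Rightarrow> ('g \<Rightarrow> real) \<Rightarrow> 'g set" where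
  "root_space br \<aa> \<alpha> = {X. \<forall>H\<in>\<aa>. br H X = \<alpha> H *\<^sub>R X}"

definition roots :: "('g::euclidean_space \<Rightarrow> 'g \<Rightarrow> 'g) \<Rightarrow> 'g set \<Rightarrow> ('g \<Rightarrow> real) set" where
  "roots br \<aa> = {\<alpha> \<in> dual_space \<aa>. \<alpha> \<noteq> 0 \<and> root_space br \<aa> \<alpha> \<noteq> {0}}"

definition split_form ::
  "('g::euclidean_space \<Rightarrow> 'g \<Rightarrow> 'g) \<Rightarrow> ('g \<Rightarrow> 'g) \<Rightarrow> 'g set \<Rightarrow> bool" where
  "split_form br \<theta> \<aa> \<longleftrightarrow> {X. \<theta> X = X \<and> (\<forall>H\<in>\<aa>. br H X = 0)} = {0} \<and>
     (\<forall>\<alpha>\<in>roots br \<aa>. dim (root_space br \<aa> \<alpha>) = 1)"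

definition positive_system ::
  "('g::euclidean_space \<Rightarrow> 'g \<Rightarrow> 'g) \<Rightarrow> 'g set \<Rightarrow> ('g \<Rightarrow> real) set \<Rightarrow> bool" where
  "positive_system br \<aa> \<Sigma>p \<longleftrightarrow>
     (\<exists>H\<in>\<aa>. (\<forall>\<alpha>\<in>roots br \<aa>. \<alpha> H \<noteq> 0) \<and> \<Sigma>p = {\<alpha> \<in> roots br \<aa>. \<alpha> H > 0})"

definition simple_roots :: "('g \<Rightarrow> real) set \<Rightarrow> ('g \<Rightarrow> real) set" where
  "simple_roots \<Sigma>p = {\<delta> \<in> \<Sigma>p. \<not> (\<exists>\<alpha>\<in>\<Sigma>p. \<exists>\<beta>\<in>\<Sigma>p. \<delta> = \<alpha> + \<beta>)}"

text \<open>The highest root is the greatest root for the partial order defined by the simple roots.\<close>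

definition highest_root ::
  "('g::euclidean_space \<Rightarrow> 'g \<Rightarrow> 'g) \<Rightarrow> 'g set \<Rightarrow> ('g \<Rightarrow> real) set \<Rightarrow> ('g \<Rightarrow> real) \<Rightarrow> bool" where
  "highest_root br \<aa> \<Sigma>p \<omega> \<longleftrightarrow> \<omega> \<in> roots br \<aa> \<and>
     (\<forall>\<beta>\<in>roots br \<aa>. \<exists>k :: ('g \<Rightarrow> real) \<Rightarrow> nat.
        \<forall>H\<in>\<aa>. \<omega> H - \<beta> H = (\<Sum>\<delta>\<in>simple_roots \<Sigma>p. real (k \<delta>) * \<delta> H))"

definition Hvec ::
  "('g::euclidean_space \<Rightarrow> 'g \<Rightarrow> 'g) \<Rightarrow> 'g set \<Rightarrow> ('g \<Rightarrow> real) \<Rightarrow> 'g" where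
  "Hvec br \<aa> \<alpha> = (THE H'. H' \<in> \<aa> \<and> (\<forall>H\<in>\<aa>. \<alpha> H = killing br H H'))"

definition root_ip ::
  "('g::euclidean_space \<Rightarrow> 'g \<Rightarrow> 'g) \<Rightarrow> 'g set \<Rightarrow> ('g \<Rightarrow> real) \<Rightarrow> ('g \<Rightarrow> real) \<Rightarrow> real" where
  "root_ip br \<aa> \<alpha> \<beta> = killing br (Hvec br \<aa> \<alpha>) (Hvec br \<aa> \<beta>)"

definition sigma_zero ::
  "('g::euclidean_space \<Rightarrow> 'g \<Rightarrow> 'g) \<Rightarrow> 'g set \<Rightarrow> ('g \<Rightarrow> real) set \<Rightarrow> ('g \<Rightarrow> real) \<Rightarrow> ('g \<Rightarrow> real) set"
  where "sigma_zero br \<aa> \<Sigma>p \<omega> = {\<beta> \<in> \<Sigma>p. root_ip br \<aa> \<omega> \<beta> = 0}"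

definition sigma_half ::
  "('g::euclidean_space \<Rightarrow> 'g \<Rightarrow> 'g) \<Rightarrow> 'g set \<Rightarrow> ('g \<Rightarrow> real) set \<Rightarrow> ('g \<Rightarrow> real) \<Rightarrow> ('g \<Rightarrow> real) set"
  where "sigma_half br \<aa> \<Sigma>p \<omega> = {\<beta> \<in> \<Sigma>p. root_ip br \<aa> \<omega> \<beta> = 1/2 * root_ip br \<aa> \<omega> \<omega>}"

definition half_representatives ::
  "('g::euclidean_space \<Rightarrow> 'g \<Rightarrow> 'g) \<Rightarrow> 'g set \<Rightarrow> ('g \<Rightarrow> real) set \<Rightarrow> ('g \<Rightarrow> real) \<Rightarrow> ('g \<Rightarrow> real) set \<Rightarrow> bool"
  where "half_representatives br \<aa> \<Sigma>p \<omega> R \<longleftrightarrow> R \<subseteq> sigma_half br \<aa> \<Sigma>p \<omega> \<and>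
     (\<forall>\<alpha>\<in>sigma_half br \<aa> \<Sigma>p \<omega>. \<exists>!\<beta>. \<beta> \<in> R \<and> \<beta> \<in> {\<alpha>, \<omega> - \<alpha>})"

definition normalized_root_vectors ::
  "('g::euclidean_space \<Rightarrow> 'g \<Rightarrow> 'g) \<Rightarrow> 'g set \<Rightarrow> (('g \<Rightarrow> real) \<Rightarrow> 'g) \<Rightarrow> bool" where
  "normalized_root_vectors br \<aa> X \<longleftrightarrow>
     (\<forall>\<alpha>\<in>roots br \<aa>. X \<alpha> \<in> root_space br \<aa> \<alpha> \<and> killing br (X \<alpha>) (X (- \<alpha>)) = 1)"

text \<open>The value of \<open>c \<alpha> \<beta>\<close> matters (and is determined) only when \<open>\<alpha> + \<beta>\<close> is a root.\<close>

definition structure_constants ::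
  "('g::euclidean_space \<Rightarrow> 'g \<Rightarrow> 'g) \<Rightarrow> 'g set \<Rightarrow> (('g \<Rightarrow> real) \<Rightarrow> 'g) \<Rightarrow>
   (('g \<Rightarrow> real) \<Rightarrow> ('g \<Rightarrow> real) \<Rightarrow> real) \<Rightarrow> bool" where
  "structure_constants br \<aa> X c \<longleftrightarrow>
     (\<forall>\<alpha>\<in>roots br \<aa>. \<forall>\<beta>\<in>roots br \<aa>. \<alpha> + \<beta> \<in> roots br \<aa> \<longrightarrow>
        br (X \<alpha>) (X \<beta>) = c \<alpha> \<beta> *\<^sub>R X (\<alpha> + \<beta>))"

text \<open>
  The group \<open>Int(\<gg>)\<close> is a group of linear maps, and the exponential of \<open>X\<close> in it is the operator
  exponential of \<open>ad X\<close>. The inductive set below is closed under inverses because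
  \<open>exp (ad (- X))\<close> is the inverse of \<open>exp (ad X)\<close>.
\<close>

definition op_exp :: "('g::euclidean_space \<Rightarrow> 'g) \<Rightarrow> 'g \<Rightarrow> 'g" where
  "op_exp T v = (\<Sum>k. (T ^^ k) v /\<^sub>R fact k)"

abbreviation Exp :: "('g::euclidean_space \<Rightarrow> 'g \<Rightarrow> 'g) \<Rightarrow> 'g \<Rightarrow> 'g \<Rightarrow> 'g" where
  "Exp br X \<equiv> op_exp (br X)"

inductive_set int_group :: "('g::euclidean_space \<Rightarrow> 'g \<Rightarrow> 'g) \<Rightarrow> ('g \<Rightarrow> 'g) set"
  for br where
  one: "id \<in> int_group br"
| step: "g \<in> int_group br \<Longrightarrow> Exp br X \<circ> g \<in> int_group br"

definition nil_algebra ::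
  "('g::euclidean_space \<Rightarrow> 'g \<Rightarrow> 'g) \<Rightarrow> 'g set \<Rightarrow> ('g \<Rightarrow> real) set \<Rightarrow> 'g set" where
  "nil_algebra br \<aa> \<Phi> = span (\<Union>\<alpha>\<in>\<Phi>. root_space br \<aa> \<alpha>)"

definition N_group ::
  "('g::euclidean_space \<Rightarrow> 'g \<Rightarrow> 'g) \<Rightarrow> 'g set \<Rightarrow> ('g \<Rightarrow> real) set \<Rightarrow> ('g \<Rightarrow> 'g) set" where
  "N_group br \<aa> \<Phi> = Exp br ` nil_algebra br \<aa> \<Phi>"

definition K_group ::
  "('g::euclidean_space \<Rightarrow> 'g \<Rightarrow> 'g) \<Rightarrow> ('g \<Rightarrow> 'g) \<Rightarrow> ('g \<Rightarrow> 'g) set" where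
  "K_group br \<theta> = {g \<in> int_group br. g \<circ> \<theta> = \<theta> \<circ> g}"

definition M_group ::
  "('g::euclidean_space \<Rightarrow> 'g \<Rightarrow> 'g) \<Rightarrow> ('g \<Rightarrow> 'g) \<Rightarrow> 'g set \<Rightarrow> ('g \<Rightarrow> 'g) set" where
  "M_group br \<theta> \<aa> = {g \<in> K_group br \<theta>. \<forall>H\<in>\<aa>. g H = H}"

definition P_group ::
  "('g::euclidean_space \<Rightarrow> 'g \<Rightarrow> 'g) \<Rightarrow> ('g \<Rightarrow> 'g) \<Rightarrow> 'g set \<Rightarrow> ('g \<Rightarrow> real) set \<Rightarrow> ('g \<Rightarrow> 'g) set"
  where "P_group br \<theta> \<aa> \<Sigma>p =
    {m \<circ> Exp br H \<circ> u |m H u. m \<in> M_group br \<theta> \<aa> \<and> H \<in> \<aa> \<and> u \<in> N_group br \<aa> (uminus ` \<Sigma>p)}"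

text \<open>The element \<open>[g]\<close> of \<open>N\<close> with \<open>g \<in> [g] P\<close>.\<close>

definition N_part ::
  "('g::euclidean_space \<Rightarrow> 'g \<Rightarrow> 'g) \<Rightarrow> ('g \<Rightarrow> 'g) \<Rightarrow> 'g set \<Rightarrow> ('g \<Rightarrow> real) set \<Rightarrow> ('g \<Rightarrow> 'g) \<Rightarrow> ('g \<Rightarrow> 'g)"
  where "N_part br \<theta> \<aa> \<Sigma>p g =
    (THE m. m \<in> N_group br \<aa> \<Sigma>p \<and> (\<exists>p\<in>P_group br \<theta> \<aa> \<Sigma>p. g = m \<circ> p))"

text \<open>
  Being \<open>k\<close> times continuously differentiable on a linear subspace \<open>S\<close>: derivatives are
  taken within \<open>S\<close>, hence only directions in \<open>S\<close> are constrained.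
\<close>

primrec Ck_on :: "nat \<Rightarrow> 'e::real_normed_vector set \<Rightarrow> ('e \<Rightarrow> real) \<Rightarrow> bool" where
  "Ck_on 0 S f \<longleftrightarrow> continuous_on S f"
| "Ck_on (Suc k) S f \<longleftrightarrow> (\<exists>f'. (\<forall>x\<in>S. (f has_derivative f' x) (at x within S)) \<and>
      (\<forall>v\<in>S. Ck_on k S (\<lambda>x. f' x v)))"

text \<open>
  Smooth functions on \<open>N\<close>, in the global chart
  \<open>exp (z Z) exp (\<Sum> y\<^sub>\<alpha> Y\<^sub>\<alpha>) exp (\<Sum> x\<^sub>\<beta> X\<^sub>\<beta>)\<close>. Only the values of \<open>f\<close> on \<open>N\<close> are relevant.
\<close>

definition smooth_N ::
  "('g::euclidean_space \<Rightarrow> 'g \<Rightarrow> 'g) \<Rightarrow> 'g set \<Rightarrow> ('g \<Rightarrow> real) set \<Rightarrow> ('g \<Rightarrow> real) \<Rightarrow>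
   (('g \<Rightarrow> real) \<Rightarrow> 'g) \<Rightarrow> (('g \<Rightarrow> 'g) \<Rightarrow> real) set" where
  "smooth_N br \<aa> \<Sigma>p \<omega> X = {f. \<forall>k. Ck_on k
     (span {X \<omega>} \<times> span (X ` sigma_half br \<aa> \<Sigma>p \<omega>) \<times> span (X ` sigma_zero br \<aa> \<Sigma>p \<omega>))
     (\<lambda>(z, y, x). f (Exp br z \<circ> Exp br y \<circ> Exp br x))}"

definition tau ::
  "('g::euclidean_space \<Rightarrow> 'g \<Rightarrow> 'g) \<Rightarrow> ('g \<Rightarrow> 'g) \<Rightarrow> 'g set \<Rightarrow> ('g \<Rightarrow> real) set \<Rightarrow>
   'g \<Rightarrow> (('g \<Rightarrow> 'g) \<Rightarrow> real) \<Rightarrow> ('g \<Rightarrow> 'g) \<Rightarrow> real" where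
  "tau br \<theta> \<aa> \<Sigma>p V f n = deriv (\<lambda>t. f (N_part br \<theta> \<aa> \<Sigma>p (Exp br (t *\<^sub>R V) \<circ> n))) 0"

definition left_invariant ::
  "('g::euclidean_space \<Rightarrow> 'g \<Rightarrow> 'g) \<Rightarrow> 'g \<Rightarrow> (('g \<Rightarrow> 'g) \<Rightarrow> real) \<Rightarrow> ('g \<Rightarrow> 'g) \<Rightarrow> real" where
  "left_invariant br Y f n = deriv (\<lambda>t. f (n \<circ> Exp br (t *\<^sub>R Y))) 0"

text \<open>
  The coefficient at \<open>n\<close> of \<open>Z = X \<omega>\<close> in the expansion of the vector field \<open>tau V\<close> in the basis
  of left-invariant vector fields given by \<open>Z\<close>, the \<open>Y\<^sub>\<alpha>\<close> and the \<open>X\<^sub>\<beta>\<close>; vector fields are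
  identified with their action on smooth functions.
\<close>

definition Z_coeff ::
  "('g::euclidean_space \<Rightarrow> 'g \<Rightarrow> 'g) \<Rightarrow> ('g \<Rightarrow> 'g) \<Rightarrow> 'g set \<Rightarrow> ('g \<Rightarrow> real) set \<Rightarrow> ('g \<Rightarrow> real) \<Rightarrow>
   (('g \<Rightarrow> real) \<Rightarrow> 'g) \<Rightarrow> 'g \<Rightarrow> ('g \<Rightarrow> 'g) \<Rightarrow> real" where
  "Z_coeff br \<theta> \<aa> \<Sigma>p \<omega> X V n = (THE q. \<exists>r s. \<forall>f\<in>smooth_N br \<aa> \<Sigma>p \<omega> X.
     tau br \<theta> \<aa> \<Sigma>p V f n = q * left_invariant br (X \<omega>) f n
       + (\<Sum>\<alpha>\<in>sigma_half br \<aa> \<Sigma>p \<omega>. r \<alpha> * left_invariant br (X \<alpha>) f n)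
       + (\<Sum>\<beta>\<in>sigma_zero br \<aa> \<Sigma>p \<omega>. s \<beta> * left_invariant br (X \<beta>) f n))"

definition H_system ::
  "('g::euclidean_space \<Rightarrow> 'g \<Rightarrow> 'g) \<Rightarrow> 'g set \<Rightarrow> ('g \<Rightarrow> real) \<Rightarrow> ('g \<Rightarrow> real) set \<Rightarrow>
   ('g \<Rightarrow> real) \<Rightarrow> 'g \<Rightarrow> bool" where
  "H_system br \<aa> \<omega> R \<gamma> H \<longleftrightarrow> H \<in> \<aa> \<and> \<omega> H = - \<omega> (Hvec br \<aa> \<gamma>) \<and>
     (\<forall>\<alpha>\<in>R. 3 * \<alpha> H - \<omega> H = - \<alpha> (Hvec br \<aa> \<gamma>))"

definition H_sol ::
  "('g::euclidean_space \<Rightarrow> 'g \<Rightarrow> 'g) \<Rightarrow> 'g set \<Rightarrow> ('g \<Rightarrow> real) \<Rightarrow> ('g \<Rightarrow> real) set \<Rightarrow> ('g \<Rightarrow> real) \<Rightarrow> 'g"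
  where "H_sol br \<aa> \<omega> R \<gamma> = (THE H. H_system br \<aa> \<omega> R \<gamma> H)"

end

(*
  The function multiplying Z is p^V(n) = B(V, u) with u = n X_{-omega}. Since n fixes X_omega, the
  point u of the orbit of the lowest root vector satisfies (ad u)^2 X_omega = -(omega,omega) u;
  pairing this with X_{-gamma} gives the formula with H(gamma) = -(H_omega + H_gamma)/3, which
  solves the linear system; the solution is unique because an element of the Cartan subspace
  killed by omega and Sigma_{1/2} lies in a proper ideal.

  The identity p^V(n) = B(V, n X_{-omega}) needs the decomposition exp(tW) in N A N^- for small t.
  It is an LU factorisation with respect to the eigenvalues of ad xi, xi regular in the Cartan
  subspace: uniqueness of the factors forces them to be automorphisms. A unipotent automorphism m
  is determined by m xi, and the coordinates of m are polynomials in m xi, so all derivatives along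
  curves in N can be computed on the orbit of xi.
*)

theory Submission
  imports Defs
begin

section \<open>Exponentials of linear maps\<close>

text \<open>The definitions offer linear maps of the Lie algebra but no manifold structure on
  Int(g), N or P: \<open>N_part\<close> and \<open>Z_coeff\<close> are definite descriptions and
  \<open>tau\<close> is a bare \<open>deriv\<close>. Existence and uniqueness of the factorisation,
  differentiability of its N-component and uniqueness of the coefficient of Z are therefore all
  obtained by linear algebra. Test functions are smooth only in the chart, so a derivative along a
  curve m(t) needs the chart coordinates of m(t). Weights have positive gaps and are bounded, so a
  Newton-type iteration for these coordinates stops after finitely many steps. The lower triangular
  factor is placed in P as follows: near the identity its diagonal entries are positive, their
  logarithms define a derivation, and derivations are inner; so its diagonal part is exp(ad H) with
  H in the Cartan subspace and the component in M is trivial. The factor 1/3: in the paired identity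
  the H_\<omega>-part of [u, X_\<omega>] returns the unknown coefficient with factor -\<kappa>/2,
  against \<kappa> on the left, where \<kappa> = (\<omega>,\<omega>). Collecting both gives
  3\<kappa>/2, while the sum carries \<kappa>/2.\<close>

lemma has_vector_derivative_inner_Basis:
  fixes f :: "real \<Rightarrow> 'g::euclidean_space"
  assumes "\<And>b. b \<in> Basis \<Longrightarrow> ((\<lambda>t. f t \<bullet> b) has_real_derivative d \<bullet> b) (at t within S)"
  shows "(f has_vector_derivative d) (at t within S)"
  unfolding has_vector_derivative_def
  by (subst has_derivative_componentwise_within)
     (use assms in \<open>auto simp: has_field_derivative_def mult_commute_abs\<close>)

lemma funpow_scaleR:
  fixes D :: "'g::real_vector \<Rightarrow> 'g"
  assumes "linear D"
  shows "((\<lambda>x. t *\<^sub>R D x) ^^ k) v = t ^ k *\<^sub>R (D ^^ k) v"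
  using assms by (induction k) (auto simp: linear_cmul)

lemma linear_funpow: "linear D \<Longrightarrow> linear (D ^^ k)" for D :: "'g::real_vector \<Rightarrow> 'g"
  by (induction k) (auto simp: linear_id linear_compose id_def[symmetric] comp_def[symmetric])

lemma funpow_norm_bound:
  fixes D :: "'g::euclidean_space \<Rightarrow> 'g"
  assumes "linear D"
  obtains M where "M > 0" "\<And>k v. norm ((D ^^ k) v) \<le> M ^ k * norm v"
proof -
  obtain M where M: "M > 0" "\<And>x. norm (D x) \<le> M * norm x"
    using linear_bounded_pos[OF assms] by auto
  have "norm ((D ^^ k) v) \<le> M ^ k * norm v" for k v
  proof (induction k)
    case (Suc k)
    have "norm ((D ^^ Suc k) v) \<le> M * norm ((D ^^ k) v)" using M(2) by simp
    also have "\<dots> \<le> M * (M ^ k * norm v)" using Suc M(1) by simp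
    finally show ?case by simp
  qed simp
  with M(1) that show thesis by blast
qed

lemma op_exp_summable:
  fixes D :: "'g::euclidean_space \<Rightarrow> 'g"
  assumes "linear D"
  shows "summable (\<lambda>k. (D ^^ k) v /\<^sub>R fact k)"
proof -
  obtain M where M: "M > 0" "\<And>k v. norm ((D ^^ k) v) \<le> M ^ k * norm v"
    using funpow_norm_bound[OF assms] by blast
  have "summable (\<lambda>k. norm v * (inverse (fact k) * M ^ k))"
    by (intro summable_mult summable_exp)
  then show ?thesis
    by (rule summable_comparison_test') (use M in \<open>auto simp: field_simps\<close>)
qed

lemma op_exp_linear:
  fixes D :: "'g::euclidean_space \<Rightarrow> 'g"
  assumes "linear D"
  shows "linear (op_exp D)"
proof (rule linearI)
  note l = linear_funpow[OF assms]
  fix x y :: 'g and r :: real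
  show "op_exp D (x + y) = op_exp D x + op_exp D y"
    unfolding op_exp_def
    by (subst suminf_add[OF op_exp_summable[OF assms] op_exp_summable[OF assms]])
       (simp add: linear_add[OF l] algebra_simps)
  show "op_exp D (r *\<^sub>R x) = r *\<^sub>R op_exp D x"
    unfolding op_exp_def
    by (subst suminf_scaleR_right[OF op_exp_summable[OF assms]])
       (simp add: linear_cmul[OF l] algebra_simps)
qed

text \<open>An intertwining map passes through the exponential series term by term. With
  \<open>A\<close> the generator itself this serves to differentiate the exponential; with
  \<open>A\<close> an automorphism it conjugates exponentials in the group.\<close>

lemma op_exp_conj:
  fixes D A :: "'g::euclidean_space \<Rightarrow> 'g"
  assumes "linear D" "linear A" "linear E" "\<And>x. A (D x) = E (A x)"
  shows "A (op_exp D v) = op_exp E (A v)"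
proof -
  have c: "A ((D ^^ k) x) = (E ^^ k) (A x)" for k x
    by (induction k) (auto simp: assms(4))
  have "A (op_exp D v) = (\<Sum>k. A ((D ^^ k) v /\<^sub>R fact k))"
    unfolding op_exp_def
    using bounded_linear.suminf[OF _ op_exp_summable[OF assms(1)], of A] assms(2)
    by (simp add: linear_conv_bounded_linear)
  then show ?thesis by (simp add: c linear_cmul[OF assms(2)] op_exp_def)
qed

lemma op_exp_0 [simp]: "op_exp (\<lambda>x. 0) v = v"
proof -
  have *: "((\<lambda>x. 0) ^^ k) v /\<^sub>R fact k = (if k = 0 then v else 0)" for k
    by (cases k) auto
  show ?thesis unfolding op_exp_def *
    using suminf_finite[of "{0}" "\<lambda>k::nat. if k = 0 then v else 0"] by simp
qed

lemma op_exp_inner: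
  fixes D :: "'g::euclidean_space \<Rightarrow> 'g"
  assumes "linear D"
  shows "(\<lambda>k. ((D ^^ k) v \<bullet> b / fact k) * t ^ k) sums (op_exp (\<lambda>x. t *\<^sub>R D x) v \<bullet> b)"
proof -
  have l: "linear (\<lambda>x. t *\<^sub>R D x)" using assms by (simp add: linear_compose_scale_right)
  have "(\<lambda>k. ((\<lambda>x. t *\<^sub>R D x) ^^ k) v /\<^sub>R fact k) sums op_exp (\<lambda>x. t *\<^sub>R D x) v"
    unfolding op_exp_def using op_exp_summable[OF l] by (rule summable_sums)
  from bounded_linear.sums[OF bounded_linear_inner_left this, of b]
  show ?thesis by (simp add: funpow_scaleR[OF assms] field_simps)
qed

text \<open>Each coordinate is an everywhere convergent power series in t, so it may be
  differentiated termwise. \<open>diffs\<close> yields the coefficients belonging to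
  \<open>D v\<close>, and D commutes with its exponential.\<close>

lemma op_exp_has_vector_derivative:
  fixes D :: "'g::euclidean_space \<Rightarrow> 'g"
  assumes "linear D"
  shows "((\<lambda>t. op_exp (\<lambda>x. t *\<^sub>R D x) v) has_vector_derivative
           D (op_exp (\<lambda>x. t *\<^sub>R D x) v)) (at t)"
proof (rule has_vector_derivative_inner_Basis)
  fix b :: 'g assume "b \<in> Basis"
  define a where "a = (\<lambda>k. (D ^^ k) v \<bullet> b / fact k)"
  have f: "(\<lambda>t. op_exp (\<lambda>x. t *\<^sub>R D x) v \<bullet> b) = (\<lambda>t. \<Sum>k. a k * t ^ k)"
    using op_exp_inner[OF assms, of v b] unfolding a_def by (auto simp: sums_iff)
  have l: "linear (\<lambda>x. t *\<^sub>R D x)" using assms by (simp add: linear_compose_scale_right)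
  have "D (op_exp (\<lambda>x. t *\<^sub>R D x) v) = op_exp (\<lambda>x. t *\<^sub>R D x) (D v)"
    by (rule op_exp_conj[OF l assms l]) (simp add: linear_cmul[OF assms])
  then have "D (op_exp (\<lambda>x. t *\<^sub>R D x) v) \<bullet> b = (\<Sum>k. ((D ^^ k) (D v) \<bullet> b / fact k) * t ^ k)"
    using op_exp_inner[OF assms, of "D v" b t] by (auto simp: sums_iff)
  also have "(\<lambda>k. ((D ^^ k) (D v) \<bullet> b / fact k)) = diffs a"
    by (auto simp: diffs_def a_def fun_eq_iff funpow_swap1 field_simps
             simp del: of_nat_Suc)
  finally have d: "D (op_exp (\<lambda>x. t *\<^sub>R D x) v) \<bullet> b = (\<Sum>k. diffs a k * t ^ k)" .
  have s: "summable (\<lambda>k. a k * y ^ k)" for y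
    using op_exp_inner[OF assms, of v b y] unfolding a_def by (auto simp: sums_iff)
  show "((\<lambda>t. op_exp (\<lambda>x. t *\<^sub>R D x) v \<bullet> b) has_real_derivative D (op_exp (\<lambda>x. t *\<^sub>R D x) v) \<bullet> b) (at t)"
    unfolding f d by (rule termdiffs_strong_converges_everywhere[OF s])
qed

text \<open>Uniqueness for linear differential equations: \<open>exp (-2Mt) |x|\<^sup>2\<close> decreases when \<open>M\<close> bounds \<open>D\<close>.\<close>

lemma linear_ode_zero:
  fixes D :: "'g::euclidean_space \<Rightarrow> 'g"
  assumes "linear D" and "x 0 = 0"
    and x: "\<And>t. (x has_vector_derivative D (x t)) (at t)"
  shows "x 1 = 0"
proof -
  obtain M where M: "M > 0" "\<And>x. norm (D x) \<le> M * norm x"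
    using linear_bounded_pos[OF assms(1)] by auto
  define u where "u = (\<lambda>t. (x t \<bullet> x t) * exp (- (2 * M * t)))"
  have "\<exists>y. DERIV u t :> y \<and> y \<le> 0" for t
  proof -
    have "((\<lambda>t. x t \<bullet> x t) has_vector_derivative (x t \<bullet> D (x t) + D (x t) \<bullet> x t)) (at t)"
      by (rule bounded_bilinear.has_vector_derivative[OF bounded_bilinear_inner x x])
    then have "((\<lambda>t. x t \<bullet> x t) has_real_derivative (2 * (x t \<bullet> D (x t)))) (at t)"
      by (simp add: has_real_derivative_iff_has_vector_derivative inner_commute)
    then have "DERIV u t :> 2 * (x t \<bullet> D (x t)) * exp (- (2 * M * t))
                 + (x t \<bullet> x t) * (exp (- (2 * M * t)) * - (2 * M))"
      unfolding u_def by (auto intro!: derivative_eq_intros)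
    moreover have "x t \<bullet> D (x t) \<le> M * (x t \<bullet> x t)"
    proof -
      have "x t \<bullet> D (x t) \<le> norm (x t) * norm (D (x t))" by (rule norm_cauchy_schwarz)
      also have "\<dots> \<le> norm (x t) * (M * norm (x t))" by (intro mult_left_mono M) auto
      finally show ?thesis by (simp add: power2_norm_eq_inner[symmetric] power2_eq_square ac_simps)
    qed
    then have "2 * (x t \<bullet> D (x t)) * exp (- (2 * M * t))
                 \<le> 2 * (M * (x t \<bullet> x t)) * exp (- (2 * M * t))"
      by (intro mult_right_mono mult_left_mono) auto
    ultimately show ?thesis by (intro exI conjI) (auto simp: algebra_simps)
  qed
  then have "u 1 \<le> u 0"
    by (intro DERIV_nonpos_imp_nonincreasing[of 0 1 u]) auto
  then have "x 1 \<bullet> x 1 \<le> 0" unfolding u_def using assms(2) by (simp add: mult_le_0_iff)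
  moreover have "x 1 \<bullet> x 1 \<ge> 0" by simp
  ultimately show ?thesis by (metis inner_eq_zero_iff order_antisym)
qed

lemma op_exp_minus_cancel:
  fixes D :: "'g::euclidean_space \<Rightarrow> 'g"
  assumes "linear D"
  shows "op_exp D (op_exp (\<lambda>x. - D x) v) = v"
proof -
  define w where "w = op_exp (\<lambda>x. - D x) v"
  \<comment> \<open>Both terms solve the same linear equation and have the value w at t = 0; at t =
    1 they are exp(D) w and v. Uniqueness replaces a multiplication of series.\<close>
  define x where "x = (\<lambda>t. op_exp (\<lambda>y. t *\<^sub>R D y) w - op_exp (\<lambda>y. (t - 1) *\<^sub>R D y) v)"
  have "x 1 = 0"
  proof (rule linear_ode_zero[OF assms])
    show "x 0 = 0" by (simp add: x_def w_def)
    fix t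
    have "((\<lambda>s. op_exp (\<lambda>y. s *\<^sub>R D y) v) \<circ> (\<lambda>t. t - 1) has_vector_derivative
        1 *\<^sub>R D (op_exp (\<lambda>y. (t - 1) *\<^sub>R D y) v)) (at t)"
      by (rule vector_diff_chain_at[OF _ op_exp_has_vector_derivative[OF assms]])
         (auto intro!: derivative_eq_intros)
    then have "((\<lambda>t. op_exp (\<lambda>y. (t - 1) *\<^sub>R D y) v) has_vector_derivative
        D (op_exp (\<lambda>y. (t - 1) *\<^sub>R D y) v)) (at t)" by (simp add: o_def)
    from has_vector_derivative_diff[OF op_exp_has_vector_derivative[OF assms] this]
    show "(x has_vector_derivative D (x t)) (at t)"
      unfolding x_def by (simp add: linear_diff[OF assms])
  qed
  then show ?thesis by (simp add: x_def w_def)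
qed

section \<open>Automorphisms and inner exponentials of a Lie algebra\<close>

locale lie_algebra =
  fixes br :: "'g::euclidean_space \<Rightarrow> 'g \<Rightarrow> 'g"
  assumes lie: "lie_bracket br"
begin

lemma bil: "bilinear br" and br_self [simp]: "br x x = 0"
  and jacobi: "br x (br y z) + br y (br z x) + br z (br x y) = 0"
  using lie unfolding lie_bracket_def by auto

lemma br_linear_right: "linear (br x)" and br_linear_left: "linear (\<lambda>x. br x y)"
  using bil unfolding bilinear_def by auto

lemma br_bounded_bilinear: "bounded_bilinear br"
  using bil bilinear_conv_bounded_bilinear by blast

lemmas br_add_left = bilinear_ladd[OF bil] and br_add_right = bilinear_radd[OF bil]
  and br_diff_left = bilinear_lsub[OF bil] and br_diff_right = bilinear_rsub[OF bil]
  and br_minus_left [simp] = bilinear_lneg[OF bil] and br_minus_right [simp] = bilinear_rneg[OF bil]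
  and br_scale_left [simp] = bilinear_lmul[OF bil] and br_scale_right [simp] = bilinear_rmul[OF bil]
  and br_zero_left [simp] = bilinear_lzero[OF bil] and br_zero_right [simp] = bilinear_rzero[OF bil]

lemma br_sum_left: "br (\<Sum>i\<in>I. f i) y = (\<Sum>i\<in>I. br (f i) y)"
  using linear_sum[OF br_linear_left] .

lemma br_sum_right: "br x (\<Sum>i\<in>I. f i) = (\<Sum>i\<in>I. br x (f i))"
  using linear_sum[OF br_linear_right] .

lemma br_antisym: "br x y = - br y x"
proof -
  have "br (x + y) (x + y) = 0" by simp
  then show ?thesis by (simp add: br_add_left br_add_right eq_neg_iff_add_eq_0 del: br_self)
       (simp add: add.commute)
qed

lemma br_derivation: "br x (br y z) = br (br x y) z + br y (br x z)"
proof -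
  have "br y (br z x) = - br y (br x z)" by (subst br_antisym[of z x]) simp
  moreover have "br z (br x y) = - br (br x y) z" by (rule br_antisym)
  ultimately show ?thesis using jacobi[of x y z] by (simp add: algebra_simps)
qed

definition automorphisms :: "('g \<Rightarrow> 'g) set" where
  "automorphisms = {g. linear g \<and> bij g \<and> (\<forall>x y. g (br x y) = br (g x) (g y))}"

lemma automorphismsD:
  assumes "g \<in> automorphisms"
  shows "linear g" "bij g" "g (br x y) = br (g x) (g y)"
  using assms unfolding automorphisms_def by auto

lemma automorphisms_comp: "g \<in> automorphisms \<Longrightarrow> h \<in> automorphisms \<Longrightarrow> g \<circ> h \<in> automorphisms"
  unfolding automorphisms_def by (auto simp: linear_compose bij_comp)

lemma automorphisms_id: "id \<in> automorphisms"
  unfolding automorphisms_def by (simp add: linear_id)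

lemma automorphisms_inv:
  assumes "g \<in> automorphisms"
  shows "inv g \<in> automorphisms"
proof -
  note g = automorphismsD[OF assms]
  have s: "surj g" "inj g" using g(2) by (auto simp: bij_def)
  have "linear (inv g)" using g(1) s(2) s(1) inj_linear_imp_inv_linear by blast
  moreover have "inv g (br x y) = br (inv g x) (inv g y)" for x y
  proof -
    have "g (br (inv g x) (inv g y)) = br x y" by (simp add: g(3) surj_f_inv_f[OF s(1)])
    then show ?thesis using inv_f_f[OF s(2)] by metis
  qed
  ultimately show ?thesis unfolding automorphisms_def using bij_imp_bij_inv[OF g(2)] by simp
qed

lemma Exp_linear: "linear (Exp br x)"
  by (rule op_exp_linear[OF br_linear_right])

lemma Exp_scale: "Exp br (t *\<^sub>R x) = op_exp (\<lambda>y. t *\<^sub>R br x y)"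
  by (rule arg_cong[of _ _ op_exp]) auto

lemma Exp_minus_cancel: "Exp br x (Exp br (- x) v) = v"  "Exp br (- x) (Exp br x v) = v"
proof -
  show *: "Exp br x (Exp br (- x) v) = v" for x
    using op_exp_minus_cancel[OF br_linear_right[of x], of v]
    by (simp add: bilinear_lneg[OF bil, abs_def])
  show "Exp br (- x) (Exp br x v) = v" using *[of "- x"] by simp
qed

lemma Exp_0 [simp]: "Exp br 0 = id"
  by (rule ext) (simp add: bilinear_lzero[OF bil, abs_def])

lemma Exp_has_vector_derivative:
  "((\<lambda>t. Exp br (t *\<^sub>R x) v) has_vector_derivative br x (Exp br (t *\<^sub>R x) v)) (at t)"
  unfolding Exp_scale by (rule op_exp_has_vector_derivative[OF br_linear_right])

text \<open>Since ad x is a derivation, both sides, with t x in place of x, solve the same linear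
  differential equation with the same initial value.\<close>

lemma Exp_bracket: "Exp br x (br a b) = br (Exp br x a) (Exp br x b)"
proof -
  define u where "u = (\<lambda>t. br (Exp br (t *\<^sub>R x) a) (Exp br (t *\<^sub>R x) b) - Exp br (t *\<^sub>R x) (br a b))"
  have "u 1 = 0"
  proof (rule linear_ode_zero[OF br_linear_right[of x]])
    show "u 0 = 0" by (simp add: u_def)
    show "(u has_vector_derivative br x (u t)) (at t)" for t
      unfolding u_def br_diff_right br_derivation[of x "Exp br (t *\<^sub>R x) a"]
      by (subst add.commute)
         (intro has_vector_derivative_diff
           bounded_bilinear.has_vector_derivative[OF br_bounded_bilinear] Exp_has_vector_derivative)
  qed
  then show ?thesis by (simp add: u_def)
qed

lemma Exp_automorphism: "Exp br x \<in> automorphisms"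
  unfolding automorphisms_def
  by (auto simp: Exp_linear Exp_bracket intro!: o_bij[of "Exp br (- x)"])
     (auto simp: fun_eq_iff Exp_minus_cancel)

lemma int_group_automorphisms: "g \<in> int_group br \<Longrightarrow> g \<in> automorphisms"
  by (induction rule: int_group.induct)
     (rule automorphisms_id automorphisms_comp Exp_automorphism | assumption)+

lemma automorphism_Exp:
  assumes "g \<in> automorphisms"
  shows "g (Exp br x v) = Exp br (g x) (g v)"
  by (rule op_exp_conj[OF br_linear_right automorphismsD(1)[OF assms] br_linear_right])
     (rule automorphismsD(3)[OF assms])

end

section \<open>Graded Lie algebras and unipotent automorphisms\<close>

lemma polynomial_function_bilinear:
  fixes f :: "'a::euclidean_space \<Rightarrow> 'b::euclidean_space \<Rightarrow> 'c::euclidean_space"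
  assumes f: "bilinear f" and p: "polynomial_function p" and q: "polynomial_function q"
  shows "polynomial_function (\<lambda>x. f (p x) (q x))"
proof -
  have "f (p x) (q x) = (\<Sum>b\<in>Basis. \<Sum>c\<in>Basis. ((p x \<bullet> b) * (q x \<bullet> c)) *\<^sub>R f b c)" for x
  proof -
    have "f (p x) (q x) = f (\<Sum>b\<in>Basis. (p x \<bullet> b) *\<^sub>R b) (\<Sum>c\<in>Basis. (q x \<bullet> c) *\<^sub>R c)"
      by (simp add: euclidean_representation)
    then show ?thesis
      by (simp add: bilinear_sum[OF f] bilinear_lmul[OF f] bilinear_rmul[OF f]
          sum.cartesian_product mult.commute)
  qed
  moreover have "polynomial_function (\<lambda>x. \<Sum>b\<in>Basis. \<Sum>c\<in>Basis. ((p x \<bullet> b) * (q x \<bullet> c)) *\<^sub>R f b c)"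
    using p q
    by (intro polynomial_function_sum polynomial_function_mult polynomial_function_const finite_Basis)
       (auto simp: real_polynomial_function_eq[symmetric] polynomial_function_iff_Basis_inner
             intro: real_polynomial_function.intros)
  ultimately show ?thesis by (simp add: fun_eq_iff)
qed

text \<open>The eigenspace decomposition of ad \<xi>, encoded by its projections
  \<open>\<pi> h\<close>; these are indexed by all reals, so sums of weights need no membership
  check. \<open>\<Lambda>\<close> is any finite set containing the eigenvalues. The locale is
  instantiated both at a regular element and at its negative.\<close>

locale graded_lie = lie_algebra br for br :: "'g::euclidean_space \<Rightarrow> 'g \<Rightarrow> 'g" +
  fixes \<xi> :: 'g and \<Lambda> :: "real set" and \<pi> :: "real \<Rightarrow> 'g \<Rightarrow> 'g"
  assumes fin: "finite \<Lambda>"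
    and pi_linear: "linear (\<pi> h)"
    and pi_sum: "(\<Sum>h\<in>\<Lambda>. \<pi> h v) = v"
    and pi_eig: "br \<xi> (\<pi> h v) = h *\<^sub>R \<pi> h v"
    and pi_out: "h \<notin> \<Lambda> \<Longrightarrow> \<pi> h v = 0"
    and pi_pi: "\<pi> h (\<pi> k v) = (if h = k then \<pi> k v else 0)"
begin

text \<open>The sum of the eigenspaces with eigenvalue in S. The description by vanishing components
  allows S to contain numbers that are not weights, such as half-lines.\<close>

definition W :: "real set \<Rightarrow> 'g set" where "W S = {v. \<forall>h. h \<notin> S \<longrightarrow> \<pi> h v = 0}"

definition pr :: "real set \<Rightarrow> 'g \<Rightarrow> 'g" where "pr S v = (\<Sum>h\<in>\<Lambda> \<inter> S. \<pi> h v)"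

lemmas pi_add = linear_add[OF pi_linear] and pi_diff = linear_diff[OF pi_linear]
  and pi_cmul = linear_cmul[OF pi_linear] and pi_0 [simp] = linear_0[OF pi_linear]
  and pi_sum_distrib = linear_sum[OF pi_linear]

lemma subspace_W: "subspace (W S)"
  unfolding W_def subspace_def by (auto simp: pi_add pi_cmul)

lemmas W_add = subspace_add[OF subspace_W] and W_diff = subspace_diff[OF subspace_W]
  and W_scale = subspace_scale[OF subspace_W] and W_0 [simp] = subspace_0[OF subspace_W]
  and W_sum = subspace_sum[OF subspace_W] and W_neg = subspace_neg[OF subspace_W]

lemma W_mono: "v \<in> W S \<Longrightarrow> S \<subseteq> T \<Longrightarrow> v \<in> W T"
  unfolding W_def by auto

lemma W_Int: "v \<in> W S \<Longrightarrow> v \<in> W T \<Longrightarrow> S \<inter> T = {} \<Longrightarrow> v = 0"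
proof -
  assume a: "v \<in> W S" "v \<in> W T" "S \<inter> T = {}"
  have "\<pi> h v = 0" for h using a unfolding W_def by (cases "h \<in> S") auto
  then show "v = 0" using pi_sum[of v] by simp
qed

lemma W_Lambda: "v \<in> W \<Lambda>"
  unfolding W_def by (auto simp: pi_out)

lemma W_mono': "v \<in> W S \<Longrightarrow> S \<inter> \<Lambda> \<subseteq> T \<Longrightarrow> v \<in> W T"
  unfolding W_def using pi_out by auto

lemma pi_in_W: "\<pi> h v \<in> W {h}"
  unfolding W_def by (auto simp: pi_pi)

lemma pr_linear: "linear (pr S)"
  unfolding pr_def by (intro linear_compose_sum ballI pi_linear)

lemma pi_pr: "\<pi> h (pr S v) = (if h \<in> S then \<pi> h v else 0)"
  unfolding pr_def using fin by (auto simp: pi_sum_distrib pi_pi sum.delta pi_out)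

lemma pr_in_W: "pr S v \<in> W S"
  unfolding W_def by (auto simp: pi_pr)

lemma eq_by_pi:
  assumes "\<And>h. \<pi> h v = \<pi> h w"
  shows "v = w"
proof -
  have "(\<Sum>h\<in>\<Lambda>. \<pi> h v) = (\<Sum>h\<in>\<Lambda>. \<pi> h w)" by (rule sum.cong[OF refl assms])
  then show ?thesis by (simp only: pi_sum)
qed

lemma pr_id: "v \<in> W S \<Longrightarrow> pr S v = v"
  by (rule eq_by_pi) (auto simp: pi_pr W_def)

lemma pr_0: "v \<in> W T \<Longrightarrow> S \<inter> T = {} \<Longrightarrow> pr S v = 0"
  by (rule eq_by_pi) (auto simp: pi_pr W_def)

lemma pr_compl: "S \<inter> T = {} \<Longrightarrow> S \<union> T = UNIV \<Longrightarrow> v = pr S v + pr T v"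
  by (rule eq_by_pi) (auto simp: pi_pr pi_add)

lemma W_compl: "pr S v = 0 \<Longrightarrow> S \<union> T = UNIV \<Longrightarrow> v \<in> W T"
proof -
  assume a: "pr S v = 0" "S \<union> T = UNIV"
  have "\<pi> h v = 0" if "h \<notin> T" for h
    using pi_pr[of h S v] a that by (auto simp: set_eq_iff split: if_splits)
  then show "v \<in> W T" by (simp add: W_def)
qed

lemma pi_xi: "\<pi> h (br \<xi> v) = h *\<^sub>R \<pi> h v"
proof -
  have "br \<xi> v = (\<Sum>k\<in>\<Lambda>. k *\<^sub>R \<pi> k v)"
    by (subst pi_sum[of v, symmetric]) (simp add: br_sum_right pi_eig)
  then show ?thesis using fin by (auto simp: pi_sum_distrib pi_cmul pi_pi sum.delta if_distrib pi_out cong: if_cong)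
qed

lemma W_eig: "v \<in> W {h} \<longleftrightarrow> br \<xi> v = h *\<^sub>R v"
proof
  assume "v \<in> W {h}"
  then have e: "\<pi> h v = v" by - (rule eq_by_pi, auto simp: W_def pi_pi)
  show "br \<xi> v = h *\<^sub>R v" using pi_eig[of h v] by (simp only: e)
next
  assume a: "br \<xi> v = h *\<^sub>R v"
  have "\<pi> k v = 0" if "k \<noteq> h" for k
  proof -
    have "k *\<^sub>R \<pi> k v = h *\<^sub>R \<pi> k v" using pi_xi[of k v] unfolding a pi_cmul by (rule sym)
    then show ?thesis using that scaleR_cancel_right by metis
  qed
  then show "v \<in> W {h}" by (auto simp: W_def)
qed

lemma xi_W0: "\<xi> \<in> W {0}" by (simp add: W_eig)

text \<open>ad \<xi> is a derivation, so eigenvalues add under the bracket; the general case follows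
  by expanding both arguments into components.\<close>

lemma W_br:
  assumes "x \<in> W S" "y \<in> W T" "\<And>s t. s \<in> S \<Longrightarrow> t \<in> T \<Longrightarrow> s + t \<in> U"
  shows "br x y \<in> W U"
proof -
  have "br (\<pi> h x) (\<pi> k y) \<in> W U" for h k
  proof (cases "h \<in> S \<and> k \<in> T")
    case True
    have "br (\<pi> h x) (\<pi> k y) \<in> W {h + k}"
      unfolding W_eig by (simp add: br_derivation pi_eig scaleR_left_distrib)
    then show ?thesis by (rule W_mono) (use True assms(3) in auto)
  next
    case False
    then have "\<pi> h x = 0 \<or> \<pi> k y = 0" using assms(1,2) by (auto simp: W_def)
    then show ?thesis by auto
  qed
  then have "(\<Sum>h\<in>\<Lambda>. \<Sum>k\<in>\<Lambda>. br (\<pi> h x) (\<pi> k y)) \<in> W U" by (intro W_sum)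
  also have "(\<Sum>h\<in>\<Lambda>. \<Sum>k\<in>\<Lambda>. br (\<pi> h x) (\<pi> k y)) = br x y"
    by (simp add: br_sum_right[symmetric] br_sum_left[symmetric] pi_sum)
  finally show ?thesis .
qed

section \<open>Filtration by weights and truncated exponentials\<close>

abbreviation F :: "real \<Rightarrow> 'g set" where "F r \<equiv> W {r..}"

definition gaps :: "real set" where
  "gaps = (\<lambda>(a, b). \<bar>a - b\<bar>) ` (insert 0 \<Lambda> \<times> insert 0 \<Lambda>) - {0}"

text \<open>A lower bound for the distance of distinct weights, with 0 counted among them so that
  every positive weight is at least \<epsilon>. The extra 1 keeps the set nonempty.\<close>

definition \<epsilon> :: real where "\<epsilon> = Min (insert 1 gaps)"

lemma finite_gaps: "finite gaps"
  using fin unfolding gaps_def by (intro finite_Diff finite_imageI finite_cartesian_product) auto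

lemma eps_pos: "\<epsilon> > 0"
proof -
  have "\<forall>x\<in>insert 1 gaps. 0 < x" by (auto simp: gaps_def)
  then show ?thesis unfolding \<epsilon>_def using finite_gaps by (subst Min_gr_iff) simp_all
qed

lemma eps_gap:
  assumes "a \<in> insert 0 \<Lambda>" "b \<in> insert 0 \<Lambda>" "a < b"
  shows "a + \<epsilon> \<le> b"
proof -
  have "\<bar>a - b\<bar> \<in> gaps"
    unfolding gaps_def using assms by (intro DiffI image_eqI[of _ _ "(a, b)"] SigmaI) auto
  then have "\<epsilon> \<le> \<bar>a - b\<bar>" unfolding \<epsilon>_def using finite_gaps by (intro Min_le) simp_all
  then show ?thesis using assms by simp
qed

lemma W_gap: "h \<in> insert 0 \<Lambda> \<Longrightarrow> v \<in> W {h<..} \<Longrightarrow> v \<in> F (h + \<epsilon>)"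
  by (erule W_mono') (use eps_gap in auto)

lemma F_eps: "F \<epsilon> = W {0<..}"
  using W_gap[of 0] eps_pos by (auto intro: W_mono)

definition bot_h :: real where "bot_h = Min (insert 0 \<Lambda>)"

text \<open>This many steps of size \<epsilon> lead from the lowest weight beyond the highest one.
  The summand 2 also ensures that a sum over k < \<open>len\<close> contains the terms of index 0
  and 1, as \<open>len_split\<close> requires.\<close>

definition len :: nat where
  "len = nat \<lceil>(Max (insert 0 \<Lambda>) - bot_h) / \<epsilon>\<rceil> + 2"

lemma F_bot: "v \<in> F bot_h"
  by (rule W_mono'[OF W_Lambda]) (use fin in \<open>auto simp: bot_h_def\<close>)

lemma bot_le: "bot_h \<le> 0" using fin by (auto simp: bot_h_def)

lemma F_top: "v \<in> F r \<Longrightarrow> bot_h + real len * \<epsilon> \<le> r \<Longrightarrow> v = 0"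
proof -
  assume v: "v \<in> F r" "bot_h + real len * \<epsilon> \<le> r"
  have "(Max (insert 0 \<Lambda>) - bot_h) / \<epsilon> < real len" unfolding len_def by linarith
  then have "Max (insert 0 \<Lambda>) - bot_h < real len * \<epsilon>" using eps_pos by (simp add: field_simps)
  then have "Max (insert 0 \<Lambda>) < r" using v(2) by simp
  then have "h < r" if "h \<in> \<Lambda>" for h using fin that by auto
  then have "{r..} \<inter> \<Lambda> \<subseteq> {}" by fastforce
  then have "v \<in> W {}" by (rule W_mono'[OF v(1)])
  then show "v = 0" by (rule W_Int[of _ "{}" "{}", OF _ _ Int_empty_left]) fact
qed

definition raise :: "real \<Rightarrow> ('g \<Rightarrow> 'g) \<Rightarrow> bool" where
  "raise s A \<longleftrightarrow> (\<forall>r. \<forall>v\<in>F r. A v \<in> F (r + s))"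

lemma raiseD: "raise s A \<Longrightarrow> v \<in> F r \<Longrightarrow> r + s = r' \<Longrightarrow> A v \<in> F r'"
  unfolding raise_def by auto

lemma raise_mono: "raise s A \<Longrightarrow> s' \<le> s \<Longrightarrow> raise s' A"
  unfolding raise_def by (metis W_mono add_left_mono atLeast_subset_iff)

lemma raise_add: "raise s A \<Longrightarrow> raise s B \<Longrightarrow> raise s (\<lambda>v. A v + B v)"
  unfolding raise_def by (auto intro: W_add)

lemma raise_scale: "raise s A \<Longrightarrow> raise s (\<lambda>v. c *\<^sub>R A v)"
  unfolding raise_def by (auto intro: W_scale)

lemma raise_sum: "(\<And>i. i \<in> I \<Longrightarrow> raise s (A i)) \<Longrightarrow> raise s (\<lambda>v. \<Sum>i\<in>I. A i v)"
  unfolding raise_def by (auto intro: W_sum)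

lemma raise_comp: "raise s A \<Longrightarrow> raise t B \<Longrightarrow> raise (s + t) (\<lambda>v. A (B v))"
  unfolding raise_def by (metis (no_types, lifting) add.assoc add.commute)

lemma raise_id: "raise 0 (\<lambda>v. v)"
  unfolding raise_def by simp

lemma raise_br: "Y \<in> F s \<Longrightarrow> raise s (br Y)"
  unfolding raise_def by (auto intro: W_br)

lemma raise_funpow: "raise s A \<Longrightarrow> raise (real k * s) (A ^^ k)"
proof (induction k)
  case (Suc k)
  from raise_comp[OF Suc.prems Suc.IH[OF Suc.prems]] show ?case
    by (simp add: algebra_simps o_def)
qed (simp add: raise_def)

lemma nilpotent_funpow:
  assumes "raise \<epsilon> A" "len \<le> k"
  shows "(A ^^ k) v = 0"
proof (rule F_top)
  show "(A ^^ k) v \<in> F (bot_h + real k * \<epsilon>)"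
    using raise_funpow[OF assms(1), of k] F_bot[of v] by (auto simp: raise_def)
  show "bot_h + real len * \<epsilon> \<le> bot_h + real k * \<epsilon>" using assms(2) eps_pos by simp
qed

text \<open>The truncated series is polynomial in both arguments on the whole space; it equals
  \<open>Exp\<close> for Y in \<open>F \<epsilon>\<close>, where ad Y is nilpotent because it raises
  weights.\<close>

definition nexp :: "'g \<Rightarrow> 'g \<Rightarrow> 'g" where
  "nexp Y v = (\<Sum>k<len. (br Y ^^ k) v /\<^sub>R fact k)"

lemma Exp_nexp:
  assumes "Y \<in> F \<epsilon>"
  shows "Exp br Y v = nexp Y v"
  unfolding op_exp_def nexp_def
  by (rule suminf_finite) (use nilpotent_funpow[OF raise_br[OF assms]] in auto)

lemma polynomial_nexp:
  assumes "polynomial_function p" "polynomial_function q"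
  shows "polynomial_function (\<lambda>x. nexp (p x) (q x))"
proof -
  have "polynomial_function (\<lambda>x. (br (p x) ^^ k) (q x))" for k
    by (induction k) (use assms polynomial_function_bilinear[OF bil] in auto)
  then show ?thesis unfolding nexp_def
    by (intro polynomial_function_sum polynomial_function_cmul) auto
qed

text \<open>\<open>controlled e P\<close>: to first order in the filtration the operators \<open>e Y\<close> depend on \<open>Y\<close> through
  \<open>ad (P Y)\<close>.\<close>

definition controlled :: "('g \<Rightarrow> 'g \<Rightarrow> 'g) \<Rightarrow> ('g \<Rightarrow> 'g) \<Rightarrow> bool" where
  "controlled e P \<longleftrightarrow> (\<forall>Y\<in>F \<epsilon>. linear (e Y) \<and> raise \<epsilon> (\<lambda>v. e Y v - v)) \<and>
     (\<forall>r\<ge>\<epsilon>. \<forall>Y\<in>F \<epsilon>. \<forall>Y'\<in>F \<epsilon>. Y - Y' \<in> F r \<longrightarrow>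
        raise (r + \<epsilon>) (\<lambda>v. e Y v - e Y' v - br (P (Y - Y')) v))"

lemma len_split: "(\<Sum>k<len. f k) = f 0 + f 1 + (\<Sum>k\<in>{2..<len}. f k)"
proof -
  have "{..<len} = {0, 1} \<union> {2..<len}" by (auto simp: len_def)
  then show ?thesis by (simp add: sum.union_disjoint add.assoc)
qed

lemma raise_Exp:
  assumes "Y \<in> F \<epsilon>"
  shows "raise \<epsilon> (\<lambda>v. Exp br Y v - v)"
proof -
  have b: "raise \<epsilon> (br Y ^^ k)" if "k \<ge> 1" for k
    by (rule raise_mono[OF raise_funpow[OF raise_br[OF assms]]]) (use that eps_pos in auto)
  have "(\<lambda>v. Exp br Y v - v) = (\<lambda>v. br Y v + (\<Sum>k\<in>{2..<len}. (br Y ^^ k) v /\<^sub>R fact k))"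
    by (simp add: Exp_nexp[OF assms] nexp_def len_split fun_eq_iff)
  moreover have "raise \<epsilon> (\<lambda>v. br Y v + (\<Sum>k\<in>{2..<len}. (br Y ^^ k) v /\<^sub>R fact k))"
    using b by (intro raise_add raise_sum raise_scale raise_br[OF assms]) auto
  ultimately show ?thesis by simp
qed

text \<open>Telescoping: every term contains one factor A - B, which raises by r, and at least one
  further factor A or B, which raises by \<epsilon>. Exponent 1 lacks the second factor, hence the
  two successors.\<close>

lemma raise_funpow_diff:
  assumes A: "linear A" "raise \<epsilon> A" and B: "raise \<epsilon> B" and d: "raise r (\<lambda>v. A v - B v)"
  shows "raise (r + \<epsilon>) (\<lambda>v. (A ^^ Suc (Suc k)) v - (B ^^ Suc (Suc k)) v)"
proof (induction k)
  have eq: "(A ^^ Suc k) v - (B ^^ Suc k) v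
      = A ((A ^^ k) v - (B ^^ k) v) + (A ((B ^^ k) v) - B ((B ^^ k) v))" for k v
    by (simp add: linear_diff[OF A(1)])
  {
    case 0
    have "raise (r + \<epsilon>) (\<lambda>v. A (A v - B v) + (A (B v) - B (B v)))"
      using raise_comp[OF A(2) d] raise_comp[OF d B] by (intro raise_add) (simp_all add: add.commute)
    then show ?case by (simp add: linear_diff[OF A(1)])
  next
    case (Suc k)
    have "raise (r + \<epsilon>) (\<lambda>v. A ((A ^^ Suc (Suc k)) v - (B ^^ Suc (Suc k)) v))"
      by (rule raise_mono[OF raise_comp[OF A(2) Suc]]) (use eps_pos in auto)
    moreover have "raise (r + \<epsilon>) (\<lambda>v. A ((B ^^ Suc (Suc k)) v) - B ((B ^^ Suc (Suc k)) v))"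
      by (rule raise_mono[OF raise_comp[OF d raise_funpow[OF B]]])
         (use eps_pos in \<open>auto simp: algebra_simps\<close>)
    ultimately show ?case unfolding eq[of "Suc (Suc k)"] by (rule raise_add)
  }
qed

text \<open>The linear term of the series contributes exactly ad (P (Y - Y')), and
  \<open>raise_funpow_diff\<close> shows that the later terms are of higher order.\<close>

lemma controlled_Exp:
  assumes "linear P" and P: "\<And>r v. \<epsilon> \<le> r \<Longrightarrow> v \<in> F r \<Longrightarrow> P v \<in> F r"
  shows "controlled (\<lambda>Y. Exp br (P Y)) P"
  unfolding controlled_def
proof (intro conjI ballI allI impI)
  fix Y assume "Y \<in> F \<epsilon>"
  then show "linear (Exp br (P Y))" "raise \<epsilon> (\<lambda>v. Exp br (P Y) v - v)"
    using P by (auto intro: Exp_linear raise_Exp)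
next
  fix r Y Y' assume r: "\<epsilon> \<le> r" and Y: "Y \<in> F \<epsilon>" "Y' \<in> F \<epsilon>" and d: "Y - Y' \<in> F r"
  let ?A = "br (P Y)" and ?B = "br (P Y')"
  have PY: "P Y \<in> F \<epsilon>" "P Y' \<in> F \<epsilon>" using Y P by auto
  have dd: "br (P (Y - Y')) v = ?A v - ?B v" for v
    by (simp add: linear_diff[OF assms(1)] br_diff_left)
  have "raise r (\<lambda>v. ?A v - ?B v)"
    using raise_br[OF P[OF r d]] by (simp add: dd[abs_def])
  then have D: "raise (r + \<epsilon>) (\<lambda>v. (?A ^^ k) v - (?B ^^ k) v)" if "k \<ge> 2" for k
    using raise_funpow_diff[OF br_linear_right raise_br[OF PY(1)] raise_br[OF PY(2)], of r "k - 2"] that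
    by (simp add: numeral_2_eq_2 Suc_diff_Suc)
  have "(\<lambda>v. Exp br (P Y) v - Exp br (P Y') v - br (P (Y - Y')) v)
      = (\<lambda>v. \<Sum>k\<in>{2..<len}. ((?A ^^ k) v - (?B ^^ k) v) /\<^sub>R fact k)"
    by (simp add: Exp_nexp[OF PY(1)] Exp_nexp[OF PY(2)] nexp_def len_split fun_eq_iff dd
        sum_subtractf scaleR_diff_right)
  moreover have "raise (r + \<epsilon>) (\<lambda>v. \<Sum>k\<in>{2..<len}. ((?A ^^ k) v - (?B ^^ k) v) /\<^sub>R fact k)"
    using D by (intro raise_sum raise_scale) auto
  ultimately show "raise (r + \<epsilon>) (\<lambda>v. Exp br (P Y) v - Exp br (P Y') v - br (P (Y - Y')) v)"
    by simp
qed

lemma raise_minus_id_comp: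
  assumes "linear A" "raise \<epsilon> (\<lambda>v. A v - v)" "raise \<epsilon> (\<lambda>v. B v - v)"
  shows "raise \<epsilon> (\<lambda>v. A (B v) - v)"
proof -
  have "(\<lambda>v. A (B v) - v) = (\<lambda>v. ((A (B v - v) - (B v - v)) + (A v - v)) + (B v - v))"
    by (simp add: linear_diff[OF assms(1)] fun_eq_iff)
  moreover have "raise \<epsilon> (\<lambda>v. A (B v - v) - (B v - v))"
    by (rule raise_mono[OF raise_comp[OF assms(2,3)]]) (use eps_pos in auto)
  ultimately show ?thesis using raise_add[OF raise_add[OF _ assms(2)] assms(3)] by presburger
qed

lemma controlled_comp:
  assumes e: "controlled e P" and f: "controlled f Q" and PQ: "linear P" "linear Q"
    and P: "\<And>r v. \<epsilon> \<le> r \<Longrightarrow> v \<in> F r \<Longrightarrow> P v \<in> F r"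
    and Q: "\<And>r v. \<epsilon> \<le> r \<Longrightarrow> v \<in> F r \<Longrightarrow> Q v \<in> F r"
  shows "controlled (\<lambda>Y v. e Y (f Y v)) (\<lambda>Y. P Y + Q Y)"
  unfolding controlled_def
proof (intro conjI ballI allI impI)
  fix Y assume "Y \<in> F \<epsilon>"
  then have "linear (e Y)" "linear (f Y)" "raise \<epsilon> (\<lambda>v. e Y v - v)" "raise \<epsilon> (\<lambda>v. f Y v - v)"
    using e f unfolding controlled_def by auto
  then show "linear (\<lambda>v. e Y (f Y v))" "raise \<epsilon> (\<lambda>v. e Y (f Y v) - v)"
    using linear_compose[of "f Y" "e Y"] raise_minus_id_comp by (auto simp: o_def)
next
  fix r Y Y' assume r: "\<epsilon> \<le> r" and Y: "Y \<in> F \<epsilon>" "Y' \<in> F \<epsilon>" and d: "Y - Y' \<in> F r"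
  let ?s = "r + \<epsilon>"
  have l: "linear (e Y')" "raise \<epsilon> (\<lambda>v. e Y' v - v)" "raise \<epsilon> (\<lambda>v. f Y v - v)"
    using e f Y unfolding controlled_def by auto
  have E: "raise ?s (\<lambda>v. e Y v - e Y' v - br (P (Y - Y')) v)"
    and G: "raise ?s (\<lambda>v. f Y v - f Y' v - br (Q (Y - Y')) v)"
    using e f r Y d unfolding controlled_def by blast+
  have bP: "raise r (br (P (Y - Y')))" and bQ: "raise r (br (Q (Y - Y')))"
    using P[OF r d] Q[OF r d] raise_br by auto
  have f0: "raise 0 (f Y)" and e0: "raise 0 (e Y')"
    using raise_add[OF raise_mono[OF l(3), of 0] raise_id] raise_add[OF raise_mono[OF l(2), of 0] raise_id]
      eps_pos by auto
  \<comment> \<open>Product rule: apart from the two given approximation errors, the remaining terms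
    compare \<open>f Y\<close> and \<open>e Y'\<close> with the identity and thereby gain a further
    \<epsilon>.\<close>
  have "e Y (f Y v) - e Y' (f Y' v) - br (P (Y - Y') + Q (Y - Y')) v =
      (((e Y (f Y v) - e Y' (f Y v) - br (P (Y - Y')) (f Y v)) + br (P (Y - Y')) (f Y v - v))
       + e Y' (f Y v - f Y' v - br (Q (Y - Y')) v))
       + (e Y' (br (Q (Y - Y')) v) - br (Q (Y - Y')) v)" for v
    by (simp add: linear_diff[OF l(1)] br_diff_right br_add_left)
  moreover have "raise ?s (\<lambda>v. e Y (f Y v) - e Y' (f Y v) - br (P (Y - Y')) (f Y v))"
    using raise_comp[OF E f0] by simp
  moreover have "raise ?s (\<lambda>v. br (P (Y - Y')) (f Y v - v))"
    using raise_comp[OF bP l(3)] by simp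
  moreover have "raise ?s (\<lambda>v. e Y' (f Y v - f Y' v - br (Q (Y - Y')) v))"
    using raise_comp[OF e0 G] by simp
  moreover have "raise ?s (\<lambda>v. e Y' (br (Q (Y - Y')) v) - br (Q (Y - Y')) v)"
    using raise_comp[OF l(2) bQ] by (simp add: add.commute)
  ultimately show "raise ?s (\<lambda>v. e Y (f Y v) - e Y' (f Y' v) - br (P (Y - Y') + Q (Y - Y')) v)"
    by (simp only: raise_add)
qed

section \<open>Unipotent automorphisms and polynomial coordinates on them\<close>

definition unip :: "('g \<Rightarrow> 'g) set" where
  "unip = {m \<in> automorphisms. raise \<epsilon> (\<lambda>v. m v - v)}"

lemma unip_comp: "m \<in> unip \<Longrightarrow> m' \<in> unip \<Longrightarrow> m \<circ> m' \<in> unip"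
  unfolding unip_def using automorphisms_comp automorphismsD(1) raise_minus_id_comp by auto

lemma Exp_unip: "Y \<in> F \<epsilon> \<Longrightarrow> Exp br Y \<in> unip"
  unfolding unip_def using Exp_automorphism raise_Exp by auto

text \<open>An automorphism fixing \<xi> commutes with ad \<xi> and so preserves each eigenspace,
  whereas m - 1 strictly raises weights. On an eigenspace both hold only if m - 1 vanishes
  there.\<close>

lemma unip_fix:
  assumes "m \<in> unip" "m \<xi> = \<xi>"
  shows "m = id"
proof
  fix v
  have m: "m \<in> automorphisms" "raise \<epsilon> (\<lambda>v. m v - v)" using assms(1) by (auto simp: unip_def)
  note a = automorphismsD[OF m(1)]
  have *: "m (\<pi> h v) = \<pi> h v" for h
  proof -
    have "br \<xi> (m (\<pi> h v)) = h *\<^sub>R m (\<pi> h v)"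
      using a(3)[of \<xi> "\<pi> h v"] by (simp add: pi_eig assms(2) linear_cmul[OF a(1)])
    then have "m (\<pi> h v) - \<pi> h v \<in> W {h}" by (intro W_diff pi_in_W) (simp add: W_eig)
    moreover have "m (\<pi> h v) - \<pi> h v \<in> F (h + \<epsilon>)"
      using m(2) W_mono[OF pi_in_W, of h "{h..}" v] by (auto simp: raise_def)
    ultimately have "m (\<pi> h v) - \<pi> h v = 0" by (rule W_Int) (use eps_pos in auto)
    then show ?thesis by simp
  qed
  have "m v = (\<Sum>h\<in>\<Lambda>. m (\<pi> h v))" by (simp add: linear_sum[OF a(1), symmetric] pi_sum)
  then show "m v = id v" by (simp add: * pi_sum)
qed

lemma xi_inj:
  assumes "v \<in> F \<epsilon>" "br \<xi> v \<in> F r"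
  shows "v \<in> F r"
proof -
  have "\<pi> h v = 0" if "\<not> r \<le> h" for h
  proof (cases "\<epsilon> \<le> h")
    case True
    then have "h \<noteq> 0" using eps_pos by auto
    moreover have "h *\<^sub>R \<pi> h v = 0" using assms(2) that by (auto simp: W_def pi_xi[symmetric])
    ultimately show ?thesis by simp
  qed (use assms(1) in \<open>auto simp: W_def\<close>)
  then show ?thesis by (auto simp: W_def)
qed

text \<open>The inverse of ad \<xi> on positive weights, extended by zero to the other
  weights.\<close>

definition xi_inv :: "'g \<Rightarrow> 'g" where
  "xi_inv v = (\<Sum>h\<in>\<Lambda> \<inter> {0<..}. (1 / h) *\<^sub>R \<pi> h v)"

lemma xi_inv_linear: "linear xi_inv"
  unfolding xi_inv_def
  by (intro linear_compose_sum ballI linear_compose_scale_right pi_linear)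

lemma pi_xi_inv: "\<pi> k (xi_inv v) = (if k > 0 then (1 / k) *\<^sub>R \<pi> k v else 0)"
  unfolding xi_inv_def using fin
  by (auto simp: pi_sum_distrib pi_cmul pi_pi if_distrib sum.delta pi_out cong: if_cong)

lemma xi_inv_F: "v \<in> F r \<Longrightarrow> xi_inv v \<in> F r"
  unfolding W_def by (auto simp: pi_xi_inv)

lemma br_xi_inv: "v \<in> F \<epsilon> \<Longrightarrow> br \<xi> (xi_inv v) = v"
  by (rule eq_by_pi) (use eps_pos in \<open>auto simp: pi_xi pi_xi_inv W_def\<close>)

text \<open>The maps \<open>P1\<close>, \<open>P2\<close>, \<open>P3\<close> split Y into three
  blocks of coordinates. Modulo higher filtration, e Y \<xi> - \<xi> is - ad \<xi> Y, which is
  invertible on positive weights; correcting by \<open>xi_inv\<close> therefore gains \<epsilon> at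
  each step. As weights are bounded, finitely many polynomial steps give the exact inverse.\<close>

lemma chart_inverse:
  assumes P: "linear P1" "linear P2" "linear P3"
    and PF: "\<And>r v. \<epsilon> \<le> r \<Longrightarrow> v \<in> F r \<Longrightarrow> P1 v \<in> F r"
      "\<And>r v. \<epsilon> \<le> r \<Longrightarrow> v \<in> F r \<Longrightarrow> P2 v \<in> F r"
      "\<And>r v. \<epsilon> \<le> r \<Longrightarrow> v \<in> F r \<Longrightarrow> P3 v \<in> F r"
    and Psum: "\<And>v. v \<in> F \<epsilon> \<Longrightarrow> P1 v + P2 v + P3 v = v"
  defines "e \<equiv> \<lambda>Y. Exp br (P1 Y) \<circ> Exp br (P2 Y) \<circ> Exp br (P3 Y)"
  obtains \<psi> where "polynomial_function \<psi>"
    "\<And>m. m \<in> unip \<Longrightarrow> \<psi> (m \<xi>) \<in> F \<epsilon> \<and> m = e (\<psi> (m \<xi>))"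
    "\<And>Y. Y \<in> F \<epsilon> \<Longrightarrow> \<psi> (e Y \<xi>) = Y" "\<And>Y. Y \<in> F \<epsilon> \<Longrightarrow> e Y \<in> unip"
proof -
  have e_unip: "e Y \<in> unip" if "Y \<in> F \<epsilon>" for Y
    unfolding e_def using that PF by (intro unip_comp Exp_unip) auto
  have "controlled (\<lambda>Y v. Exp br (P1 Y) (Exp br (P2 Y) v)) (\<lambda>Y. P1 Y + P2 Y)"
    by (rule controlled_comp[OF controlled_Exp[OF P(1) PF(1)] controlled_Exp[OF P(2) PF(2)] P(1,2) PF(1,2)])
  then have "controlled (\<lambda>Y v. Exp br (P1 Y) (Exp br (P2 Y) (Exp br (P3 Y) v))) (\<lambda>Y. P1 Y + P2 Y + P3 Y)"
    by (rule controlled_comp[OF _ controlled_Exp[OF P(3) PF(3)] linear_compose_add[OF P(1,2)] P(3)])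
       (auto intro: W_add PF)
  note C = this[unfolded controlled_def, THEN conjunct2, rule_format]
  have ctrl: "raise (r + \<epsilon>) (\<lambda>v. e Y v - e Y' v - br (Y - Y') v)"
    if "\<epsilon> \<le> r" "Y \<in> F \<epsilon>" "Y' \<in> F \<epsilon>" "Y - Y' \<in> F r" for r Y Y'
    using C[OF that] unfolding Psum[OF W_diff[OF that(2,3)]] e_def o_def .
  define T where "T = (\<lambda>Y. e Y \<xi> - \<xi>)"
  have T: "T Y - T Y' + br \<xi> (Y - Y') \<in> F (r + \<epsilon>)"
    if "\<epsilon> \<le> r" "Y \<in> F \<epsilon>" "Y' \<in> F \<epsilon>" "Y - Y' \<in> F r" for r Y Y'
  proof -
    have "e Y \<xi> - e Y' \<xi> - br (Y - Y') \<xi> \<in> F (0 + (r + \<epsilon>))"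
      using ctrl[OF that] W_mono[OF xi_W0, of "{0..}"] unfolding raise_def by fastforce
    moreover have "br (Y - Y') \<xi> = - br \<xi> (Y - Y')" by (rule br_antisym)
    ultimately show ?thesis by (simp add: T_def algebra_simps)
  qed
  have T_F: "T Y \<in> F \<epsilon>" if "Y \<in> F \<epsilon>" for Y
  proof -
    have "raise \<epsilon> (\<lambda>v. e Y v - v)" using e_unip[OF that] by (simp add: unip_def)
    from raiseD[OF this, of \<xi> 0 \<epsilon>] show ?thesis
      using W_mono[OF xi_W0, of "{0..}"] by (simp add: T_def)
  qed
  \<comment> \<open>If T takes equal values at Y and Y', the first-order comparison pushes Y - Y'
    into ever higher filtration steps.\<close>
  have T_inj: "Y = Y'" if Y: "Y \<in> F \<epsilon>" "Y' \<in> F \<epsilon>" and eq: "T Y = T Y'" for Y Y'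
  proof -
    have d: "Y - Y' \<in> F \<epsilon>" using Y by (rule W_diff)
    have *: "Y - Y' \<in> F (real (Suc j) * \<epsilon>)" for j
    proof (induction j)
      case (Suc j)
      have "br \<xi> (Y - Y') \<in> F (real (Suc j) * \<epsilon> + \<epsilon>)"
        using T[OF _ Y Suc] eps_pos eq by (auto simp: algebra_simps)
      from xi_inj[OF d this] show ?case by (simp add: algebra_simps)
    qed (use d in simp)
    have "Y - Y' = 0" by (rule F_top[OF *[of len]]) (use eps_pos bot_le in \<open>auto simp: algebra_simps\<close>)
    then show ?thesis by simp
  qed
  \<comment> \<open>\<open>Tp\<close> is polynomial everywhere and agrees with T on
    \<open>F \<epsilon>\<close>: the iteration uses \<open>Tp\<close> to stay polynomial, the
    estimates use T.\<close>
  define Tp where "Tp = (\<lambda>Y. nexp (P1 Y) (nexp (P2 Y) (nexp (P3 Y) \<xi>)) - \<xi>)"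
  have Tp: "Tp Y = T Y" if "Y \<in> F \<epsilon>" for Y
    unfolding Tp_def T_def e_def using that PF by (simp add: Exp_nexp)
  have linp: "polynomial_function L" if "linear L" for L :: "'g \<Rightarrow> 'g"
    using that linear_conv_bounded_linear polynomial_function_bounded_linear by blast
  have polTp: "polynomial_function Tp"
    unfolding Tp_def using P linp by (intro polynomial_function_diff polynomial_nexp) auto
  \<comment> \<open>A Newton step with the derivative frozen at 0. The sign is plus because that
    derivative is - ad \<xi>.\<close>
  define S where "S = (\<lambda>w Y. Y + xi_inv (Tp Y - w))"
  define G where "G = (\<lambda>j w. (S w ^^ j) 0)"
  have G0: "G 0 w = 0" and GS: "G (Suc j) w = G j w + xi_inv (Tp (G j w) - w)" for j w
    by (auto simp: G_def S_def)
  have polG: "polynomial_function (G j)" for j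
  proof (induction j)
    case (Suc j)
    have "polynomial_function (\<lambda>w. Tp (G j w))"
      using polynomial_function_compose[OF Suc polTp] by (simp add: o_def)
    then have "polynomial_function (\<lambda>w. Tp (G j w) - w)"
      by (rule polynomial_function_diff) simp
    then have "polynomial_function (\<lambda>w. xi_inv (Tp (G j w) - w))"
      using polynomial_function_compose[of "\<lambda>w. Tp (G j w) - w" xi_inv] linp[OF xi_inv_linear]
      by (simp add: o_def)
    then show ?case using Suc by (auto simp: GS[abs_def])
  qed (simp add: G_def)
  \<comment> \<open>The error - w of the starting value 0 already lies in
    \<open>F \<epsilon>\<close>, hence the successor in the bound.\<close>
  have GT: "G j w \<in> F \<epsilon> \<and> T (G j w) - w \<in> F (real (Suc j) * \<epsilon>)" if w: "w \<in> F \<epsilon>" for j w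
  proof (induction j)
    case 0
    have "e 0 = id" by (auto simp: e_def linear_0 P fun_eq_iff)
    then show ?case using W_neg[OF w] by (simp add: G0 T_def)
  next
    case (Suc j)
    define Y where "Y = G j w"
    define \<Delta> where "\<Delta> = xi_inv (T Y - w)"
    have Y: "Y \<in> F \<epsilon>" "T Y - w \<in> F (real (Suc j) * \<epsilon>)" using Suc by (auto simp: Y_def)
    have n: "T Y - w \<in> F \<epsilon>" using T_F[OF Y(1)] w by (rule W_diff)
    have G: "G (Suc j) w = Y + \<Delta>" using Tp[OF Y(1)] by (simp add: GS Y_def \<Delta>_def)
    have D: "\<Delta> \<in> F \<epsilon>" "\<Delta> \<in> F (real (Suc j) * \<epsilon>)" "br \<xi> \<Delta> = T Y - w"
      unfolding \<Delta>_def using n Y(2) by (auto intro: xi_inv_F br_xi_inv)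
    have "T (Y + \<Delta>) - T Y + br \<xi> (Y + \<Delta> - Y) \<in> F (real (Suc j) * \<epsilon> + \<epsilon>)"
      by (rule T) (use Y D eps_pos in \<open>auto intro: W_add\<close>)
    then show ?case using W_add[OF Y(1) D(1)] by (simp add: G D(3) algebra_simps)
  qed
  define \<psi> where "\<psi> = (\<lambda>u. G len (u - \<xi>))"
  have psi: "\<psi> u \<in> F \<epsilon> \<and> e (\<psi> u) \<xi> = u" if "u - \<xi> \<in> F \<epsilon>" for u
  proof -
    have "T (\<psi> u) - (u - \<xi>) = 0"
      unfolding \<psi>_def
      by (rule F_top[OF conjunct2[OF GT[OF that]]]) (use eps_pos bot_le in \<open>auto simp: algebra_simps\<close>)
    then show ?thesis using GT[OF that] by (auto simp: \<psi>_def T_def algebra_simps)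
  qed
  show thesis
  proof
    show "polynomial_function \<psi>" unfolding \<psi>_def
      using polynomial_function_compose[OF polynomial_function_diff[OF polynomial_function_id
        polynomial_function_const] polG] by (simp add: o_def)
    show "e Y \<in> unip" if "Y \<in> F \<epsilon>" for Y using e_unip[OF that] .
    show "\<psi> (e Y \<xi>) = Y" if "Y \<in> F \<epsilon>" for Y
    proof -
      have *: "e Y \<xi> - \<xi> \<in> F \<epsilon>" using T_F[OF that] by (simp add: T_def)
      from psi[OF this] show ?thesis by - (rule T_inj, auto simp: that T_def)
    qed
    show "\<psi> (m \<xi>) \<in> F \<epsilon> \<and> m = e (\<psi> (m \<xi>))" if m: "m \<in> unip" for m
    proof -
      have "raise \<epsilon> (\<lambda>v. m v - v)" using m by (simp add: unip_def)
      from raiseD[OF this, of \<xi> 0 \<epsilon>] have *: "m \<xi> - \<xi> \<in> F \<epsilon>"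
        using W_mono[OF xi_W0, of "{0..}"] by simp
      define Y where "Y = \<psi> (m \<xi>)"
      have Y: "Y \<in> F \<epsilon>" "e Y \<xi> = m \<xi>" using psi[OF *] by (auto simp: Y_def)
      \<comment> \<open>d inverts \<open>e Y\<close>, so d after m fixes \<xi> and is the identity
        by \<open>unip_fix\<close>.\<close>
      define d where "d = Exp br (- P3 Y) \<circ> Exp br (- P2 Y) \<circ> Exp br (- P1 Y)"
      have d: "d \<in> unip" unfolding d_def using Y(1) PF by (intro unip_comp Exp_unip W_neg) auto
      have "d (e Y \<xi>) = \<xi>" by (simp add: d_def e_def Exp_minus_cancel)
      then have "(d \<circ> m) \<xi> = \<xi>" by (simp add: Y(2))
      from unip_fix[OF unip_comp[OF d m] this] have "d \<circ> m = id" .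
      moreover have "e Y \<circ> d = id" by (auto simp: d_def e_def fun_eq_iff Exp_minus_cancel)
      ultimately have dm: "d (m x) = x" and ed: "e Y (d x) = x" for x
        unfolding o_def id_def fun_eq_iff by simp_all
      have "m x = e Y x" for x using ed[of "m x"] unfolding dm by (rule sym)
      then have "m = e Y" by (rule ext)
      with Y(1) show ?thesis unfolding Y_def by (rule conjI)
    qed
  qed
qed

section \<open>Triangular factorisation of automorphisms near the identity\<close>

lemma bracket_hom_by_pi:
  assumes A: "linear A"
    and h: "\<And>a b x y. x \<in> W {a} \<Longrightarrow> y \<in> W {b} \<Longrightarrow> A (br x y) = br (A x) (A y)"
  shows "A (br x y) = br (A x) (A y)"
proof -
  have "A (br x y) = A (br (\<Sum>h\<in>\<Lambda>. \<pi> h x) (\<Sum>k\<in>\<Lambda>. \<pi> k y))" by (simp only: pi_sum)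
  also have "\<dots> = (\<Sum>k\<in>\<Lambda>. \<Sum>h\<in>\<Lambda>. br (A (\<pi> h x)) (A (\<pi> k y)))"
    by (simp only: br_sum_right br_sum_left linear_sum[OF A] h[OF pi_in_W pi_in_W])
  also have "\<dots> = br (A (\<Sum>h\<in>\<Lambda>. \<pi> h x)) (A (\<Sum>k\<in>\<Lambda>. \<pi> k y))"
    by (simp only: br_sum_right br_sum_left linear_sum[OF A])
  finally show ?thesis by (simp only: pi_sum)
qed

lemma pr_bounded: "\<exists>C\<ge>1. \<forall>S v. norm (pr S v) \<le> C * norm v"
proof -
  have "\<exists>c>0. \<forall>v. norm (\<pi> h v) \<le> c * norm v" for h
    using linear_bounded_pos[OF pi_linear] by blast
  then obtain c where c: "\<And>h. c h > 0" "\<And>h v. norm (\<pi> h v) \<le> c h * norm v" by metis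
  have "norm (pr S v) \<le> (1 + (\<Sum>h\<in>\<Lambda>. c h)) * norm v" for S v
  proof -
    have "norm (pr S v) \<le> (\<Sum>h\<in>\<Lambda> \<inter> S. norm (\<pi> h v))"
      unfolding pr_def by (rule norm_sum)
    also have "\<dots> \<le> (\<Sum>h\<in>\<Lambda>. norm (\<pi> h v))" using fin by (intro sum_mono2) auto
    also have "\<dots> \<le> (\<Sum>h\<in>\<Lambda>. c h * norm v)" by (intro sum_mono c)
    also have "\<dots> \<le> (1 + (\<Sum>h\<in>\<Lambda>. c h)) * norm v"
      by (simp add: sum_distrib_right distrib_right)
    finally show ?thesis .
  qed
  moreover have "1 + (\<Sum>h\<in>\<Lambda>. c h) \<ge> 1" using c(1) by (simp add: sum_nonneg less_imp_le)
  ultimately show ?thesis by blast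
qed

lemma raise_by_pi:
  assumes A: "linear A" and h: "\<And>h v. h \<in> \<Lambda> \<Longrightarrow> v \<in> W {h} \<Longrightarrow> A v \<in> W {h<..}"
  shows "raise \<epsilon> A"
  unfolding raise_def
proof (intro allI ballI)
  fix r v assume v: "v \<in> F r"
  have "A (\<pi> h v) \<in> F (r + \<epsilon>)" if "h \<in> \<Lambda>" for h
  proof (cases "r \<le> h")
    case True
    have "A (\<pi> h v) \<in> F (h + \<epsilon>)" using that h[OF that pi_in_W] by (intro W_gap) auto
    then show ?thesis by (rule W_mono) (use True in auto)
  next
    case False
    then show ?thesis using v by (simp add: W_def linear_0[OF A])
  qed
  then have "(\<Sum>h\<in>\<Lambda>. A (\<pi> h v)) \<in> F (r + \<epsilon>)" by (rule W_sum)
  then show "A v \<in> F (r + \<epsilon>)" by (simp only: linear_sum[OF A, symmetric] pi_sum)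
qed

text \<open>On the kernel v = -(A v - v), so v climbs the filtration until it vanishes.\<close>

lemma raise_minus_id_inj:
  assumes A: "linear A" "raise \<epsilon> (\<lambda>v. A v - v)"
  shows "inj A"
proof -
  have "v = 0" if "A v = 0" for v
  proof -
    have "v \<in> F (bot_h + real j * \<epsilon>)" for j
    proof (induction j)
      case (Suc j)
      have "A v - v \<in> F (bot_h + real j * \<epsilon> + \<epsilon>)" using A(2) Suc by (auto simp: raise_def)
      then show ?case using that W_neg[of "0 - v"] by (simp add: algebra_simps)
    qed (use F_bot in simp)
    from F_top[OF this[of len]] show ?thesis by simp
  qed
  then show ?thesis using A(1) linear_injective_0 by blast
qed

text \<open>An LU decomposition of an automorphism \<open>g\<close> near the identity: \<open>g \<circ> Q\<close> is upper unipotent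
  and \<open>Q\<close> is lower triangular. Here \<open>Q x\<close>, for \<open>x\<close> of weight \<open>h\<close>, is the unique element of
  weights \<open>\<le> h\<close> that \<open>g\<close> maps to \<open>x\<close> modulo weights \<open>> h\<close>; this uniqueness forces \<open>Q\<close> to
  preserve brackets.\<close>

lemma triangular_factor:
  assumes "\<eta> > 0"
  obtains \<delta> where "\<delta> > 0"
    "\<And>g. g \<in> automorphisms \<Longrightarrow> (\<And>v. norm (g v - v) \<le> \<delta> * norm v) \<Longrightarrow>
      \<exists>Q\<in>automorphisms. g \<circ> Q \<in> unip \<and> (\<forall>h. \<forall>x\<in>W {h}. Q x \<in> W {..h} \<and> pr {..h} (g (Q x)) = x) \<and>
        (\<forall>h. \<forall>x\<in>W {h}. norm (Q x - x) \<le> \<eta> * norm x)"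
proof -
  obtain C where C: "C \<ge> 1" "\<And>S v. norm (pr S v) \<le> C * norm v" using pr_bounded by blast
  \<comment> \<open>The first bound keeps g, compressed to weights at most h, within 1/2 of the
    identity and hence injective there. The second gives the final estimate; its factor 2 comes from
    norm (Q x) \<le> 2 norm x.\<close>
  define \<delta> where "\<delta> = min (1 / (2 * C)) (\<eta> / (2 * C))"
  have d: "\<delta> > 0" "C * \<delta> \<le> 1 / 2" "2 * (C * \<delta>) \<le> \<eta>"
    using C(1) assms by (auto simp: \<delta>_def min_def field_simps)
  show thesis
  proof (rule that[OF d(1)])
    fix g assume g: "g \<in> automorphisms" and near: "\<And>v. norm (g v - v) \<le> \<delta> * norm v"
    note ga = automorphismsD[OF g]
    have key: "norm (pr S (g v - v)) \<le> C * \<delta> * norm v" for S v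
      using C(2)[of S "g v - v"] mult_left_mono[OF near[of v], of C] C(1) unfolding mult.assoc by linarith
    \<comment> \<open>The compression of g to weights at most h, completed by the identity on the
      higher weights so that it becomes an invertible endomorphism of the whole space.\<close>
    define A where "A = (\<lambda>h v. pr {..h} (g (pr {..h} v)) + pr {h<..} v)"
    have compl: "{..h} \<inter> {h<..} = {}" "{..h} \<union> {h<..} = UNIV" for h :: real by auto
    have linA: "linear (A h)" for h
      unfolding A_def
      using linear_compose[OF linear_compose[OF pr_linear ga(1)] pr_linear]
      by (intro linear_compose_add pr_linear) (simp add: o_def)
    have prA: "pr {h<..} (A h v) = pr {h<..} v" for h v
      unfolding A_def by (simp add: linear_add[OF pr_linear] pr_0[OF pr_in_W] pr_id[OF pr_in_W] Int_commute compl)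
    have injA: "inj (A h)" for h
    proof -
      have "v = 0" if "A h v = 0" for v
      proof -
        have p: "pr {h<..} v = 0" using prA[of h v] that by (simp add: linear_0[OF pr_linear])
        have v: "v \<in> W {..h}" by (rule W_compl[OF p]) auto
        have "pr {..h} (g v) = 0" using that p by (simp add: A_def pr_id[OF v])
        then have "norm v = norm (pr {..h} (g v - v))"
          by (simp add: linear_diff[OF pr_linear] pr_id[OF v])
        also have "\<dots> \<le> 1 / 2 * norm v"
          using key[of "{..h}" v] mult_right_mono[OF d(2) norm_ge_zero[of v]] by simp
        finally show ?thesis by simp
      qed
      then show ?thesis using linA linear_injective_0 by blast
    qed
    have surjA: "surj (A h)" for h using linear_inj_imp_surj[OF linA injA] .
    have lininv: "linear (inv (A h))" for h
      using linA injA surjA inj_linear_imp_inv_linear by blast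
    define Q where "Q = (\<lambda>v. \<Sum>h\<in>\<Lambda>. inv (A h) (\<pi> h v))"
    have linQ: "linear Q" unfolding Q_def
      using linear_compose[OF pi_linear lininv] by (intro linear_compose_sum ballI) (simp add: o_def)
    have Q: "Q x \<in> W {..h}" "pr {..h} (g (Q x)) = x" if x: "x \<in> W {h}" for h x
    proof -
      have pix: "\<pi> k x = (if k = h then x else 0)" for k
      proof (cases "k = h")
        case True
        have "x = \<pi> h x" by (rule eq_by_pi) (use x in \<open>auto simp: W_def pi_pi\<close>)
        then show ?thesis using True by simp
      qed (use x in \<open>simp add: W_def\<close>)
      have Qx: "Q x = inv (A h) x"
      proof (cases "h \<in> \<Lambda>")
        case True
        then show ?thesis unfolding Q_def pix using fin
          by (simp add: if_distrib linear_0[OF lininv] sum.delta cong: if_cong)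
      next
        case False
        then have "x = 0" using pix[of h] pi_out by simp
        then show ?thesis by (simp add: linear_0[OF linQ] linear_0[OF lininv])
      qed
      have AQ: "A h (Q x) = x" unfolding Qx by (rule surj_f_inv_f[OF surjA])
      have p: "pr {h<..} (Q x) = 0"
        using prA[of h "Q x"] AQ pr_0[OF x, of "{h<..}"] by simp
      show QW: "Q x \<in> W {..h}" by (rule W_compl[OF p]) auto
      show "pr {..h} (g (Q x)) = x" using AQ p by (simp add: A_def pr_id[OF QW])
    qed
    have uniq: "w = w'" if "w \<in> W {..h}" "w' \<in> W {..h}" "pr {..h} (g w) = pr {..h} (g w')" for h w w'
    proof -
      have "A h w = A h w'" using that pr_0[of _ "{..h}" "{h<..}"] by (simp add: A_def pr_id compl Int_commute)
      then show ?thesis using injA[of h] by (simp add: inj_eq)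
    qed
    have gQ: "g (Q x) - x \<in> W {h<..}" if x: "x \<in> W {h}" for h x
      by (rule W_compl[of "{..h}"])
         (use Q(2)[OF x] pr_id[OF W_mono[OF x], of "{..h}"] in \<open>auto simp: linear_diff[OF pr_linear]\<close>)
    \<comment> \<open>The bracket of Q x and Q y has the two properties that determine the image of
      br x y under Q: weights at most a + b, and image under g equal to br x y modulo higher
      weights.\<close>
    have Qbr: "Q (br x y) = br (Q x) (Q y)" for x y
    proof (rule bracket_hom_by_pi[OF linQ])
      fix a b x y assume x: "x \<in> W {a}" and y: "y \<in> W {b}"
      have xy: "br x y \<in> W {a + b}" by (rule W_br[OF x y]) auto
      have "g (br (Q x) (Q y)) - br x y = br (g (Q x) - x) (g (Q y)) + br x (g (Q y) - y)"
        by (simp add: ga(3) br_diff_left br_diff_right)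
      moreover have "g (Q y) \<in> W {b..}"
      proof -
        have "(g (Q y) - y) + y \<in> W {b..}"
          by (rule W_add[OF W_mono[OF gQ[OF y]] W_mono[OF y]]) auto
        then show ?thesis by simp
      qed
      then have "br (g (Q x) - x) (g (Q y)) \<in> W {a + b<..}"
        by (rule W_br[OF gQ[OF x]]) auto
      moreover have "br x (g (Q y) - y) \<in> W {a + b<..}"
        by (rule W_br[OF x gQ[OF y]]) auto
      ultimately have "g (br (Q x) (Q y)) - br x y \<in> W {a + b<..}" by (simp add: W_add)
      from pr_0[OF this, of "{..a + b}"]
      have "pr {..a + b} (g (br (Q x) (Q y))) = br x y"
        using pr_id[OF W_mono[OF xy], of "{..a + b}"] by (simp add: linear_diff[OF pr_linear] compl)
      moreover have "br (Q x) (Q y) \<in> W {..a + b}"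
        by (rule W_br[OF Q(1)[OF x] Q(1)[OF y]]) auto
      ultimately show "Q (br x y) = br (Q x) (Q y)"
        using Q[OF xy] by - (rule uniq[of _ "a + b"], auto)
    qed
    have lingQ: "linear (\<lambda>v. g (Q v))" using linear_compose[OF linQ ga(1)] by (simp add: o_def)
    have r: "raise \<epsilon> (\<lambda>v. g (Q v) - v)"
      by (rule raise_by_pi) (use gQ in \<open>auto intro: linear_compose_sub lingQ linear_id[unfolded id_def]\<close>)
    have "inj (\<lambda>v. g (Q v))" by (rule raise_minus_id_inj[OF lingQ r])
    then have "inj Q" by (auto simp: inj_def)
    then have Qaut: "Q \<in> automorphisms"
      unfolding automorphisms_def bij_def
      using linQ Qbr linear_inj_imp_surj[OF linQ] by simp
    have "g \<circ> Q \<in> unip" unfolding unip_def using automorphisms_comp[OF g Qaut] r by simp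
    moreover have "norm (Q x - x) \<le> \<eta> * norm x" if x: "x \<in> W {h}" for h x
    proof -
      have eq: "Q x - x = - pr {..h} (g (Q x) - Q x)"
        using Q[OF x] by (simp add: linear_diff[OF pr_linear] pr_id)
      have n: "norm (Q x - x) \<le> C * \<delta> * norm (Q x)"
        unfolding eq using key[of "{..h}" "Q x"] by simp
      have "norm (Q x) \<le> norm x + norm (Q x - x)" using norm_triangle_ineq[of x "Q x - x"] by simp
      also have "\<dots> \<le> norm x + 1 / 2 * norm (Q x)"
        using n mult_right_mono[OF d(2) norm_ge_zero[of "Q x"]] by simp
      finally have "norm (Q x) \<le> 2 * norm x" by simp
      then have "C * \<delta> * norm (Q x) \<le> C * \<delta> * (2 * norm x)"
        using C(1) d(1) by (intro mult_left_mono) auto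
      also have "\<dots> \<le> \<eta> * norm x" using mult_right_mono[OF d(3) norm_ge_zero[of x]] by simp
      finally show ?thesis using n by simp
    qed
    ultimately show "\<exists>Q\<in>automorphisms. g \<circ> Q \<in> unip \<and>
        (\<forall>h. \<forall>x\<in>W {h}. Q x \<in> W {..h} \<and> pr {..h} (g (Q x)) = x) \<and>
        (\<forall>h. \<forall>x\<in>W {h}. norm (Q x - x) \<le> \<eta> * norm x)"
      using Qaut Q by blast
  qed
qed

text \<open>The chart with all coordinates in a single block shows that each unipotent automorphism
  is one exponential, in place of a Campbell-Hausdorff argument.\<close>

lemma unip_eq_Exp: "unip = Exp br ` F \<epsilon>"
proof -
  obtain \<psi> where \<psi>: "\<And>m. m \<in> unip \<Longrightarrow> \<psi> (m \<xi>) \<in> F \<epsilon> \<and>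
      m = Exp br (\<psi> (m \<xi>)) \<circ> Exp br 0 \<circ> Exp br 0"
    by (rule chart_inverse[of "\<lambda>v. v" "\<lambda>v. 0" "\<lambda>v. 0"]) (auto simp: linear_id[unfolded id_def] linear_zero)
  have "m \<in> Exp br ` F \<epsilon>" if "m \<in> unip" for m
    using \<psi>[OF that] by auto
  then show ?thesis using Exp_unip by auto
qed

lemma unip_inv: "m \<in> unip \<Longrightarrow> \<exists>m'\<in>unip. m' \<circ> m = id \<and> m \<circ> m' = id"
proof -
  assume "m \<in> unip"
  then obtain Y where Y: "Y \<in> F \<epsilon>" "m = Exp br Y" by (auto simp: unip_eq_Exp)
  have "Exp br (- Y) \<circ> m = id" "m \<circ> Exp br (- Y) = id"
    unfolding Y(2) by (auto simp: fun_eq_iff Exp_minus_cancel)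
  moreover have "Exp br (- Y) \<in> unip" using Y(1) by (intro Exp_unip W_neg)
  ultimately show "\<exists>m'\<in>unip. m' \<circ> m = id \<and> m \<circ> m' = id" by blast
qed

end

section \<open>The Killing form and root vectors\<close>

lemma quadratic_nonpos_imp_linear_zero:
  fixes a c :: real
  assumes "\<And>t. 2 * t * a + t\<^sup>2 * c \<le> 0"
  shows "a = 0"
proof (rule ccontr)
  assume a: "a \<noteq> 0"
  \<comment> \<open>Both k and 2 k + c are positive, so at t = a / k the linear term
    dominates.\<close>
  define k where "k = \<bar>c\<bar> + 1"
  have k: "k > 0" "2 * k + c > 0" by (auto simp: k_def)
  define t where "t = a / k"
  have "2 * t * a + t\<^sup>2 * c = (a\<^sup>2 / k) * ((2 * k + c) / k)"
    using k(1) by (simp add: t_def power2_eq_square field_simps)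
  moreover have "(a\<^sup>2 / k) * ((2 * k + c) / k) > 0" using a k by (intro mult_pos_pos divide_pos_pos) auto
  ultimately have "2 * t * a + t\<^sup>2 * c > 0" by simp
  with assms[of t] show False by simp
qed

text \<open>A second inner product beside that of the type class: the one built from the Killing
  form and \<theta> makes ad H self-adjoint for H in \<aa>, while the norm of the class provides the
  compact sphere.\<close>

locale inner_form =
  fixes q :: "'g::euclidean_space \<Rightarrow> 'g \<Rightarrow> real"
  assumes bil: "bilinear q" and sym: "q x y = q y x" and pos: "x \<noteq> 0 \<Longrightarrow> q x x > 0"
begin

lemmas q_simps = bilinear_ladd[OF bil] bilinear_radd[OF bil] bilinear_lmul[OF bil]
  bilinear_rmul[OF bil] bilinear_lsub[OF bil] bilinear_rsub[OF bil]

lemma self_adjoint_eigenvector: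
  assumes T: "linear T" "\<And>x y. q (T x) y = q x (T y)"
    and V: "subspace V" "V \<noteq> {0}" "\<And>v. v \<in> V \<Longrightarrow> T v \<in> V"
  shows "\<exists>v\<in>V. \<exists>c. v \<noteq> 0 \<and> T v = c *\<^sub>R v"
proof -
  define R where "R = (\<lambda>v. q (T v) v / q v v)"
  define S where "S = V \<inter> sphere 0 1"
  have cont: "continuous_on A (\<lambda>v. q (f v) (g v))" if "continuous_on A f" "continuous_on A g" for A f g
    using bounded_bilinear.continuous_on[OF _ that] bil bilinear_conv_bounded_bilinear by blast
  have cT: "continuous_on A T" for A
    using T(1) linear_continuous_on linear_conv_bounded_linear by blast
  have ne: "v \<noteq> 0 \<and> q v v \<noteq> 0" if "v \<in> S" for v
  proof -
    have "v \<noteq> 0" using that by (auto simp: S_def)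
    then show ?thesis using pos[of v] by auto
  qed
  have "compact S" unfolding S_def using closed_subspace[OF V(1)] by (intro closed_Int_compact) auto
  moreover have "S \<noteq> {}"
  proof -
    obtain v where "v \<in> V" "v \<noteq> 0" using V(1,2) subspace_0 by blast
    then have "(1 / norm v) *\<^sub>R v \<in> S" unfolding S_def using V(1) by (auto simp: subspace_scale)
    then show ?thesis by blast
  qed
  moreover have "continuous_on S R"
    unfolding R_def using ne by (intro continuous_on_divide cont cT continuous_on_id) auto
  ultimately obtain v where v: "v \<in> S" "\<And>u. u \<in> S \<Longrightarrow> R u \<le> R v"
    using continuous_attains_sup[of S R] by blast
  define c where "c = R v"
  have vV: "v \<in> V" using v(1) by (simp add: S_def)
  have le: "q (T u) u - c * q u u \<le> 0" if u: "u \<in> V" for u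
  proof (cases "u = 0")
    case True
    then show ?thesis by (simp add: bilinear_rzero[OF bil])
  next
    case False
    have "(1 / norm u) *\<^sub>R u \<in> S" unfolding S_def using V(1) u False by (auto simp: subspace_scale)
    from v(2)[OF this] have "R u \<le> c" using False
      by (simp add: R_def c_def linear_cmul[OF T(1)] q_simps)
    then show ?thesis using pos[OF False] by (simp add: R_def field_simps)
  qed
  have eq: "q (T v) v - c * q v v = 0" using ne[OF v(1)] by (simp add: c_def R_def)
  \<comment> \<open>The form q (T u) u - c q u u is at most 0 on V and vanishes at v. Along the
    residual d its linear coefficient is 2 q d d, which must therefore be 0.\<close>
  define d where "d = T v - c *\<^sub>R v"
  have dV: "d \<in> V" unfolding d_def using V vV by (intro subspace_diff subspace_scale) auto
  have "2 * t * q d d + t\<^sup>2 * (q (T d) d - c * q d d) \<le> 0" for t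
  proof -
    have "v + t *\<^sub>R d \<in> V" using V vV dV by (intro subspace_add subspace_scale) auto
    from le[OF this] have "(q (T v) v - c * q v v) + t * (q (T v) d + q (T d) v - c * q v d - c * q d v)
        + t\<^sup>2 * (q (T d) d - c * q d d) \<le> 0"
      by (simp add: linear_add[OF T(1)] linear_cmul[OF T(1)] q_simps power2_eq_square algebra_simps)
    moreover have "q (T v) d + q (T d) v - c * q v d - c * q d v = 2 * q d d"
    proof -
      have "q (T d) v = q (T v) d" using T(2)[of d v] sym by simp
      moreover have "q d v = q v d" by (rule sym)
      moreover have "q d d = q (T v) d - c * q v d"
        by (subst d_def) (simp add: q_simps)
      ultimately show ?thesis by (simp add: algebra_simps)
    qed
    ultimately show ?thesis using eq by (simp add: mult.assoc mult.left_commute)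
  qed
  then have "q d d = 0" by (rule quadratic_nonpos_imp_linear_zero)
  then have "d = 0" using pos[of d] by auto
  then show ?thesis using vV ne[OF v(1)] by (intro bexI[of _ v] exI[of _ c]) (auto simp: d_def)
qed

text \<open>If some T does not act by a scalar on each vector of V, it has an eigenspace in V that
  is nonzero, proper, and stable under the family by commutativity; so induction on the dimension
  applies.\<close>

lemma common_eigenvector:
  assumes "\<And>T. T \<in> Ts \<Longrightarrow> linear T" "\<And>T x y. T \<in> Ts \<Longrightarrow> q (T x) y = q x (T y)"
    and "\<And>T T' x. T \<in> Ts \<Longrightarrow> T' \<in> Ts \<Longrightarrow> T (T' x) = T' (T x)"
    and "subspace V" "V \<noteq> {0}" "\<And>T v. T \<in> Ts \<Longrightarrow> v \<in> V \<Longrightarrow> T v \<in> V"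
  shows "\<exists>v\<in>V. v \<noteq> 0 \<and> (\<forall>T\<in>Ts. \<exists>c. T v = c *\<^sub>R v)"
  using assms(4-6)
proof (induction "dim V" arbitrary: V rule: less_induct)
  case less
  show ?case
  proof (cases "\<forall>T\<in>Ts. \<forall>v\<in>V. \<exists>c. T v = c *\<^sub>R v")
    case True
    then show ?thesis using less.prems(1,2) subspace_0 by blast
  next
    case False
    then obtain T where T: "T \<in> Ts" "\<not> (\<forall>v\<in>V. \<exists>c. T v = c *\<^sub>R v)" by blast
    obtain u c where u: "u \<in> V" "u \<noteq> 0" "T u = c *\<^sub>R u"
      using self_adjoint_eigenvector[OF assms(1,2)[OF T(1)] less.prems(1,2)] less.prems(3)[OF T(1)] by blast
    define V' where "V' = {v \<in> V. T v = c *\<^sub>R v}"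
    have s: "subspace V'"
      using less.prems(1) unfolding V'_def subspace_def
      by (auto simp: linear_add[OF assms(1)[OF T(1)]] linear_cmul[OF assms(1)[OF T(1)]]
          linear_0[OF assms(1)[OF T(1)]] algebra_simps)
    have "V' \<subset> V" using T(2) unfolding V'_def by blast
    then have "dim V' < dim V"
      using s less.prems(1) by (metis dim_psubset span_eq_iff)
    moreover have "V' \<noteq> {0}" using u unfolding V'_def by blast
    moreover have "T' v \<in> V'" if "T' \<in> Ts" "v \<in> V'" for T' v
      using that less.prems(3) assms(3)[OF T(1) that(1)] unfolding V'_def
      by (auto simp: linear_cmul[OF assms(1)])
    ultimately show ?thesis using less.hyps[of V'] s unfolding V'_def by blast
  qed
qed

end

section \<open>Trace and Killing form\<close>

lemma lin_trace_commute:
  fixes f g :: "'g::euclidean_space \<Rightarrow> 'g"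
  assumes "linear f" "linear g"
  shows "lin_trace (f \<circ> g) = lin_trace (g \<circ> f)"
proof -
  have e: "f (g b) \<bullet> b = (\<Sum>c\<in>Basis. (g b \<bullet> c) * (f c \<bullet> b))" if "linear f" for f g :: "'g \<Rightarrow> 'g" and b
  proof -
    have "f (g b) = f (\<Sum>c\<in>Basis. (g b \<bullet> c) *\<^sub>R c)" by (simp add: euclidean_representation)
    then show ?thesis by (simp add: linear_sum[OF that] linear_cmul[OF that] inner_sum_left)
  qed
  have "lin_trace (f \<circ> g) = (\<Sum>b\<in>Basis. \<Sum>c\<in>Basis. (g b \<bullet> c) * (f c \<bullet> b))"
    by (simp add: lin_trace_def e[OF assms(1)])
  also have "\<dots> = (\<Sum>c\<in>Basis. \<Sum>b\<in>Basis. (f c \<bullet> b) * (g b \<bullet> c))"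
    by (subst sum.swap) (simp add: mult.commute)
  also have "\<dots> = lin_trace (g \<circ> f)" by (simp add: lin_trace_def e[OF assms(2)])
  finally show ?thesis .
qed

lemma lin_trace_diff: "lin_trace (\<lambda>x. f x - g x) = lin_trace f - lin_trace g"
  by (simp add: lin_trace_def inner_diff_left sum_subtractf)

lemma lin_trace_add: "lin_trace (\<lambda>x. f x + g x) = lin_trace f + lin_trace g"
  by (simp add: lin_trace_def inner_add_left sum.distrib)

lemma lin_trace_scale: "lin_trace (\<lambda>x. c *\<^sub>R f x) = c * lin_trace f"
  by (simp add: lin_trace_def sum_distrib_left)

context lie_algebra
begin

abbreviation B :: "'g \<Rightarrow> 'g \<Rightarrow> real" where "B \<equiv> killing br"

lemma B_sym: "B x y = B y x"
  unfolding killing_def by (rule lin_trace_commute[OF br_linear_right br_linear_right])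

lemma B_bil: "bilinear B"
proof -
  have "B (x + y) z = B x z + B y z" "B (r *\<^sub>R x) z = r * B x z" for x y z r
    by (simp_all add: killing_def o_def br_add_left lin_trace_add lin_trace_scale)
  then show ?thesis unfolding bilinear_def
    by (auto intro!: linearI simp: B_sym[of _ "_ + _"] B_sym[of _ "_ *\<^sub>R _"])
       (simp_all add: B_sym)
qed

lemmas B_simps = bilinear_ladd[OF B_bil] bilinear_radd[OF B_bil] bilinear_lmul[OF B_bil]
  bilinear_rmul[OF B_bil] bilinear_lsub[OF B_bil] bilinear_rsub[OF B_bil]
  bilinear_lneg[OF B_bil] bilinear_rneg[OF B_bil] bilinear_lzero[OF B_bil] bilinear_rzero[OF B_bil]

lemma B_linear_right: "linear (B x)" and B_linear_left: "linear (\<lambda>x. B x y)"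
  using B_bil unfolding bilinear_def by auto

lemma B_sum_left: "B (\<Sum>i\<in>I. f i) y = (\<Sum>i\<in>I. B (f i) y)"
  using linear_sum[OF B_linear_left] .

lemma B_sum_right: "B x (\<Sum>i\<in>I. f i) = (\<Sum>i\<in>I. B x (f i))"
  using linear_sum[OF B_linear_right] .

lemma B_invariant: "B (br x y) z = B x (br y z)"
proof -
  have d: "br (br x y) v = br x (br y v) - br y (br x v)" for x y v
    using br_derivation[of x y v] by simp
  have "B (br x y) z = lin_trace (br x \<circ> (br y \<circ> br z)) - lin_trace (br y \<circ> (br x \<circ> br z))"
    by (simp add: killing_def o_def d lin_trace_diff)
  also have "lin_trace (br y \<circ> (br x \<circ> br z)) = lin_trace ((br x \<circ> br z) \<circ> br y)"
    by (rule lin_trace_commute) (intro br_linear_right linear_compose)+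
  also have "lin_trace (br x \<circ> (br y \<circ> br z)) - lin_trace ((br x \<circ> br z) \<circ> br y) = B x (br y z)"
    by (simp add: killing_def o_def d lin_trace_diff br_diff_right)
  finally show ?thesis .
qed

lemma B_automorphism:
  assumes "g \<in> automorphisms"
  shows "B (g x) (g y) = B x y"
proof -
  note g = automorphismsD[OF assms]
  have s: "surj g" "inj g" using g(2) by (auto simp: bij_def)
  have li: "linear (inv g)" using automorphisms_inv[OF assms] automorphismsD by blast
  have "br (g x) (br (g y) v) = g (br x (br y (inv g v)))" for v
    by (simp add: g(3) surj_f_inv_f[OF s(1)])
  then have "B (g x) (g y) = lin_trace (g \<circ> (br x \<circ> br y \<circ> inv g))"
    by (simp add: killing_def o_def)
  also have "\<dots> = lin_trace ((br x \<circ> br y \<circ> inv g) \<circ> g)"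
    by (rule lin_trace_commute[OF g(1)]) (intro li br_linear_right linear_compose)
  also have "(br x \<circ> br y \<circ> inv g) \<circ> g = br x \<circ> br y" using s(2) by (simp add: fun_eq_iff)
  finally show ?thesis by (simp add: killing_def o_def)
qed

end

section \<open>Roots and root space decomposition in the split case\<close>

locale split_simple = lie_algebra br for br :: "'g::euclidean_space \<Rightarrow> 'g \<Rightarrow> 'g" +
  fixes \<theta> :: "'g \<Rightarrow> 'g" and \<aa> :: "'g set"
  assumes simple: "simple_lie br" and cartan: "cartan_involution br \<theta>"
    and csub: "cartan_subspace br \<theta> \<aa>" and split: "split_form br \<theta> \<aa>"
begin

abbreviation "rts \<equiv> roots br \<aa>"

lemma theta: "linear \<theta>" "\<theta> (br x y) = br (\<theta> x) (\<theta> y)" "\<theta> (\<theta> x) = x"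
  and theta_pos: "x \<noteq> 0 \<Longrightarrow> - B x (\<theta> x) > 0"
  using cartan unfolding cartan_involution_def by (auto simp: fun_eq_iff)

lemma theta_automorphism: "\<theta> \<in> automorphisms"
  unfolding automorphisms_def using theta by (auto intro!: o_bij[of \<theta>])

lemma B_theta: "B (\<theta> x) y = B x (\<theta> y)"
  using B_automorphism[OF theta_automorphism, of x "\<theta> y"] by (simp add: theta)

lemma B_nondegenerate: "(\<And>y. B x y = 0) \<Longrightarrow> x = 0"
  using theta_pos[of x] by force

lemma a_subspace: "subspace \<aa>" and a_theta: "H \<in> \<aa> \<Longrightarrow> \<theta> H = - H"
  and a_abelian: "H \<in> \<aa> \<Longrightarrow> H' \<in> \<aa> \<Longrightarrow> br H H' = 0"
  using csub unfolding cartan_subspace_def by auto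

lemmas a_add = subspace_add[OF a_subspace] and a_diff = subspace_diff[OF a_subspace]
  and a_scale = subspace_scale[OF a_subspace] and a_0 [simp] = subspace_0[OF a_subspace]
  and a_sum = subspace_sum[OF a_subspace] and a_neg = subspace_neg[OF a_subspace]

lemma a_pos: "H \<in> \<aa> \<Longrightarrow> H \<noteq> 0 \<Longrightarrow> B H H > 0"
  using theta_pos[of H] by (simp add: a_theta B_simps)

lemma a_eqI:
  assumes "H \<in> \<aa>" "H' \<in> \<aa>" "\<And>K. K \<in> \<aa> \<Longrightarrow> B K H = B K H'"
  shows "H = H'"
proof (rule ccontr)
  assume "H \<noteq> H'"
  then have "B (H - H') (H - H') > 0" using assms by (intro a_pos a_diff) auto
  moreover have "B (H - H') (H - H') = 0" using assms(3)[OF a_diff[OF assms(1,2)]] by (simp add: B_simps)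
  ultimately show False by simp
qed

text \<open>\<theta> v centralises \<aa> together with v, so the \<theta>-fixed vector v + \<theta>
  v vanishes by splitness. Hence \<theta> v = - v, and maximality of \<aa> applies.\<close>

lemma a_centralizer:
  assumes "\<And>H. H \<in> \<aa> \<Longrightarrow> br H v = 0"
  shows "v \<in> \<aa>"
proof -
  have t: "br H (\<theta> v) = 0" if "H \<in> \<aa>" for H
    using theta(2)[of "- H" v] assms[OF that] a_theta[OF a_neg[OF that]]
    by (simp add: linear_0[OF theta(1)])
  have "\<theta> (v + \<theta> v) = v + \<theta> v" by (simp add: linear_add[OF theta(1)] theta)
  moreover have "br H (v + \<theta> v) = 0" if "H \<in> \<aa>" for H using that t assms by (simp add: br_add_right)
  ultimately have "v + \<theta> v \<in> {X. \<theta> X = X \<and> (\<forall>H\<in>\<aa>. br H X = 0)}" by blast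
  then have "\<theta> v = - v" using split unfolding split_form_def by (simp add: eq_neg_iff_add_eq_0 add.commute)
  then show ?thesis using csub assms unfolding cartan_subspace_def by blast
qed

lemma B_represent:
  assumes "linear l"
  shows "\<exists>Z. \<forall>v. B Z v = l v"
proof -
  define \<phi> where "\<phi> = (\<lambda>Z. \<Sum>b\<in>Basis. B Z b *\<^sub>R b)"
  have in_b: "\<phi> Z \<bullet> b = B Z b" if "b \<in> Basis" for Z b
    using that by (simp add: \<phi>_def inner_sum_left inner_Basis if_distrib sum.delta cong: if_cong)
  have ext: "f v = g v" if "linear f" "linear g" "\<And>b. b \<in> Basis \<Longrightarrow> f b = g b" for f g :: "'g \<Rightarrow> real" and v
    using linear_eq_stdbasis[OF that] by simp
  have lin: "linear \<phi>" unfolding \<phi>_def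
    by (intro linearI) (simp_all add: B_simps scaleR_left_distrib sum.distrib scaleR_sum_right)
  have "inj \<phi>"
    unfolding linear_injective_0[OF lin]
  proof (intro allI impI)
    fix Z assume Z: "\<phi> Z = 0"
    have "B Z v = 0" for v
      by (rule ext[OF B_linear_right linear_zero]) (use in_b[of _ Z] Z in auto)
    then show "Z = 0" by (rule B_nondegenerate)
  qed
  then have "surj \<phi>" using lin linear_inj_imp_surj by blast
  then obtain Z where Z: "\<phi> Z = (\<Sum>b\<in>Basis. l b *\<^sub>R b)" by (metis surjD)
  have "B Z b = l b" if "b \<in> Basis" for b
    using in_b[OF that, of Z] that unfolding Z
    by (simp add: inner_sum_left inner_Basis if_distrib sum.delta cong: if_cong)
  then have "B Z v = l v" for v by (rule ext[OF B_linear_right assms])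
  then show ?thesis by blast
qed

lemma inner_form_theta: "inner_form (\<lambda>x y. - B x (\<theta> y))"
proof
  show "bilinear (\<lambda>x y. - B x (\<theta> y))"
    unfolding bilinear_def
    by (auto intro!: linearI simp: B_simps linear_add[OF theta(1)] linear_cmul[OF theta(1)])
  show "- B x (\<theta> y) = - B y (\<theta> x)" for x y using B_theta[of y x] B_sym[of x "\<theta> y"] by simp
  show "- B x (\<theta> x) > 0" if "x \<noteq> 0" for x using theta_pos[OF that] .
qed

text \<open>Otherwise the orthogonal complement of the span, for the form - B x (\<theta> y), is
  nonzero and stable under ad \<aa>; it contains a common eigenvector, which is then orthogonal to
  itself.\<close>

lemma common_eigenvectors_span: "span {v. \<forall>H\<in>\<aa>. \<exists>c. br H v = c *\<^sub>R v} = UNIV"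
proof (rule ccontr)
  define E where "E = {v. \<forall>H\<in>\<aa>. \<exists>c. br H v = c *\<^sub>R v}"
  assume "span {v. \<forall>H\<in>\<aa>. \<exists>c. br H v = c *\<^sub>R v} \<noteq> UNIV"
  then obtain a where a: "a \<noteq> 0" "span E \<subseteq> {x. a \<bullet> x = 0}"
    using span_not_univ_subset_hyperplane[of E] unfolding E_def by blast
  \<comment> \<open>\<open>Z\<close> represents the Euclidean normal through the Killing form, so
    that \<theta> Z is a nonzero vector of the complement \<open>V\<close>.\<close>
  obtain Z where Z: "\<And>v. B Z v = a \<bullet> v" using B_represent[OF bounded_linear.linear[OF bounded_linear_inner_right], of a] by blast
  define V where "V = {v. \<forall>s\<in>span E. - B v (\<theta> s) = 0}"
  have adj: "- B (br H x) (\<theta> y) = - B x (\<theta> (br H y))" if "H \<in> \<aa>" for H x y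
  proof -
    have "B (br H x) (\<theta> y) = - B x (br H (\<theta> y))"
      by (subst br_antisym) (simp add: B_simps B_invariant)
    then show ?thesis by (simp add: theta a_theta[OF that] B_simps)
  qed
  have Einv: "br H s \<in> span E" if H: "H \<in> \<aa>" and s: "s \<in> span E" for H s
    using s
  proof (induction rule: span_induct)
    case base
    show ?case using linear_subspace_vimage[OF br_linear_right subspace_span] by (simp add: vimage_def)
  next
    case (step x)
    then obtain c where "br H x = c *\<^sub>R x" using H unfolding E_def by blast
    then show ?case using step by (simp add: span_base span_scale)
  qed
  have "\<exists>v\<in>V. v \<noteq> 0 \<and> (\<forall>T\<in>br ` \<aa>. \<exists>c. T v = c *\<^sub>R v)"
  proof (rule inner_form.common_eigenvector[OF inner_form_theta])
    show "subspace V" unfolding V_def subspace_def by (auto simp: B_simps)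
    have "\<theta> Z \<in> V" using a(2) by (auto simp: V_def B_theta theta Z)
    moreover have "\<theta> Z \<noteq> 0"
    proof
      assume "\<theta> Z = 0"
      then have "Z = 0" using theta(3)[of Z] by (simp add: linear_0[OF theta(1)])
      then show False using Z[of a] a(1) by (simp add: B_simps)
    qed
    ultimately show "V \<noteq> {0}" by blast
    show "T v \<in> V" if "T \<in> br ` \<aa>" "v \<in> V" for T v
    proof -
      obtain H where H: "T = br H" "H \<in> \<aa>" using \<open>T \<in> br ` \<aa>\<close> by blast
      show ?thesis unfolding V_def
      proof (intro CollectI ballI)
        fix s assume "s \<in> span E"
        then show "- B (T v) (\<theta> s) = 0"
          using adj[OF H(2), of v s] Einv[OF H(2)] \<open>v \<in> V\<close> unfolding V_def H(1) by auto
      qed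
    qed
    show "T (T' x) = T' (T x)" if T: "T \<in> br ` \<aa>" "T' \<in> br ` \<aa>" for T T' x
    proof -
      obtain H H' where H: "T = br H" "T' = br H'" "H \<in> \<aa>" "H' \<in> \<aa>" using T by blast
      show ?thesis using br_derivation[of H H' x] a_abelian[OF H(3,4)] by (simp add: H)
    qed
  qed (use adj br_linear_right in auto)
  then obtain v where v: "v \<in> V" "v \<noteq> 0" "v \<in> E" by (auto simp: E_def)
  then have "- B v (\<theta> v) = 0" using span_base[of v E] by (auto simp: V_def)
  then show False using theta_pos[OF v(2)] by simp
qed

lemma root_space_subspace: "subspace (root_space br \<aa> \<alpha>)"
  unfolding root_space_def subspace_def by (auto simp: br_add_right algebra_simps)

lemma root_dual: "\<alpha> \<in> rts \<Longrightarrow> \<alpha> \<in> dual_space \<aa>" and root_nonzero: "\<alpha> \<in> rts \<Longrightarrow> \<alpha> \<noteq> 0"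
  by (auto simp: roots_def)

lemma dualD:
  assumes "\<alpha> \<in> dual_space \<aa>"
  shows "x \<in> \<aa> \<Longrightarrow> y \<in> \<aa> \<Longrightarrow> \<alpha> (x + y) = \<alpha> x + \<alpha> y" "x \<in> \<aa> \<Longrightarrow> \<alpha> (r *\<^sub>R x) = r * \<alpha> x"
    "x \<notin> \<aa> \<Longrightarrow> \<alpha> x = 0"
  using assms unfolding dual_space_def by auto

lemma dual_eqI:
  assumes "\<alpha> \<in> dual_space \<aa>" "\<beta> \<in> dual_space \<aa>" "\<And>H. H \<in> \<aa> \<Longrightarrow> \<alpha> H = \<beta> H"
  shows "\<alpha> = \<beta>"
  by (rule ext) (metis assms dualD(3))

lemma dual_closed: "\<alpha> \<in> dual_space \<aa> \<Longrightarrow> \<beta> \<in> dual_space \<aa> \<Longrightarrow> \<alpha> + \<beta> \<in> dual_space \<aa>"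
  "\<alpha> \<in> dual_space \<aa> \<Longrightarrow> \<beta> \<in> dual_space \<aa> \<Longrightarrow> \<alpha> - \<beta> \<in> dual_space \<aa>"
  "\<alpha> \<in> dual_space \<aa> \<Longrightarrow> - \<alpha> \<in> dual_space \<aa>" "0 \<in> dual_space \<aa>"
  unfolding dual_space_def by (auto simp: algebra_simps)

text \<open>\<theta> acts by -1 on \<aa> and therefore maps the root space of \<alpha> into that of
  -\<alpha>.\<close>

lemma root_neg:
  assumes "\<alpha> \<in> rts"
  shows "- \<alpha> \<in> rts"
proof -
  have "0 \<in> root_space br \<aa> \<alpha>" using subspace_0[OF root_space_subspace] .
  then obtain x where x: "x \<in> root_space br \<aa> \<alpha>" "x \<noteq> 0" using assms by (auto simp: roots_def)
  have "br H (\<theta> x) = - \<alpha> H *\<^sub>R \<theta> x" if "H \<in> \<aa>" for H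
  proof -
    have "\<alpha> H *\<^sub>R \<theta> x = - br H (\<theta> x)"
      using theta(2)[of H x] x(1) that by (simp add: root_space_def a_theta linear_cmul[OF theta(1)])
    then show ?thesis by simp
  qed
  then have "\<theta> x \<in> root_space br \<aa> (- \<alpha>)" by (simp add: root_space_def)
  moreover have "\<theta> x \<noteq> 0" using x(2) theta(3)[of x] by (auto simp: linear_0[OF theta(1)])
  ultimately have "root_space br \<aa> (- \<alpha>) \<noteq> {0}" by blast
  then show ?thesis using root_dual[OF assms] root_nonzero[OF assms]
    unfolding roots_def by (auto intro: dual_closed)
qed

lemma root_space_cases:
  assumes "x \<in> root_space br \<aa> \<alpha>" "\<alpha> \<in> dual_space \<aa>" "\<alpha> \<noteq> 0" "\<alpha> \<notin> rts"
  shows "x = 0"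
  using assms unfolding roots_def by blast

lemma span_roots: "span (\<aa> \<union> (\<Union>\<alpha>\<in>rts. root_space br \<aa> \<alpha>)) = UNIV"
proof -
  have "{v. \<forall>H\<in>\<aa>. \<exists>c. br H v = c *\<^sub>R v} \<subseteq> span (\<aa> \<union> (\<Union>\<alpha>\<in>rts. root_space br \<aa> \<alpha>))" (is "_ \<subseteq> span ?U")
  proof
    fix v assume "v \<in> {v. \<forall>H\<in>\<aa>. \<exists>c. br H v = c *\<^sub>R v}"
    then obtain l where l: "\<And>H. H \<in> \<aa> \<Longrightarrow> br H v = l H *\<^sub>R v" by (auto simp: bchoice_iff)
    show "v \<in> span ?U"
    proof (cases "v = 0")
      case False
      \<comment> \<open>The eigenvalue functional of v, set to 0 outside \<aa> as
        \<open>dual_space\<close> demands.\<close>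
      define \<alpha> where "\<alpha> = (\<lambda>H. if H \<in> \<aa> then l H else 0)"
      have a: "br H v = \<alpha> H *\<^sub>R v" if "H \<in> \<aa>" for H using l[OF that] that by (simp add: \<alpha>_def)
      have "\<alpha> (x + y) = \<alpha> x + \<alpha> y" if "x \<in> \<aa>" "y \<in> \<aa>" for x y
      proof -
        have "\<alpha> (x + y) *\<^sub>R v = (\<alpha> x + \<alpha> y) *\<^sub>R v"
          using a[OF a_add[OF that]] a[OF that(1)] a[OF that(2)] by (simp add: br_add_left algebra_simps)
        then show ?thesis using False scaleR_cancel_right by blast
      qed
      moreover have "\<alpha> (r *\<^sub>R x) = r * \<alpha> x" if "x \<in> \<aa>" for x r
      proof -
        have "\<alpha> (r *\<^sub>R x) *\<^sub>R v = (r * \<alpha> x) *\<^sub>R v" unfolding a[OF a_scale[OF that], symmetric] by (simp add: a[OF that])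
        then show ?thesis using False scaleR_cancel_right by blast
      qed
      ultimately have d: "\<alpha> \<in> dual_space \<aa>" unfolding dual_space_def by (auto simp: \<alpha>_def)
      have r: "v \<in> root_space br \<aa> \<alpha>" using a by (simp add: root_space_def)
      show ?thesis
      proof (cases "\<alpha> = 0")
        case True
        then have "v \<in> \<aa>" using a by (intro a_centralizer) simp
        then show ?thesis by (simp add: span_base)
      next
        case nz: False
        then have "\<alpha> \<in> rts" using root_space_cases[OF r d] False by blast
        then show ?thesis using r by (intro span_base) blast
      qed
    qed (simp add: span_zero)
  qed
  then show ?thesis using common_eigenvectors_span span_mono span_span by blast
qed

lemma root_spaces_orthogonal:
  assumes "x \<in> root_space br \<aa> \<alpha>" "y \<in> root_space br \<aa> \<beta>" "H \<in> \<aa>" "\<alpha> H + \<beta> H \<noteq> 0"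
  shows "B x y = 0"
proof -
  have "\<alpha> H * B x y = B (br H x) y" using assms by (simp add: root_space_def B_simps)
  also have "\<dots> = - B x (br H y)" by (subst br_antisym) (simp add: B_simps B_invariant)
  also have "\<dots> = - \<beta> H * B x y" using assms by (simp add: root_space_def B_simps)
  finally have "(\<alpha> H + \<beta> H) * B x y = 0" by (simp add: algebra_simps)
  then show ?thesis using assms(4) by simp
qed

lemma a_root_space: "H \<in> \<aa> \<Longrightarrow> H \<in> root_space br \<aa> 0"
  unfolding root_space_def using a_abelian by simp

lemma root_space_br:
  assumes "x \<in> root_space br \<aa> \<alpha>" "y \<in> root_space br \<aa> \<beta>"
  shows "br x y \<in> root_space br \<aa> (\<alpha> + \<beta>)"
  using assms unfolding root_space_def by (auto simp: br_derivation algebra_simps)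

end

section \<open>Coordinates with respect to normalised root vectors\<close>

locale rooted = split_simple br \<theta> \<aa> for br :: "'g::euclidean_space \<Rightarrow> 'g \<Rightarrow> 'g" and \<theta> \<aa> +
  fixes X :: "('g \<Rightarrow> real) \<Rightarrow> 'g"
  assumes normalized: "normalized_root_vectors br \<aa> X"
begin

lemma X_root: "\<alpha> \<in> rts \<Longrightarrow> X \<alpha> \<in> root_space br \<aa> \<alpha>"
  and X_norm: "\<alpha> \<in> rts \<Longrightarrow> B (X \<alpha>) (X (- \<alpha>)) = 1"
  using normalized unfolding normalized_root_vectors_def by auto

lemma X_eig: "\<alpha> \<in> rts \<Longrightarrow> H \<in> \<aa> \<Longrightarrow> br H (X \<alpha>) = \<alpha> H *\<^sub>R X \<alpha>"
  using X_root unfolding root_space_def by auto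

lemma X_nonzero: "\<alpha> \<in> rts \<Longrightarrow> X \<alpha> \<noteq> 0"
  using X_norm[of \<alpha>] by (auto simp: B_simps)

lemma root_space_span:
  assumes "\<alpha> \<in> rts"
  shows "root_space br \<aa> \<alpha> = span {X \<alpha>}"
proof -
  have "dim (root_space br \<aa> \<alpha>) = 1" using split assms unfolding split_form_def by blast
  moreover have "span {X \<alpha>} \<subseteq> root_space br \<aa> \<alpha>"
    using X_root[OF assms] by (intro span_minimal root_space_subspace) auto
  moreover have "dim (span {X \<alpha>}) = 1" using X_nonzero[OF assms] by simp
  ultimately show ?thesis
    by (metis dim_psubset less_irrefl psubsetI root_space_subspace span_eq_iff span_span)
qed

lemma B_X:
  assumes "\<alpha> \<in> rts" "\<beta> \<in> rts"
  shows "B (X \<alpha>) (X \<beta>) = (if \<beta> = - \<alpha> then 1 else 0)"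
proof (cases "\<beta> = - \<alpha>")
  case False
  then have "\<exists>H\<in>\<aa>. \<beta> H \<noteq> (- \<alpha>) H"
    using dual_eqI[OF root_dual[OF assms(2)] dual_closed(3)[OF root_dual[OF assms(1)]]] by blast
  then obtain H where "H \<in> \<aa>" "\<alpha> H + \<beta> H \<noteq> 0" by force
  then show ?thesis using root_spaces_orthogonal[OF X_root X_root] assms False by simp
qed (use X_norm assms in simp)

lemma B_X_a:
  assumes "\<alpha> \<in> rts" "H \<in> \<aa>"
  shows "B H (X \<alpha>) = 0" "B (X \<alpha>) H = 0"
proof -
  obtain H' where "H' \<in> \<aa>" "\<alpha> H' \<noteq> 0"
    using dual_eqI[of \<alpha> 0] root_dual[OF assms(1)] root_nonzero[OF assms(1)] dual_closed(4) by force
  then show "B H (X \<alpha>) = 0"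
    using root_spaces_orthogonal[OF a_root_space[OF assms(2)] X_root[OF assms(1)]] by simp
  then show "B (X \<alpha>) H = 0" by (simp add: B_sym)
qed

lemma X_inj: "inj_on X rts"
proof (rule inj_onI)
  fix \<alpha> \<beta> assume a: "\<alpha> \<in> rts" "\<beta> \<in> rts" "X \<alpha> = X \<beta>"
  then have "B (X \<beta>) (X (- \<alpha>)) = 1" using X_norm by metis
  then show "\<alpha> = \<beta>" using B_X[OF a(2) root_neg[OF a(1)]] by (auto split: if_splits)
qed

text \<open>Pairing with X (-\<alpha>) isolates the coefficient of X \<alpha>, so the root vectors
  are independent, hence finitely many; \<open>X_inj\<close> transfers this to the roots.\<close>

lemma finite_roots: "finite rts"
proof -
  have "independent (X ` rts)"
    unfolding independent_explicit_finite_subsets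
  proof (intro allI impI ballI)
    fix S u v assume S: "S \<subseteq> X ` rts" "finite S" "(\<Sum>v\<in>S. u v *\<^sub>R v) = 0" "v \<in> S"
    then obtain \<alpha> where \<alpha>: "\<alpha> \<in> rts" "v = X \<alpha>" by blast
    have "u w * B w (X (- \<alpha>)) = (if w = v then u v else 0)" if w: "w \<in> S" for w
    proof -
      obtain \<beta> where "\<beta> \<in> rts" "w = X \<beta>" using w S(1) by blast
      then show ?thesis using B_X[OF _ root_neg[OF \<alpha>(1)], of \<beta>] \<alpha> X_inj by (auto simp: inj_on_eq_iff)
    qed
    then have "B (\<Sum>v\<in>S. u v *\<^sub>R v) (X (- \<alpha>)) = (\<Sum>w\<in>S. if w = v then u v else 0)"
      by (simp add: B_sum_left B_simps)
    then show "u v = 0" using S by (simp add: B_simps)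
  qed
  then have "finite (X ` rts)" using independent_bound by blast
  then show ?thesis using X_inj finite_imageD by blast
qed

definition coord :: "('g \<Rightarrow> real) \<Rightarrow> 'g \<Rightarrow> real" where "coord \<alpha> v = B v (X (- \<alpha>))"

text \<open>The projection to \<aa> along the root spaces. As a remainder it makes the decomposition
  immediate; that its values lie in \<aa> rests on \<open>span_roots\<close>.\<close>

definition a_part :: "'g \<Rightarrow> 'g" where "a_part v = v - (\<Sum>\<alpha>\<in>rts. coord \<alpha> v *\<^sub>R X \<alpha>)"

lemma coord_linear: "linear (coord \<alpha>)" unfolding coord_def by (rule B_linear_left)

lemmas coord_simps = linear_add[OF coord_linear] linear_cmul[OF coord_linear] linear_diff[OF coord_linear]
  linear_0[OF coord_linear] linear_neg[OF coord_linear] linear_sum[OF coord_linear]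

lemma coord_X: "\<alpha> \<in> rts \<Longrightarrow> \<beta> \<in> rts \<Longrightarrow> coord \<alpha> (X \<beta>) = (if \<alpha> = \<beta> then 1 else 0)"
  using B_X[of \<beta> "- \<alpha>"] root_neg by (auto simp: coord_def)

lemma coord_a: "\<alpha> \<in> rts \<Longrightarrow> H \<in> \<aa> \<Longrightarrow> coord \<alpha> H = 0"
  using B_X_a root_neg by (simp add: coord_def)

lemma a_part_linear: "linear a_part"
  unfolding a_part_def
  by (intro linear_compose_sub linear_compose_sum ballI linear_id[unfolded id_def])
     (intro linearI, simp_all add: coord_simps algebra_simps)

lemma a_part_a: "H \<in> \<aa> \<Longrightarrow> a_part H = H"
  by (simp add: a_part_def coord_a)

lemma a_part_X: "\<alpha> \<in> rts \<Longrightarrow> a_part (X \<alpha>) = 0"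
  using finite_roots by (simp add: a_part_def coord_X if_distrib[of "\<lambda>c. c *\<^sub>R _"] sum.delta cong: if_cong)

lemma decomposition: "v = a_part v + (\<Sum>\<alpha>\<in>rts. coord \<alpha> v *\<^sub>R X \<alpha>)"
  by (simp add: a_part_def)

lemma a_part_in_a: "a_part v \<in> \<aa>"
proof -
  have "v \<in> span (\<aa> \<union> (\<Union>\<alpha>\<in>rts. root_space br \<aa> \<alpha>))" by (simp add: span_roots)
  then show ?thesis
  proof (induction rule: span_induct)
    case base
    show ?case using linear_subspace_vimage[OF a_part_linear a_subspace] by (simp add: vimage_def)
  next
    case (step x)
    show ?case
    proof (cases "x \<in> \<aa>")
      case False
      then obtain \<alpha> where \<alpha>: "\<alpha> \<in> rts" "x \<in> span {X \<alpha>}" using step root_space_span by blast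
      then obtain k where "x = k *\<^sub>R X \<alpha>" by (auto simp: span_singleton)
      then show ?thesis using a_part_X[OF \<alpha>(1)] by (simp add: linear_cmul[OF a_part_linear])
    qed (simp add: a_part_a)
  qed
qed

lemma eq_by_coord: "a_part v = a_part w \<Longrightarrow> (\<And>\<alpha>. \<alpha> \<in> rts \<Longrightarrow> coord \<alpha> v = coord \<alpha> w) \<Longrightarrow> v = w"
  by (subst decomposition[of v], subst decomposition[of w]) simp

text \<open>Such an H is central and hence in the radical of the Killing form.\<close>

lemma br_a_nonzero:
  assumes "H \<in> \<aa>" "\<And>\<alpha>. \<alpha> \<in> rts \<Longrightarrow> \<alpha> H = 0"
  shows "H = 0"
proof -
  have "br H v = 0" for v
    by (subst decomposition[of v])
       (simp add: br_add_right br_sum_right a_abelian[OF assms(1) a_part_in_a] X_eig assms)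
  then have "B H y = 0" for y by (simp add: killing_def o_def lin_trace_def)
  then show ?thesis by (rule B_nondegenerate)
qed

lemma br_X_in_a: "\<alpha> \<in> rts \<Longrightarrow> br (X \<alpha>) (X (- \<alpha>)) \<in> \<aa>"
  using root_space_br[OF X_root X_root[OF root_neg], of \<alpha> \<alpha>]
  by (intro a_centralizer) (auto simp: root_space_def)

lemma B_br_X: "\<alpha> \<in> rts \<Longrightarrow> H \<in> \<aa> \<Longrightarrow> B H (br (X \<alpha>) (X (- \<alpha>))) = \<alpha> H"
  using X_norm by (simp add: B_invariant[symmetric] X_eig B_simps)

lemma Hvec_eqI:
  assumes "H' \<in> \<aa>" "\<And>H. H \<in> \<aa> \<Longrightarrow> \<alpha> H = B H H'"
  shows "Hvec br \<aa> \<alpha> = H'"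
  unfolding Hvec_def
proof (rule the_equality)
  fix K assume "K \<in> \<aa> \<and> (\<forall>H\<in>\<aa>. \<alpha> H = B H K)"
  then show "K = H'" using assms by (intro a_eqI) auto
qed (use assms in auto)

lemma Hvec_root: "\<alpha> \<in> rts \<Longrightarrow> Hvec br \<aa> \<alpha> = br (X \<alpha>) (X (- \<alpha>))"
  by (rule Hvec_eqI) (auto simp: br_X_in_a B_br_X)

lemma Hvec_in_a: "\<alpha> \<in> rts \<Longrightarrow> Hvec br \<aa> \<alpha> \<in> \<aa>"
  by (simp add: Hvec_root br_X_in_a)

lemma B_Hvec: "\<alpha> \<in> rts \<Longrightarrow> H \<in> \<aa> \<Longrightarrow> B H (Hvec br \<aa> \<alpha>) = \<alpha> H"
  by (simp add: Hvec_root B_br_X)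

lemma root_ip_eq: "\<alpha> \<in> rts \<Longrightarrow> \<beta> \<in> rts \<Longrightarrow> root_ip br \<aa> \<alpha> \<beta> = \<alpha> (Hvec br \<aa> \<beta>)"
  "\<alpha> \<in> rts \<Longrightarrow> \<beta> \<in> rts \<Longrightarrow> root_ip br \<aa> \<alpha> \<beta> = \<beta> (Hvec br \<aa> \<alpha>)"
  unfolding root_ip_def using B_Hvec Hvec_in_a B_sym by metis+

lemma root_ip_pos: "\<alpha> \<in> rts \<Longrightarrow> root_ip br \<aa> \<alpha> \<alpha> > 0"
proof -
  assume a: "\<alpha> \<in> rts"
  have "Hvec br \<aa> \<alpha> \<noteq> 0"
  proof
    assume "Hvec br \<aa> \<alpha> = 0"
    then have "\<alpha> H = 0" if "H \<in> \<aa>" for H using B_Hvec[OF a that] by (simp add: B_simps)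
    then show False using dual_eqI[OF root_dual[OF a] dual_closed(4)] root_nonzero[OF a] by auto
  qed
  then show ?thesis unfolding root_ip_def by (rule a_pos[OF Hvec_in_a[OF a]])
qed

definition weights :: "'g \<Rightarrow> real set" where "weights \<xi> = insert 0 ((\<lambda>\<alpha>. \<alpha> \<xi>) ` rts)"

definition wproj :: "'g \<Rightarrow> real \<Rightarrow> 'g \<Rightarrow> 'g" where
  "wproj \<xi> h v = (if h = 0 then a_part v else 0) + (\<Sum>\<alpha>\<in>rts. (if \<alpha> \<xi> = h then coord \<alpha> v else 0) *\<^sub>R X \<alpha>)"

lemma a_part_lincomb: "a_part (\<Sum>\<alpha>\<in>rts. f \<alpha> *\<^sub>R X \<alpha>) = 0"
  by (simp add: linear_sum[OF a_part_linear] linear_cmul[OF a_part_linear] a_part_X)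

lemma coord_lincomb: "\<beta> \<in> rts \<Longrightarrow> coord \<beta> (\<Sum>\<alpha>\<in>rts. f \<alpha> *\<^sub>R X \<alpha>) = f \<beta>"
  using finite_roots by (simp add: coord_simps coord_X if_distrib sum.delta' cong: if_cong)

lemma a_part_wproj: "a_part (wproj \<xi> h v) = (if h = 0 then a_part v else 0)"
  unfolding wproj_def
  by (auto simp: linear_add[OF a_part_linear] a_part_lincomb a_part_a a_part_in_a linear_0[OF a_part_linear])

lemma coord_wproj: "\<alpha> \<in> rts \<Longrightarrow> coord \<alpha> (wproj \<xi> h v) = (if \<alpha> \<xi> = h then coord \<alpha> v else 0)"
  unfolding wproj_def by (auto simp: coord_simps(1) coord_lincomb coord_a a_part_in_a linear_0[OF coord_linear])

lemma graded:
  assumes xi: "\<xi> \<in> \<aa>"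
  shows "graded_lie br \<xi> (weights \<xi>) (wproj \<xi>)"
proof (intro graded_lie.intro graded_lie_axioms.intro)
  show "lie_algebra br" by unfold_locales
  show fin: "finite (weights \<xi>)" by (simp add: weights_def finite_roots)
  show "linear (wproj \<xi> h)" for h
    unfolding wproj_def
    by (intro linearI)
       (auto simp: linear_add[OF a_part_linear] linear_cmul[OF a_part_linear] coord_simps(1,2) algebra_simps
         sum.distrib[symmetric] scaleR_sum_right intro!: sum.cong)
  show "(\<Sum>h\<in>weights \<xi>. wproj \<xi> h v) = v" for v
  proof (rule eq_by_coord)
    show "a_part (\<Sum>h\<in>weights \<xi>. wproj \<xi> h v) = a_part v"
      using fin by (simp add: linear_sum[OF a_part_linear] a_part_wproj sum.delta) (simp add: weights_def)
    show "coord \<alpha> (\<Sum>h\<in>weights \<xi>. wproj \<xi> h v) = coord \<alpha> v" if "\<alpha> \<in> rts" for \<alpha>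
      using fin that by (simp add: coord_simps coord_wproj sum.delta') (simp add: weights_def)
  qed
  show "br \<xi> (wproj \<xi> h v) = h *\<^sub>R wproj \<xi> h v" for h v
    unfolding wproj_def
    by (auto simp: br_add_right br_sum_right X_eig[OF _ xi] a_abelian[OF xi a_part_in_a] scaleR_sum_right
        algebra_simps intro!: sum.cong sum.neutral)
  show "wproj \<xi> h v = 0" if "h \<notin> weights \<xi>" for h v
    using that unfolding wproj_def weights_def by (auto intro!: sum.neutral)
  show "wproj \<xi> h (wproj \<xi> k v) = (if h = k then wproj \<xi> k v else 0)" for h k v
    by (rule eq_by_coord) (auto simp: a_part_wproj coord_wproj linear_0[OF a_part_linear] linear_0[OF coord_linear])
qed

lemma W_iff:
  assumes xi: "\<xi> \<in> \<aa>"
  shows "v \<in> graded_lie.W (wproj \<xi>) S \<longleftrightarrow>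
    (\<forall>\<alpha>\<in>rts. \<alpha> \<xi> \<notin> S \<longrightarrow> coord \<alpha> v = 0) \<and> (0 \<notin> S \<longrightarrow> a_part v = 0)"
proof -
  have "wproj \<xi> h v = 0 \<longleftrightarrow> (\<forall>\<alpha>\<in>rts. \<alpha> \<xi> = h \<longrightarrow> coord \<alpha> v = 0) \<and> (h = 0 \<longrightarrow> a_part v = 0)" for h
  proof
    assume "wproj \<xi> h v = 0"
    then have "coord \<alpha> (wproj \<xi> h v) = 0" "a_part (wproj \<xi> h v) = 0" for \<alpha>
      by (simp_all add: linear_0[OF a_part_linear] linear_0[OF coord_linear])
    then show "(\<forall>\<alpha>\<in>rts. \<alpha> \<xi> = h \<longrightarrow> coord \<alpha> v = 0) \<and> (h = 0 \<longrightarrow> a_part v = 0)"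
      unfolding a_part_wproj by (metis coord_wproj)
  qed (auto simp: wproj_def intro!: sum.neutral)
  then show ?thesis unfolding graded_lie.W_def[OF graded[OF xi]] by auto
qed

end

section \<open>The grading by the highest root\<close>

locale positive_rooted = rooted br \<theta> \<aa> X
  for br :: "'g::euclidean_space \<Rightarrow> 'g \<Rightarrow> 'g" and \<theta> \<aa> X +
  fixes \<Sigma>p :: "('g \<Rightarrow> real) set" and \<omega> :: "'g \<Rightarrow> real"
  assumes pos_system: "positive_system br \<aa> \<Sigma>p" and highest: "highest_root br \<aa> \<Sigma>p \<omega>"
begin

text \<open>A regular element that cuts out the positive system. The values of roots at it serve as
  heights, and it is the base point of the orbits considered below.\<close>

definition \<xi> :: 'g where
  "\<xi> = (SOME H. H \<in> \<aa> \<and> (\<forall>\<alpha>\<in>rts. \<alpha> H \<noteq> 0) \<and> \<Sigma>p = {\<alpha> \<in> rts. \<alpha> H > 0})"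

lemma xi: "\<xi> \<in> \<aa>" "\<alpha> \<in> rts \<Longrightarrow> \<alpha> \<xi> \<noteq> 0" "\<Sigma>p = {\<alpha> \<in> rts. \<alpha> \<xi> > 0}"
proof -
  have "\<exists>H. H \<in> \<aa> \<and> (\<forall>\<alpha>\<in>rts. \<alpha> H \<noteq> 0) \<and> \<Sigma>p = {\<alpha> \<in> rts. \<alpha> H > 0}"
    using pos_system unfolding positive_system_def by blast
  then have "\<xi> \<in> \<aa> \<and> (\<forall>\<alpha>\<in>rts. \<alpha> \<xi> \<noteq> 0) \<and> \<Sigma>p = {\<alpha> \<in> rts. \<alpha> \<xi> > 0}"
    unfolding \<xi>_def by (rule someI_ex)
  then show "\<xi> \<in> \<aa>" "\<alpha> \<in> rts \<Longrightarrow> \<alpha> \<xi> \<noteq> 0" "\<Sigma>p = {\<alpha> \<in> rts. \<alpha> \<xi> > 0}" by auto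
qed

abbreviation "Hv \<equiv> Hvec br \<aa>"
abbreviation "\<Sigma>0 \<equiv> sigma_zero br \<aa> \<Sigma>p \<omega>"
abbreviation "\<Sigma>h \<equiv> sigma_half br \<aa> \<Sigma>p \<omega>"

definition \<kappa> :: real where "\<kappa> = \<omega> (Hv \<omega>)"

lemma pos_roots: "\<alpha> \<in> \<Sigma>p \<Longrightarrow> \<alpha> \<in> rts" "\<alpha> \<in> \<Sigma>p \<Longrightarrow> \<alpha> \<xi> > 0"
  and pos_or_neg: "\<alpha> \<in> rts \<Longrightarrow> \<alpha> \<in> \<Sigma>p \<or> - \<alpha> \<in> \<Sigma>p"
proof -
  show "\<alpha> \<in> \<Sigma>p \<Longrightarrow> \<alpha> \<in> rts" "\<alpha> \<in> \<Sigma>p \<Longrightarrow> \<alpha> \<xi> > 0" using xi(3) by auto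
  assume "\<alpha> \<in> rts"
  then show "\<alpha> \<in> \<Sigma>p \<or> - \<alpha> \<in> \<Sigma>p" using xi(2)[of \<alpha>] root_neg[of \<alpha>] by (subst (1 2) xi(3)) auto
qed

lemma omega_root: "\<omega> \<in> rts"
  using highest unfolding highest_root_def by blast

text \<open>\<omega> - \<beta> is a nonnegative combination of simple roots, each of which is
  positive at \<xi>; equal heights make every coefficient vanish.\<close>

lemma height_le_omega:
  assumes "\<beta> \<in> rts"
  shows "\<beta> \<xi> \<le> \<omega> \<xi>" "\<beta> \<xi> = \<omega> \<xi> \<Longrightarrow> \<beta> = \<omega>"
proof -
  obtain k :: "('g \<Rightarrow> real) \<Rightarrow> nat"
    where k: "\<And>H. H \<in> \<aa> \<Longrightarrow> \<omega> H - \<beta> H = (\<Sum>\<delta>\<in>simple_roots \<Sigma>p. real (k \<delta>) * \<delta> H)"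
    using highest assms unfolding highest_root_def by blast
  have s: "simple_roots \<Sigma>p \<subseteq> \<Sigma>p" unfolding simple_roots_def by auto
  then have fin: "finite (simple_roots \<Sigma>p)" using finite_roots pos_roots(1) by (meson finite_subset subsetI)
  have nn: "real (k \<delta>) * \<delta> \<xi> \<ge> 0" if "\<delta> \<in> simple_roots \<Sigma>p" for \<delta>
    using s that pos_roots(2)[of \<delta>] by (intro mult_nonneg_nonneg) auto
  have "\<omega> \<xi> - \<beta> \<xi> \<ge> 0" unfolding k[OF xi(1)] using nn by (rule sum_nonneg)
  then show "\<beta> \<xi> \<le> \<omega> \<xi>" by simp
  show "\<beta> = \<omega>" if "\<beta> \<xi> = \<omega> \<xi>"
  proof (rule dual_eqI[OF root_dual[OF assms] root_dual[OF omega_root]])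
    fix H assume H: "H \<in> \<aa>"
    have "(\<Sum>\<delta>\<in>simple_roots \<Sigma>p. real (k \<delta>) * \<delta> \<xi>) = 0" using k[OF xi(1)] that by simp
    then have z: "\<forall>\<delta>\<in>simple_roots \<Sigma>p. real (k \<delta>) * \<delta> \<xi> = 0"
      using sum_nonneg_eq_0_iff[OF fin, of "\<lambda>\<delta>. real (k \<delta>) * \<delta> \<xi>"] nn by simp
    have "k \<delta> = 0" if d: "\<delta> \<in> simple_roots \<Sigma>p" for \<delta>
    proof -
      have "\<delta> \<in> \<Sigma>p" using d s by blast
      from pos_roots(2)[OF this] bspec[OF z d] show ?thesis by simp
    qed
    then have "\<omega> H - \<beta> H = 0" unfolding k[OF H] by (intro sum.neutral) auto
    then show "\<beta> H = \<omega> H" by simp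
  qed
qed

lemma omega_pos: "\<omega> \<xi> > 0" "\<omega> \<in> \<Sigma>p"
proof -
  have "- \<omega> \<xi> \<le> \<omega> \<xi>" using height_le_omega(1)[OF root_neg[OF omega_root]] by simp
  then show "\<omega> \<xi> > 0" using xi(2)[OF omega_root] by simp
  then show "\<omega> \<in> \<Sigma>p" using omega_root by (subst xi(3)) simp
qed

lemma kappa_pos: "\<kappa> > 0"
  unfolding \<kappa>_def using root_ip_pos[OF omega_root] root_ip_eq[OF omega_root omega_root] by simp

lemma root_ip_omega: "\<beta> \<in> rts \<Longrightarrow> root_ip br \<aa> \<omega> \<beta> = \<beta> (Hv \<omega>)"
  using root_ip_eq(2)[OF omega_root] .

lemma sigma_half_iff: "\<beta> \<in> \<Sigma>h \<longleftrightarrow> \<beta> \<in> \<Sigma>p \<and> \<beta> (Hv \<omega>) = \<kappa> / 2"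
  unfolding sigma_half_def using root_ip_omega pos_roots(1) omega_root by (auto simp: \<kappa>_def)

lemma sigma_zero_iff: "\<beta> \<in> \<Sigma>0 \<longleftrightarrow> \<beta> \<in> \<Sigma>p \<and> \<beta> (Hv \<omega>) = 0"
  unfolding sigma_zero_def using root_ip_omega pos_roots(1) by auto

lemma root_space_zero_height:
  assumes "x \<in> root_space br \<aa> \<alpha>" "\<alpha> \<in> dual_space \<aa>" "\<bar>\<alpha> \<xi>\<bar> > \<omega> \<xi>"
  shows "x = 0"
proof (rule root_space_cases[OF assms(1,2)])
  show "\<alpha> \<noteq> 0" using assms(3) omega_pos(1) by auto
  show "\<alpha> \<notin> rts"
  proof
    assume a: "\<alpha> \<in> rts"
    show False
      using height_le_omega(1)[OF a] height_le_omega(1)[OF root_neg[OF a]] assms(3) by simp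
  qed
qed

lemma root_dual_ops: "\<alpha> \<in> rts \<Longrightarrow> \<beta> \<in> rts \<Longrightarrow> \<alpha> + \<beta> \<in> dual_space \<aa>"
  "\<alpha> \<in> rts \<Longrightarrow> \<beta> \<in> rts \<Longrightarrow> \<alpha> - \<beta> \<in> dual_space \<aa>"
  by (rule dual_closed root_dual | assumption)+

lemma br_omega_pos:
  assumes "\<beta> \<in> rts" "\<beta> \<xi> > 0"
  shows "br (X \<omega>) (X \<beta>) = 0"
proof (rule root_space_zero_height[OF root_space_br[OF X_root[OF omega_root] X_root[OF assms(1)]]
      root_dual_ops(1)[OF omega_root assms(1)]])
  show "\<omega> \<xi> < \<bar>(\<omega> + \<beta>) \<xi>\<bar>" using omega_pos(1) assms(2) by simp
qed

lemma br_X_neg: "\<alpha> \<in> rts \<Longrightarrow> br (X (- \<alpha>)) (X \<alpha>) = - Hv \<alpha>"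
  by (subst br_antisym) (simp add: Hvec_root)

text \<open>Weights of the sl(2) triple of \<omega>: X \<beta> is annihilated by ad X_\<omega>, and
  lowering it twice gives 0 for reasons of height. If the first lowering is 0, so is
  \<beta>(H_\<omega>); otherwise raising the second lowering forces \<beta>(H_\<omega>) = \<kappa>/2
  and makes \<beta> - \<omega> a root.\<close>

lemma positive_root_cases:
  assumes "\<beta> \<in> \<Sigma>p" "\<beta> \<noteq> \<omega>"
  shows "\<beta> \<in> \<Sigma>0 \<or> (\<beta> \<in> \<Sigma>h \<and> \<omega> - \<beta> \<in> \<Sigma>h)"
proof -
  note b = pos_roots[OF assms(1)]
  note nw = root_neg[OF omega_root]
  define f where "f = br (X (- \<omega>))"
  define v where "v = X \<beta>"
  have ev: "br (X \<omega>) v = 0" unfolding v_def by (rule br_omega_pos[OF b])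
  have e: "br (X \<omega>) (f w) = br (Hv \<omega>) w + f (br (X \<omega>) w)" for w
    unfolding f_def Hvec_root[OF omega_root] by (rule br_derivation)
  have Hw: "Hv \<omega> \<in> \<aa>" by (rule Hvec_in_a[OF omega_root])
  have fv: "f v \<in> root_space br \<aa> (\<beta> - \<omega>)"
    unfolding f_def v_def using root_space_br[OF X_root[OF nw] X_root[OF b(1)]] by simp
  have ff0: "f (f v) = 0"
  proof (rule root_space_zero_height)
    show "f (f v) \<in> root_space br \<aa> (- \<omega> + (\<beta> - \<omega>))"
      unfolding f_def using root_space_br[OF X_root[OF nw] fv[unfolded f_def]] .
    show "- \<omega> + (\<beta> - \<omega>) \<in> dual_space \<aa>"
      using root_dual[OF nw] root_dual_ops(2)[OF b(1) omega_root] dual_closed(1) by blast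
    have "\<beta> \<xi> < \<omega> \<xi>" using height_le_omega[OF b(1)] assms(2) by force
    then show "\<bar>(- \<omega> + (\<beta> - \<omega>)) \<xi>\<bar> > \<omega> \<xi>" by simp
  qed
  have efv: "br (X \<omega>) (f v) = \<beta> (Hv \<omega>) *\<^sub>R v"
    using e[of v] ev X_eig[OF b(1) Hw] by (simp add: f_def v_def)
  show ?thesis
  proof (cases "f v = 0")
    case True
    then have "\<beta> (Hv \<omega>) = 0" using efv X_nonzero[OF b(1)] by (simp add: v_def)
    then show ?thesis using assms(1) by (simp add: sigma_zero_iff)
  next
    case False
    have "br (Hv \<omega>) (f v) = (\<beta> - \<omega>) (Hv \<omega>) *\<^sub>R f v" using fv Hw by (simp add: root_space_def)
    then have "(\<beta> - \<omega>) (Hv \<omega>) *\<^sub>R f v + \<beta> (Hv \<omega>) *\<^sub>R f v = 0"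
      using e[of "f v"] ff0 efv by (simp add: f_def)
    then have "((\<beta> - \<omega>) (Hv \<omega>) + \<beta> (Hv \<omega>)) *\<^sub>R f v = 0"
      by (simp only: scaleR_left_distrib)
    then have h: "\<beta> (Hv \<omega>) = \<kappa> / 2" using False by (simp add: \<kappa>_def)
    have "\<beta> - \<omega> \<noteq> 0" using assms(2) by simp
    then have "\<beta> - \<omega> \<in> rts"
      using root_space_cases[OF fv root_dual_ops(2)[OF b(1) omega_root]] False by blast
    from root_neg[OF this] have r: "\<omega> - \<beta> \<in> rts" by simp
    have "(\<omega> - \<beta>) \<xi> > 0" using height_le_omega[OF b(1)] assms(2) by force
    then have "\<omega> - \<beta> \<in> \<Sigma>p" using r by (subst xi(3)) simp
    then show ?thesis using h assms(1) by (simp add: sigma_half_iff \<kappa>_def)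
  qed
qed

lemma Sigma_partition: "\<Sigma>p = \<Sigma>0 \<union> \<Sigma>h \<union> {\<omega>}" "\<omega> \<notin> \<Sigma>0" "\<omega> \<notin> \<Sigma>h" "\<Sigma>0 \<inter> \<Sigma>h = {}"
proof -
  show "\<omega> \<notin> \<Sigma>0" "\<omega> \<notin> \<Sigma>h" "\<Sigma>0 \<inter> \<Sigma>h = {}"
    using kappa_pos by (auto simp: sigma_half_iff sigma_zero_iff \<kappa>_def[symmetric])
  have "\<Sigma>0 \<subseteq> \<Sigma>p" "\<Sigma>h \<subseteq> \<Sigma>p" by (auto simp: sigma_half_iff sigma_zero_iff)
  then show "\<Sigma>p = \<Sigma>0 \<union> \<Sigma>h \<union> {\<omega>}" using positive_root_cases omega_pos(2) by blast
qed

lemma half_complement: "\<alpha> \<in> \<Sigma>h \<Longrightarrow> \<omega> - \<alpha> \<in> \<Sigma>h"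
  using positive_root_cases[of \<alpha>] Sigma_partition by blast

lemma half_roots: "\<alpha> \<in> \<Sigma>h \<Longrightarrow> \<alpha> \<in> rts"
  using pos_roots(1) by (auto simp: sigma_half_iff)

lemma half_complement_root: "\<alpha> \<in> \<Sigma>h \<Longrightarrow> \<omega> - \<alpha> \<in> rts"
  using half_roots half_complement by blast

text \<open>The cases correspond to the eigenvalues \<kappa>, \<kappa>/2, 0, -\<kappa>/2, -\<kappa>
  of ad H_\<omega>.\<close>

lemma root_cases:
  assumes "\<beta> \<in> rts"
  obtains "\<beta> = \<omega>" | "\<beta> \<in> \<Sigma>h" | "\<beta> \<in> \<Sigma>0 \<union> uminus ` \<Sigma>0" "\<beta> (Hv \<omega>) = 0" | "- \<beta> \<in> \<Sigma>h" | "\<beta> = - \<omega>"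
proof (cases "\<beta> \<in> \<Sigma>p")
  case True
  then show ?thesis using that(1-3) positive_root_cases[of \<beta>] by (auto simp: sigma_zero_iff)
next
  case False
  then have n: "- \<beta> \<in> \<Sigma>p" using pos_or_neg[OF assms] by blast
  have "\<beta> = - (- \<beta>)" by simp
  consider "- \<beta> = \<omega>" | "- \<beta> \<in> \<Sigma>h" | "- \<beta> \<in> \<Sigma>0" using positive_root_cases[OF n] by blast
  then show ?thesis
  proof cases
    case 1
    then have "\<beta> = - \<omega>" by (metis minus_minus)
    then show ?thesis by (rule that(5))
  next
    case 3
    then have "\<beta> \<in> uminus ` \<Sigma>0" using \<open>\<beta> = - (- \<beta>)\<close> by blast
    moreover have "\<beta> (Hv \<omega>) = 0" using 3 by (simp add: sigma_zero_iff)
    ultimately show ?thesis using that(3) by blast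
  qed (rule that(4))
qed

section \<open>The linear system for H(\<gamma>)\<close>

lemma determined_on_half:
  assumes H: "H \<in> \<aa>" "\<omega> H = 0" "\<And>\<alpha>. \<alpha> \<in> \<Sigma>h \<Longrightarrow> \<alpha> H = 0"
  shows "H = 0"
proof -
  note Hw = Hvec_in_a[OF omega_root]
  \<comment> \<open>J is an ideal: X \<alpha> with \<alpha>(H_\<omega>) nonzero commutes with J,
    while \<aa> and the other X \<alpha> preserve the eigenspaces of ad H_\<omega>. It misses X
    \<omega>, so simplicity makes it 0; and H belongs to it.\<close>
  define J where "J = {V. br (Hv \<omega>) V = 0 \<and> (\<forall>\<beta>\<in>rts. \<beta> (Hv \<omega>) \<noteq> 0 \<longrightarrow> br V (X \<beta>) = 0)}"
  have J: "subspace J" unfolding J_def subspace_def by (auto simp: br_add_left br_add_right)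
  have inv0: "br x y \<in> J" if y: "y \<in> J" and x: "x \<in> root_space br \<aa> \<alpha>" "\<alpha> \<in> dual_space \<aa>" "\<alpha> (Hv \<omega>) = 0" for x y \<alpha>
  proof -
    have "br (Hv \<omega>) x = 0" using x Hw by (simp add: root_space_def)
    then have "br (Hv \<omega>) (br x y) = 0" using y by (simp add: br_derivation[of "Hv \<omega>" x y] J_def)
    moreover have "br (br x y) (X \<beta>) = 0" if b: "\<beta> \<in> rts" "\<beta> (Hv \<omega>) \<noteq> 0" for \<beta>
    proof -
      have rs: "br x (X \<beta>) \<in> root_space br \<aa> (\<alpha> + \<beta>)" by (rule root_space_br[OF x(1) X_root[OF b(1)]])
      have d: "\<alpha> + \<beta> \<in> dual_space \<aa>" using x(2) root_dual[OF b(1)] dual_closed(1) by blast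
      have v: "(\<alpha> + \<beta>) (Hv \<omega>) \<noteq> 0" using x(3) b(2) by simp
      have "br y (br x (X \<beta>)) = 0"
      proof (cases "\<alpha> + \<beta> \<in> rts")
        case True
        then obtain k where "br x (X \<beta>) = k *\<^sub>R X (\<alpha> + \<beta>)"
          using rs unfolding root_space_span[OF True] by (auto simp: span_singleton)
        then show ?thesis using y True v by (simp add: J_def)
      next
        case False
        have "\<alpha> + \<beta> \<noteq> 0" using v by (metis zero_fun_apply)
        then show ?thesis using root_space_cases[OF rs d] False by simp
      qed
      moreover have "br y (X \<beta>) = 0" using y b by (simp add: J_def)
      ultimately show ?thesis using br_derivation[of x y "X \<beta>"] by simp
    qed
    ultimately show ?thesis by (simp add: J_def)
  qed
  have invX: "br (X \<alpha>) y \<in> J" if y: "y \<in> J" and a: "\<alpha> \<in> rts" for y \<alpha>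
  proof (cases "\<alpha> (Hv \<omega>) = 0")
    case True
    then show ?thesis using inv0[OF y X_root[OF a] root_dual[OF a]] by blast
  next
    case False
    then have "br (X \<alpha>) y = 0" using y a by (subst br_antisym) (simp add: J_def)
    then show ?thesis using subspace_0[OF J] by simp
  qed
  have "br x y \<in> J" if y: "y \<in> J" for x y
  proof -
    have "br (a_part x) y \<in> J" by (rule inv0[OF y a_root_space[OF a_part_in_a] dual_closed(4)]) simp
    moreover have "(\<Sum>\<alpha>\<in>rts. coord \<alpha> x *\<^sub>R br (X \<alpha>) y) \<in> J"
      using invX[OF y] by (intro subspace_sum[OF J] subspace_scale[OF J]) auto
    moreover have "br x y = br (a_part x) y + (\<Sum>\<alpha>\<in>rts. coord \<alpha> x *\<^sub>R br (X \<alpha>) y)"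
      by (subst decomposition[of x]) (simp add: br_add_left br_sum_left)
    ultimately show ?thesis using subspace_add[OF J] by simp
  qed
  then have "J = {0} \<or> J = UNIV" using simple J unfolding simple_lie_def by blast
  moreover have "X \<omega> \<notin> J"
    using X_eig[OF omega_root Hw] X_nonzero[OF omega_root] kappa_pos by (simp add: J_def \<kappa>_def)
  ultimately have J0: "J = {0}" by blast
  have "\<beta> H = 0" if b: "\<beta> \<in> rts" "\<beta> (Hv \<omega>) \<noteq> 0" for \<beta>
    using b(1)
  proof (cases rule: root_cases)
    case 4
    then show ?thesis using H(3)[of "- \<beta>"] by simp
  qed (use b(2) H in auto)
  then have "H \<in> J" using H(1) X_eig a_abelian[OF Hw] by (auto simp: J_def)
  then show ?thesis using J0 by blast
qed

lemma H_system_iff: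
  assumes R: "half_representatives br \<aa> \<Sigma>p \<omega> R" and g: "\<gamma> \<in> \<Sigma>h"
  shows "H_system br \<aa> \<omega> R \<gamma> H \<longleftrightarrow> H = - (1 / 3) *\<^sub>R (Hv \<omega> + Hv \<gamma>)"
proof
  note Hw = Hvec_in_a[OF omega_root] and Hg = Hvec_in_a[OF half_roots[OF g]]
  have Rh: "R \<subseteq> \<Sigma>h" and Rex: "\<And>\<alpha>. \<alpha> \<in> \<Sigma>h \<Longrightarrow> \<alpha> \<in> R \<or> \<omega> - \<alpha> \<in> R"
    using R unfolding half_representatives_def by blast+
  define K where "K = - (1 / 3) *\<^sub>R (Hv \<omega> + Hv \<gamma>)"
  have K: "K \<in> \<aa>" unfolding K_def using Hw Hg by (intro a_scale a_add)
  have val: "\<alpha> K = - (1 / 3) * (\<alpha> (Hv \<omega>) + \<alpha> (Hv \<gamma>))" if "\<alpha> \<in> rts" for \<alpha>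
    using dualD(2)[OF root_dual[OF that] a_add[OF Hw Hg], of "- (1 / 3)"]
      dualD(1)[OF root_dual[OF that] Hw Hg] by (simp only: K_def)
  have wg: "\<omega> (Hv \<gamma>) = \<kappa> / 2"
    using root_ip_eq[OF omega_root half_roots[OF g]] g by (simp add: sigma_half_iff)
  have wK: "\<omega> K = - \<omega> (Hv \<gamma>)" using val[OF omega_root] wg by (simp add: \<kappa>_def[symmetric])
  have aK: "3 * \<alpha> K - \<omega> K = - \<alpha> (Hv \<gamma>)" if "\<alpha> \<in> R" for \<alpha>
  proof -
    have h: "\<alpha> \<in> \<Sigma>h" using that Rh by blast
    then show ?thesis using val[OF half_roots[OF h]] wK wg by (simp add: sigma_half_iff field_simps)
  qed
  show "H_system br \<aa> \<omega> R \<gamma> H" if "H = - (1 / 3) *\<^sub>R (Hv \<omega> + Hv \<gamma>)"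
    using that K wK aK unfolding H_system_def K_def by simp
  show "H = - (1 / 3) *\<^sub>R (Hv \<omega> + Hv \<gamma>)" if "H_system br \<aa> \<omega> R \<gamma> H"
  proof -
    have H: "H \<in> \<aa>" "\<omega> H = - \<omega> (Hv \<gamma>)" "\<And>\<alpha>. \<alpha> \<in> R \<Longrightarrow> 3 * \<alpha> H - \<omega> H = - \<alpha> (Hv \<gamma>)"
      using that unfolding H_system_def by auto
    have sub: "\<alpha> (H - K) = \<alpha> H - \<alpha> K" if "\<alpha> \<in> rts" for \<alpha>
      using dualD(1)[OF root_dual[OF that] H(1) a_neg[OF K]]
        dualD(2)[OF root_dual[OF that] K, of "-1"] by simp
    have w0: "\<omega> (H - K) = 0" using sub[OF omega_root] H(2) wK by simp
    have r0: "\<alpha> (H - K) = 0" if "\<alpha> \<in> R" for \<alpha>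
    proof -
      have "\<alpha> \<in> rts" using that Rh half_roots by blast
      from sub[OF this] show ?thesis using H(2) H(3)[OF that] aK[OF that] wK by linarith
    qed
    \<comment> \<open>If R contains \<omega> - \<alpha> instead of \<alpha>, the value at \<alpha>
      follows from the one at \<omega>; so the choice of representatives does not affect the
      solution.\<close>
    have "\<alpha> (H - K) = 0" if "\<alpha> \<in> \<Sigma>h" for \<alpha>
      using Rex[OF that] r0[of \<alpha>] r0[of "\<omega> - \<alpha>"] w0 by auto
    then have "H - K = 0" using w0 H(1) K by (intro determined_on_half a_diff) auto
    then have "H = K" by simp
    then show ?thesis unfolding K_def .
  qed
qed

lemma H_sol_eq:
  assumes "half_representatives br \<aa> \<Sigma>p \<omega> R" "\<gamma> \<in> \<Sigma>h"
  shows "H_sol br \<aa> \<omega> R \<gamma> = - (1 / 3) *\<^sub>R (Hv \<omega> + Hv \<gamma>)"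
  unfolding H_sol_def H_system_iff[OF assms] by simp

text \<open>The orbit of the lowest root vector satisfies \<open>(ad u)\<^sup>2 X\<^sub>\<omega> = - (\<omega>,\<omega>) u\<close>. Pairing this with
  \<open>X\<^sub>-\<^sub>\<gamma>\<close> expresses the coefficient of \<open>u\<close> at \<open>X\<^sub>\<gamma>\<close> through lower ones.\<close>

lemma cubic_coefficient:
  assumes c: "structure_constants br \<aa> X c" and g: "\<gamma> \<in> \<Sigma>h"
    and u: "br u (br u (X \<omega>)) = - \<kappa> *\<^sub>R u" and u1: "B (X \<omega>) u = 1"
  shows "B (X (- \<gamma>)) u =
    - (1 / c \<gamma> (\<omega> - \<gamma>)) * B (X (\<omega> - \<gamma>)) u * B (- (1 / 3) *\<^sub>R (Hv \<omega> + Hv \<gamma>)) u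
    + 1 / 3 * (\<Sum>\<alpha>\<in>{\<alpha> \<in> \<Sigma>h. - \<gamma> + \<alpha> \<in> \<Sigma>0 \<union> uminus ` \<Sigma>0}.
        c \<alpha> (- \<gamma>) / c \<alpha> (\<omega> - \<alpha>) * B (X (\<omega> - \<alpha>)) u * B (X (\<alpha> - \<gamma>)) u)"
proof -
  note Hw = Hvec_in_a[OF omega_root]
  have cX: "br (X \<alpha>) (X \<beta>) = c \<alpha> \<beta> *\<^sub>R X (\<alpha> + \<beta>)" if "\<alpha> \<in> rts" "\<beta> \<in> rts" "\<alpha> + \<beta> \<in> rts" for \<alpha> \<beta>
    using c that unfolding structure_constants_def by blast
  define p where "p = (\<lambda>\<beta>. B (X \<beta>) u)"
  \<comment> \<open>- k \<alpha> is the constant c (-\<alpha>) \<omega> in the bracket of X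
    (-\<alpha>) with X \<omega>. The relation that c (-\<alpha>) \<omega> times c \<alpha> (\<omega>
    - \<alpha>) is \<kappa>/2 rewrites it by the constants occurring in the claim.\<close>
  define k where "k = (\<lambda>\<alpha>. - (\<kappa> / 2) / c \<alpha> (\<omega> - \<alpha>))"
  have cc: "c \<alpha> (\<omega> - \<alpha>) \<noteq> 0" and up: "br (X (- \<alpha>)) (X \<omega>) = - k \<alpha> *\<^sub>R X (\<omega> - \<alpha>)" if a: "\<alpha> \<in> \<Sigma>h" for \<alpha>
  proof -
    note ar = half_roots[OF a] and wr = half_complement_root[OF a]
    have na: "- \<alpha> \<in> rts" and nw: "- \<omega> \<in> rts" using ar omega_root root_neg by auto
    have e: "br (X (- \<alpha>)) (X \<omega>) = c (- \<alpha>) \<omega> *\<^sub>R X (\<omega> - \<alpha>)"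
      using cX[OF na omega_root] wr by (simp add: add.commute)
    have "br (X (- \<omega>)) (X (- \<alpha>)) = 0"
    proof (rule root_space_zero_height[OF root_space_br[OF X_root[OF nw] X_root[OF na]]])
      show "- \<omega> + - \<alpha> \<in> dual_space \<aa>" using root_dual_ops(1)[OF nw na] .
      have "\<alpha> \<xi> > 0" using a pos_roots(2)[of \<alpha>] by (auto simp: sigma_half_iff)
      then show "\<omega> \<xi> < \<bar>(- \<omega> + - \<alpha>) \<xi>\<bar>" using omega_pos(1) by simp
    qed
    \<comment> \<open>Pairing two evaluations of this double bracket with X \<alpha> gives the
      product of the two constants; the other Jacobi term vanishes since -\<omega> - \<alpha> is too
      low to be a root.\<close>
    then have "br (X (- \<omega>)) (br (X (- \<alpha>)) (X \<omega>)) = br (X (- \<alpha>)) (- Hv \<omega>)"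
      by (subst br_derivation) (simp add: br_X_neg[OF omega_root])
    also have "\<dots> = br (Hv \<omega>) (X (- \<alpha>))" by (subst br_antisym) simp
    also have "\<dots> = - (\<kappa> / 2) *\<^sub>R X (- \<alpha>)" using X_eig[OF na Hw] a by (simp add: sigma_half_iff)
    finally have E: "c (- \<alpha>) \<omega> *\<^sub>R br (X (- \<omega>)) (X (\<omega> - \<alpha>)) = - (\<kappa> / 2) *\<^sub>R X (- \<alpha>)" unfolding e by simp
    have "B (br (X (- \<omega>)) (X (\<omega> - \<alpha>))) (X \<alpha>) = - B (X (- \<omega>)) (br (X \<alpha>) (X (\<omega> - \<alpha>)))"
      unfolding B_invariant by (subst (2) br_antisym) (simp add: B_simps)
    also have "\<dots> = - c \<alpha> (\<omega> - \<alpha>)"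
      using cX[OF ar wr] omega_root X_norm[OF nw] by (simp add: B_simps)
    finally have m: "c (- \<alpha>) \<omega> * c \<alpha> (\<omega> - \<alpha>) = \<kappa> / 2"
      using arg_cong[OF E, of "\<lambda>x. B x (X \<alpha>)"] X_norm[OF na] by (simp add: B_simps)
    then show nz: "c \<alpha> (\<omega> - \<alpha>) \<noteq> 0" using kappa_pos by auto
    show "br (X (- \<alpha>)) (X \<omega>) = - k \<alpha> *\<^sub>R X (\<omega> - \<alpha>)" unfolding e k_def using m nz by (simp add: field_simps)
  qed
  have u_dec: "u = a_part u + (\<Sum>\<alpha>\<in>rts. p (- \<alpha>) *\<^sub>R X \<alpha>)"
    using decomposition[of u] by (simp add: p_def coord_def B_sym)
  \<comment> \<open>Besides its Cartan part, only the components of u at -\<omega> and at the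
    negatives of \<Sigma>h contribute to [u, X \<omega>]. If \<beta> is orthogonal to \<omega>, then
    \<beta> + \<omega> has the eigenvalue \<kappa>, which \<omega> alone has among the
    roots.\<close>
  have zero: "br (X \<beta>) (X \<omega>) = 0" if "\<beta> \<in> rts" "\<beta> \<notin> insert (- \<omega>) (uminus ` \<Sigma>h)" for \<beta>
    using that(1)
  proof (cases rule: root_cases)
    case 3
    show ?thesis
    proof (cases "\<beta> \<xi> > 0")
      case True
      then show ?thesis using br_omega_pos[OF that(1)] by (subst br_antisym) simp
    next
      case False
      show ?thesis
      proof (rule root_space_cases[OF root_space_br[OF X_root[OF that(1)] X_root[OF omega_root]] root_dual_ops(1)[OF that(1) omega_root]])
        have v: "(\<beta> + \<omega>) (Hv \<omega>) = \<kappa>" using 3 by (simp add: \<kappa>_def)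
        then show "\<beta> + \<omega> \<noteq> 0" using kappa_pos by (metis zero_fun_apply less_irrefl)
        show "\<beta> + \<omega> \<notin> rts"
        proof
          assume "\<beta> + \<omega> \<in> rts"
          then show False
          proof (cases rule: root_cases)
            case 1
            then show ?thesis using root_nonzero[OF that(1)] by simp
          next
            case 4
            then show ?thesis using v kappa_pos by (simp add: sigma_half_iff)
          next
            case 5
            have "(- \<omega>) (Hv \<omega>) = \<kappa>" using v unfolding 5 .
            then show ?thesis using kappa_pos by (simp add: \<kappa>_def)
          qed (use v kappa_pos in \<open>auto simp: sigma_half_iff\<close>)
        qed
      qed
    qed
  next
    case 2
    then show ?thesis using br_omega_pos[OF that(1)] pos_roots(2)[of \<beta>]
      by (subst br_antisym) (simp add: sigma_half_iff)
  next
    case 4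
    then have "\<beta> \<in> uminus ` \<Sigma>h" by (intro image_eqI[of _ _ "- \<beta>"]) auto
    then show ?thesis using that(2) by blast
  qed (use that(2) in auto)
  have fh: "finite \<Sigma>h" using finite_roots half_roots by (meson finite_subset subsetI)
  have uw: "br u (X \<omega>) = B (Hv \<omega>) u *\<^sub>R X \<omega> - Hv \<omega> - (\<Sum>\<alpha>\<in>\<Sigma>h. (p \<alpha> * k \<alpha>) *\<^sub>R X (\<omega> - \<alpha>))"
  proof -
    have T: "insert (- \<omega>) (uminus ` \<Sigma>h) \<subseteq> rts" using omega_root half_roots root_neg by blast
    have "\<omega> (a_part u) = B (a_part u) (Hv \<omega>)" using B_Hvec[OF omega_root a_part_in_a] by simp
    also have "\<dots> = B u (Hv \<omega>)"
      by (subst (2) u_dec) (simp add: B_simps B_sum_left B_X_a[OF _ Hw])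
    finally have a: "br (a_part u) (X \<omega>) = B (Hv \<omega>) u *\<^sub>R X \<omega>"
      using X_eig[OF omega_root a_part_in_a] by (simp add: B_sym)
    have "br u (X \<omega>) = br (a_part u) (X \<omega>) + (\<Sum>\<alpha>\<in>rts. p (- \<alpha>) *\<^sub>R br (X \<alpha>) (X \<omega>))"
      by (subst u_dec) (simp add: br_add_left br_sum_left)
    also have "(\<Sum>\<alpha>\<in>rts. p (- \<alpha>) *\<^sub>R br (X \<alpha>) (X \<omega>))
        = (\<Sum>\<alpha>\<in>insert (- \<omega>) (uminus ` \<Sigma>h). p (- \<alpha>) *\<^sub>R br (X \<alpha>) (X \<omega>))"
      using T zero by (intro sum.mono_neutral_right finite_roots) auto
    also have "\<dots> = p \<omega> *\<^sub>R br (X (- \<omega>)) (X \<omega>) + (\<Sum>\<alpha>\<in>uminus ` \<Sigma>h. p (- \<alpha>) *\<^sub>R br (X \<alpha>) (X \<omega>))"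
      using fh Sigma_partition(3) by (subst sum.insert) auto
    also have "(\<Sum>\<alpha>\<in>uminus ` \<Sigma>h. p (- \<alpha>) *\<^sub>R br (X \<alpha>) (X \<omega>))
        = (\<Sum>\<alpha>\<in>\<Sigma>h. p \<alpha> *\<^sub>R br (X (- \<alpha>)) (X \<omega>))"
      by (subst sum.reindex) (auto simp: inj_on_def)
    also have "\<dots> = - (\<Sum>\<alpha>\<in>\<Sigma>h. (p \<alpha> * k \<alpha>) *\<^sub>R X (\<omega> - \<alpha>))"
      unfolding sum_negf[symmetric] by (intro sum.cong) (auto simp: up)
    finally show ?thesis unfolding br_X_neg[OF omega_root] using a u1 by (simp add: p_def)
  qed
  \<comment> \<open>The involution \<alpha> \<mapsto> \<omega> - \<alpha> of \<Sigma>h turns the sum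
    into one over X \<alpha>; its sign changes because \<open>k\<close> is antisymmetric under it,
    by \<open>k_swap\<close>.\<close>
  have reindex: "(\<Sum>\<alpha>\<in>\<Sigma>h. (p \<alpha> * k \<alpha>) *\<^sub>R X (\<omega> - \<alpha>)) = (\<Sum>\<alpha>\<in>\<Sigma>h. (p (\<omega> - \<alpha>) * k (\<omega> - \<alpha>)) *\<^sub>R X \<alpha>)"
    by (rule sum.reindex_bij_witness[of _ "\<lambda>\<alpha>. \<omega> - \<alpha>" "\<lambda>\<alpha>. \<omega> - \<alpha>"]) (auto intro: half_complement)
  have k_swap: "k (\<omega> - \<alpha>) = - k \<alpha>" if a: "\<alpha> \<in> \<Sigma>h" for \<alpha>
  proof -
    have "c (\<omega> - \<alpha>) \<alpha> *\<^sub>R X \<omega> = - c \<alpha> (\<omega> - \<alpha>) *\<^sub>R X \<omega>"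
      using cX[OF half_roots[OF a] half_complement_root[OF a]] cX[OF half_complement_root[OF a] half_roots[OF a]]
        omega_root br_antisym[of "X (\<omega> - \<alpha>)" "X \<alpha>"] by simp
    then have "c (\<omega> - \<alpha>) \<alpha> = - c \<alpha> (\<omega> - \<alpha>)"
      using X_nonzero[OF omega_root] scaleR_cancel_right by blast
    then show ?thesis by (simp add: k_def)
  qed
  have uw': "br u (X \<omega>) = B (Hv \<omega>) u *\<^sub>R X \<omega> - Hv \<omega> + (\<Sum>\<alpha>\<in>\<Sigma>h. (p (\<omega> - \<alpha>) * k \<alpha>) *\<^sub>R X \<alpha>)"
    unfolding uw reindex by (simp add: k_swap sum_negf)
  define Sg where "Sg = {\<alpha> \<in> \<Sigma>h. - \<gamma> + \<alpha> \<in> \<Sigma>0 \<union> uminus ` \<Sigma>0}"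
  note gr = half_roots[OF g] and ng = root_neg[OF half_roots[OF g]]
  \<comment> \<open>By invariance, [u, w] pairs with X (-\<gamma>) to - b w. Evaluating b on the
    parts of w = [u, X \<omega>] produces all terms of the formula.\<close>
  define b where "b = (\<lambda>w. B w (br u (X (- \<gamma>))))"
  have b_inv: "b w = B (br (X (- \<gamma>)) w) u" for w
    unfolding b_def by (subst B_sym, subst B_invariant) (simp add: B_sym)
  have b_w: "b (X \<omega>) = - k \<gamma> * p (\<omega> - \<gamma>)"
    by (simp add: b_inv up[OF g] B_simps p_def)
  have b_H: "b (Hv \<omega>) = \<kappa> / 2 * p (- \<gamma>)"
  proof -
    have "br (X (- \<gamma>)) (Hv \<omega>) = (\<kappa> / 2) *\<^sub>R X (- \<gamma>)"
      using X_eig[OF ng Hw] g by (subst br_antisym) (simp add: sigma_half_iff)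
    then show ?thesis by (simp add: b_inv B_simps p_def)
  qed
  have b_g: "b (X \<gamma>) = - B (Hv \<gamma>) u" by (simp add: b_inv br_X_neg[OF gr] B_simps)
  have b_S: "b (X \<alpha>) = - c \<alpha> (- \<gamma>) * p (\<alpha> - \<gamma>)" if "\<alpha> \<in> Sg" for \<alpha>
  proof -
    have a: "\<alpha> \<in> rts" "\<alpha> + - \<gamma> \<in> rts"
      using that half_roots pos_roots(1) root_neg by (auto simp: Sg_def sigma_zero_iff)
    have "br (X (- \<gamma>)) (X \<alpha>) = - (c \<alpha> (- \<gamma>) *\<^sub>R X (\<alpha> - \<gamma>))"
      using cX[OF a(1) ng a(2)] by (subst br_antisym) simp
    then show ?thesis by (simp add: b_inv B_simps p_def)
  qed
  have b_0: "b (X \<alpha>) = 0" if a: "\<alpha> \<in> \<Sigma>h" "\<alpha> \<notin> insert \<gamma> Sg" for \<alpha>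
  proof -
    have "br (X (- \<gamma>)) (X \<alpha>) = 0"
    proof (rule root_space_cases[OF root_space_br[OF X_root[OF ng] X_root[OF half_roots[OF a(1)]]]
          root_dual_ops(1)[OF ng half_roots[OF a(1)]]])
      show "- \<gamma> + \<alpha> \<noteq> 0" using a(2) by (simp add: neg_eq_iff_add_eq_0[symmetric])
      have v: "(- \<gamma> + \<alpha>) (Hv \<omega>) = 0" using g a(1) by (simp add: sigma_half_iff)
      show "- \<gamma> + \<alpha> \<notin> rts"
      proof
        assume "- \<gamma> + \<alpha> \<in> rts"
        then show False
        proof (cases rule: root_cases)
          case 3
          then show ?thesis using a by (simp add: Sg_def)
        next
          case 1
          then show ?thesis using v kappa_pos by (simp add: \<kappa>_def)
        next
          case 2
          then show ?thesis using v kappa_pos by (simp add: sigma_half_iff)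
        next
          case 4
          then show ?thesis using v kappa_pos by (simp add: sigma_half_iff)
        next
          case 5
          then show ?thesis using v kappa_pos by (simp add: \<kappa>_def)
        qed
      qed
    qed
    then show ?thesis by (simp add: b_inv B_simps)
  qed
  \<comment> \<open>Otherwise 0 would be a positive root or the negative of one. The term \<alpha> =
    \<gamma> is split off because it yields H_\<gamma> instead of a root vector.\<close>
  have g_notin: "\<gamma> \<notin> Sg" using pos_roots(2)[of 0] pos_roots(2)[of "- 0"] by (auto simp: Sg_def sigma_zero_iff)
  have Sg: "insert \<gamma> Sg \<subseteq> \<Sigma>h" using g by (auto simp: Sg_def)
  then have fS: "finite Sg" using fh finite_subset by auto
  have "\<kappa> * p (- \<gamma>) = - B (br u (br u (X \<omega>))) (X (- \<gamma>))"
    by (simp add: u B_simps p_def B_sym)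
  also have "\<dots> = b (br u (X \<omega>))"
    unfolding b_def by (subst br_antisym) (simp add: B_simps B_invariant)
  also have "\<dots> = B (Hv \<omega>) u * b (X \<omega>) - b (Hv \<omega>) + (\<Sum>\<alpha>\<in>\<Sigma>h. p (\<omega> - \<alpha>) * k \<alpha> * b (X \<alpha>))"
    unfolding uw' by (simp add: b_def B_simps B_sum_left)
  also have "(\<Sum>\<alpha>\<in>\<Sigma>h. p (\<omega> - \<alpha>) * k \<alpha> * b (X \<alpha>)) = (\<Sum>\<alpha>\<in>insert \<gamma> Sg. p (\<omega> - \<alpha>) * k \<alpha> * b (X \<alpha>))"
    using Sg b_0 by (intro sum.mono_neutral_right fh) auto
  also have "\<dots> = p (\<omega> - \<gamma>) * k \<gamma> * b (X \<gamma>) + (\<Sum>\<alpha>\<in>Sg. p (\<omega> - \<alpha>) * k \<alpha> * b (X \<alpha>))"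
    using g_notin fS by simp
  also have "(\<Sum>\<alpha>\<in>Sg. p (\<omega> - \<alpha>) * k \<alpha> * b (X \<alpha>))
      = \<kappa> / 2 * (\<Sum>\<alpha>\<in>Sg. c \<alpha> (- \<gamma>) / c \<alpha> (\<omega> - \<alpha>) * p (\<omega> - \<alpha>) * p (\<alpha> - \<gamma>))"
    unfolding sum_distrib_left by (intro sum.cong) (simp_all add: b_S k_def)
  finally have main: "\<kappa> * p (- \<gamma>) = B (Hv \<omega>) u * (- k \<gamma> * p (\<omega> - \<gamma>)) - \<kappa> / 2 * p (- \<gamma>)
      + (p (\<omega> - \<gamma>) * k \<gamma> * - B (Hv \<gamma>) u
        + \<kappa> / 2 * (\<Sum>\<alpha>\<in>Sg. c \<alpha> (- \<gamma>) / c \<alpha> (\<omega> - \<alpha>) * p (\<omega> - \<alpha>) * p (\<alpha> - \<gamma>)))"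
    unfolding b_w b_H b_g .
  define Q where "Q = (\<Sum>\<alpha>\<in>Sg. c \<alpha> (- \<gamma>) / c \<alpha> (\<omega> - \<alpha>) * p (\<omega> - \<alpha>) * p (\<alpha> - \<gamma>))"
  define h where "h = B (Hv \<omega>) u + B (Hv \<gamma>) u"
  \<comment> \<open>K stands for \<kappa>, P for p (-\<gamma>), d for c \<gamma> (\<omega> -
    \<gamma>), w for p (\<omega> - \<gamma>), x and y for the pairings of u with H_\<omega> and
    H_\<gamma>, and q for the sum.\<close>
  have alg: "3 * P = 1 / d * w * (x + y) + q"
    if "K * P = x * (- (- (K / 2) / d) * w) - K / 2 * P + (w * (- (K / 2) / d) * - y + K / 2 * q)" "K > 0"
    for K P d w x y q :: real
  proof -
    have "K * (3 * P) = K * (1 / d * w * (x + y) + q)" using that(1) by (simp add: algebra_simps add_divide_distrib)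
    then show ?thesis using that(2) by (simp only: mult_cancel_left) auto
  qed
  have "3 * p (- \<gamma>) = 1 / c \<gamma> (\<omega> - \<gamma>) * p (\<omega> - \<gamma>) * h + Q"
    using alg[OF main[unfolded k_def] kappa_pos] unfolding Q_def h_def .
  moreover have "B (- (1 / 3) *\<^sub>R (Hv \<omega> + Hv \<gamma>)) u = - (1 / 3) * h" by (simp add: h_def B_simps)
  ultimately show ?thesis unfolding Sg_def[symmetric] Q_def[unfolded p_def, symmetric] p_def[symmetric]
    by (simp add: p_def)
qed

end

section \<open>The decomposition near the identity\<close>

context lie_algebra
begin

lemma Exp_eig:
  assumes "br H v = c *\<^sub>R v"
  shows "Exp br H v = exp c *\<^sub>R v"
proof -
  have p: "(br H ^^ k) v = c ^ k *\<^sub>R v" for k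
    by (induction k) (simp_all add: assms mult.commute)
  have "(\<lambda>k. (c ^ k /\<^sub>R fact k) *\<^sub>R v) sums (exp c *\<^sub>R v)"
    by (rule bounded_linear.sums[OF bounded_linear_scaleR_left exp_converges])
  then show ?thesis unfolding op_exp_def p by (simp add: sums_iff)
qed

lemma Exp_fix: "br H v = 0 \<Longrightarrow> Exp br H v = v"
  using Exp_eig[of H v 0] by simp

end

context split_simple
begin

text \<open>\<open>D - ad Z\<close>, with \<open>Z\<close> representing \<open>x \<mapsto> tr (D \<circ> ad x)\<close>, is a derivation that is
  trace-orthogonal to all \<open>ad x\<close>, hence zero.\<close>

lemma derivation_inner:
  assumes D: "linear D" "\<And>x y. D (br x y) = br (D x) y + br x (D y)"
  shows "\<exists>Z. \<forall>x. D x = br Z x"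
proof -
  define l where "l = (\<lambda>v. lin_trace (D \<circ> br v))"
  have "linear l" unfolding l_def
    by (intro linearI)
       (simp_all add: o_def br_add_left linear_add[OF D(1)] linear_cmul[OF D(1)] lin_trace_add lin_trace_scale)
  then obtain Z where Z: "\<And>v. B Z v = l v" using B_represent by blast
  define E where "E = (\<lambda>x. D x - br Z x)"
  have E: "linear E" unfolding E_def by (intro linear_compose_sub D br_linear_right)
  have Eder: "E (br x y) = br (E x) y + br x (E y)" for x y
    by (simp add: E_def D(2) br_derivation[of Z] br_diff_left br_diff_right)
  have tr0: "lin_trace (E \<circ> br x) = 0" for x
    using Z[of x] by (simp add: E_def l_def killing_def o_def lin_trace_diff)
  have "E x = 0" for x
  proof (rule B_nondegenerate)
    fix y
    have lc: "linear (br x \<circ> (E \<circ> br y))" "linear (E \<circ> br y)"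
      by (intro linear_compose E br_linear_right)+
    \<comment> \<open>ad (E x) is the commutator of E with ad x, so cyclicity turns B (E x) y into
      the trace of E composed with ad [x, y], which is 0.\<close>
    have "B (E x) y = lin_trace (\<lambda>v. E (br x (br y v)) - br x (E (br y v)))"
      unfolding killing_def o_def by (rule arg_cong[of _ _ lin_trace]) (simp add: Eder fun_eq_iff)
    also have "\<dots> = lin_trace (\<lambda>v. E (br x (br y v))) - lin_trace (br x \<circ> (E \<circ> br y))"
      by (simp add: lin_trace_diff o_def)
    also have "lin_trace (br x \<circ> (E \<circ> br y)) = lin_trace ((E \<circ> br y) \<circ> br x)"
      by (rule lin_trace_commute[OF br_linear_right lc(2)])
    also have "lin_trace (\<lambda>v. E (br x (br y v))) - lin_trace ((E \<circ> br y) \<circ> br x)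
        = lin_trace (\<lambda>v. E (br x (br y v)) - E (br y (br x v)))"
      by (simp add: lin_trace_diff o_def)
    also have "\<dots> = lin_trace (E \<circ> br (br x y))"
    proof (rule arg_cong[of _ _ lin_trace], rule ext)
      fix v
      show "E (br x (br y v)) - E (br y (br x v)) = (E \<circ> br (br x y)) v"
        using br_derivation[of x y v] by (simp add: linear_diff[OF E, symmetric])
    qed
    finally show "B (E x) y = 0" by (simp add: tr0)
  qed
  then have "D x = br Z x" for x by (simp add: E_def)
  then show ?thesis by blast
qed

end

section \<open>N, its opposite and P in terms of weights\<close>

context positive_rooted
begin

text \<open>The second grading, by -\<xi>, provides all results on unipotent automorphisms for the
  opposite group; \<open>down_iff\<close> translates between the two.\<close>

sublocale up: graded_lie br \<xi> "weights \<xi>" "wproj \<xi>"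
  by (rule graded[OF xi(1)])

sublocale down: graded_lie br "- \<xi>" "weights (- \<xi>)" "wproj (- \<xi>)"
  by (rule graded[OF a_neg[OF xi(1)]])

lemma root_minus: "\<alpha> \<in> rts \<Longrightarrow> H \<in> \<aa> \<Longrightarrow> \<alpha> (- H) = - \<alpha> H"
  using dualD(2)[OF root_dual, of \<alpha> H "-1"] by simp

lemmas up_iff = W_iff[OF xi(1)]

lemma down_iff: "v \<in> down.W S \<longleftrightarrow> v \<in> up.W (uminus ` S)"
proof -
  have "- x \<in> S \<longleftrightarrow> x \<in> uminus ` S" for x :: real by force
  moreover have "(0::real) \<in> S \<longleftrightarrow> 0 \<in> uminus ` S" by force
  ultimately show ?thesis
    unfolding W_iff[OF a_neg[OF xi(1)]] up_iff by (simp add: root_minus[OF _ xi(1)])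
qed

lemma up_W0: "up.W {0} = \<aa>"
proof
  show "\<aa> \<subseteq> up.W {0}" using coord_a xi(2) by (auto simp: up_iff)
  show "up.W {0} \<subseteq> \<aa>"
  proof
    fix v assume v: "v \<in> up.W {0}"
    then have "coord \<alpha> v = 0" if "\<alpha> \<in> rts" for \<alpha> using that xi(2)[OF that] by (simp add: up_iff)
    then have "v = a_part v" by (subst decomposition[of v]) simp
    then show "v \<in> \<aa>" using a_part_in_a[of v] by (rule ssubst)
  qed
qed

lemma X_up: "\<alpha> \<in> rts \<Longrightarrow> X \<alpha> \<in> up.W {\<alpha> \<xi>}"
  by (simp add: up.W_eig X_eig xi(1))

lemma W_pos_nil:
  assumes x: "\<xi>' \<in> \<aa>" and \<Phi>: "\<Phi> = {\<alpha> \<in> rts. \<alpha> \<xi>' > 0}"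
  shows "graded_lie.W (wproj \<xi>') {0<..} = nil_algebra br \<aa> \<Phi>"
proof
  interpret g: graded_lie br \<xi>' "weights \<xi>'" "wproj \<xi>'" by (rule graded[OF x])
  show "nil_algebra br \<aa> \<Phi> \<subseteq> g.W {0<..}"
    unfolding nil_algebra_def
  proof (rule span_minimal[OF _ g.subspace_W], rule UN_least)
    fix \<alpha> assume a: "\<alpha> \<in> \<Phi>"
    show "root_space br \<aa> \<alpha> \<subseteq> g.W {0<..}"
    proof
      fix v assume "v \<in> root_space br \<aa> \<alpha>"
      then have "v \<in> g.W {\<alpha> \<xi>'}" using x by (simp add: g.W_eig root_space_def)
      then show "v \<in> g.W {0<..}" by (rule g.W_mono) (use a in \<open>auto simp: \<Phi>\<close>)
    qed
  qed
  show "g.W {0<..} \<subseteq> nil_algebra br \<aa> \<Phi>"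
  proof
    fix v assume v: "v \<in> g.W {0<..}"
    have "coord \<alpha> v *\<^sub>R X \<alpha> \<in> nil_algebra br \<aa> \<Phi>" if "\<alpha> \<in> rts" for \<alpha>
    proof (cases "\<alpha> \<in> \<Phi>")
      case True
      then show ?thesis unfolding nil_algebra_def using X_root[OF that]
        by (intro span_scale span_base) blast
    next
      case False
      then have "coord \<alpha> v = 0" using v that by (simp add: W_iff[OF x] \<Phi>)
      then show ?thesis by (simp add: nil_algebra_def span_zero)
    qed
    then have "(\<Sum>\<alpha>\<in>rts. coord \<alpha> v *\<^sub>R X \<alpha>) \<in> nil_algebra br \<aa> \<Phi>"
      unfolding nil_algebra_def by (rule span_sum)
    moreover have "a_part v = 0" using v by (simp add: W_iff[OF x])
    ultimately show "v \<in> nil_algebra br \<aa> \<Phi>" using decomposition[of v] by simp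
  qed
qed

lemma N_group_up: "N_group br \<aa> \<Sigma>p = up.unip"
  unfolding N_group_def up.unip_eq_Exp up.F_eps W_pos_nil[OF xi(1,3)] ..

lemma N_group_down: "N_group br \<aa> (uminus ` \<Sigma>p) = down.unip"
proof -
  have "uminus ` \<Sigma>p = {\<alpha> \<in> rts. \<alpha> (- \<xi>) > 0}"
  proof (intro equalityI subsetI)
    fix \<alpha> assume "\<alpha> \<in> uminus ` \<Sigma>p"
    then obtain \<beta> where b: "\<beta> \<in> \<Sigma>p" "\<alpha> = - \<beta>" by blast
    then have "\<alpha> \<in> rts" using root_neg pos_roots(1) by blast
    then show "\<alpha> \<in> {\<alpha> \<in> rts. \<alpha> (- \<xi>) > 0}"
      using pos_roots(2)[OF b(1)] root_minus[OF \<open>\<alpha> \<in> rts\<close> xi(1)] by (simp add: b(2))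
  next
    fix \<alpha> assume a: "\<alpha> \<in> {\<alpha> \<in> rts. \<alpha> (- \<xi>) > 0}"
    then have "- \<alpha> \<in> \<Sigma>p" using pos_or_neg[of \<alpha>] root_minus[OF _ xi(1), of \<alpha>] pos_roots(2)[of \<alpha>] by force
    then show "\<alpha> \<in> uminus ` \<Sigma>p" by (intro image_eqI[of _ _ "- \<alpha>"]) auto
  qed
  from W_pos_nil[OF a_neg[OF xi(1)] this]
  show ?thesis unfolding N_group_def down.unip_eq_Exp down.F_eps by simp
qed

lemma W_preserved:
  assumes A: "linear A" "\<And>h x. x \<in> up.W {h} \<Longrightarrow> A x \<in> up.W {h}" and v: "v \<in> up.W S"
  shows "A v \<in> up.W S"
proof -
  have "A (wproj \<xi> h v) \<in> up.W S" for h
  proof (cases "h \<in> S")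
    case True
    show ?thesis by (rule up.W_mono[OF A(2)[OF up.pi_in_W]]) (use True in simp)
  next
    case False
    then show ?thesis using v by (simp add: up.W_def linear_0[OF A(1)])
  qed
  then have "(\<Sum>h\<in>weights \<xi>. A (wproj \<xi> h v)) \<in> up.W S" by (rule up.W_sum)
  then show ?thesis by (simp only: linear_sum[OF A(1), symmetric] up.pi_sum)
qed

lemma fixing_preserves:
  assumes "g \<in> automorphisms" "g \<xi> = \<xi>" "v \<in> up.W S"
  shows "g v \<in> up.W S"
proof (rule W_preserved[OF automorphismsD(1)[OF assms(1)] _ assms(3)])
  fix h x assume "x \<in> up.W {h}"
  then show "g x \<in> up.W {h}"
    using automorphismsD(3)[OF assms(1), of \<xi> x] assms(2) linear_cmul[OF automorphismsD(1)[OF assms(1)]]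
    by (simp add: up.W_eig)
qed

lemma Exp_a_fix: "H \<in> \<aa> \<Longrightarrow> K \<in> \<aa> \<Longrightarrow> Exp br H K = K"
  by (rule Exp_fix) (rule a_abelian)

text \<open>Preserving the nonpositive weights is what separates P from N: M and exp \<aa> fix \<xi>
  and so preserve every weight space, and an opposite unipotent u has u - 1 lowering
  weights.\<close>

lemma P_group_automorphism: "p \<in> P_group br \<theta> \<aa> \<Sigma>p \<Longrightarrow> p \<in> automorphisms"
  and P_group_preserves: "p \<in> P_group br \<theta> \<aa> \<Sigma>p \<Longrightarrow> v \<in> up.W {..0} \<Longrightarrow> p v \<in> up.W {..0}"
proof -
  assume "p \<in> P_group br \<theta> \<aa> \<Sigma>p"
  then obtain m H u where p: "p = m \<circ> Exp br H \<circ> u" and m: "m \<in> M_group br \<theta> \<aa>"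
    and H: "H \<in> \<aa>" and u: "u \<in> down.unip"
    unfolding P_group_def N_group_down by blast
  have ma: "m \<in> automorphisms" "m \<xi> = \<xi>"
    using m int_group_automorphisms xi(1) unfolding M_group_def K_group_def by auto
  have ua: "u \<in> automorphisms" "down.raise down.\<epsilon> (\<lambda>v. u v - v)" using u by (auto simp: down.unip_def)
  show "p \<in> automorphisms" unfolding p by (intro automorphisms_comp ma Exp_automorphism ua)
  show "p v \<in> up.W {..0}" if v: "v \<in> up.W {..0}"
  proof -
    have im: "uminus ` {0..} = {..0::real}"
      by (auto intro!: image_eqI[of _ uminus "- _"])
    have "v \<in> down.F 0" using v by (simp add: down_iff im)
    moreover have "u v - v \<in> down.F 0"
      by (rule down.W_mono[OF down.raiseD[OF ua(2) \<open>v \<in> down.F 0\<close> refl]]) (use down.eps_pos in auto)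
    ultimately have "(u v - v) + v \<in> down.F 0" by (intro down.W_add)
    then have "u v \<in> up.W {..0}" by (simp add: down_iff im)
    then show ?thesis unfolding p o_def
      by (intro fixing_preserves[OF ma] fixing_preserves[OF Exp_automorphism Exp_a_fix[OF H xi(1)]])
  qed
qed

text \<open>For two factorisations, q = m'^-1 m coincides with p' p^-1. Hence q \<xi> - \<xi> has
  both positive and nonpositive weights, so it is 0, and \<open>unip_fix\<close> gives q =
  id.\<close>

lemma N_part_eq:
  assumes m: "m \<in> up.unip" and p: "p \<in> P_group br \<theta> \<aa> \<Sigma>p"
  shows "N_part br \<theta> \<aa> \<Sigma>p (m \<circ> p) = m"
  unfolding N_part_def N_group_up
proof (rule the_equality)
  show "m \<in> up.unip \<and> (\<exists>p'\<in>P_group br \<theta> \<aa> \<Sigma>p. m \<circ> p = m \<circ> p')" using m p by blast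
  fix m' assume "m' \<in> up.unip \<and> (\<exists>p'\<in>P_group br \<theta> \<aa> \<Sigma>p. m \<circ> p = m' \<circ> p')"
  then obtain p' where m': "m' \<in> up.unip" and p': "p' \<in> P_group br \<theta> \<aa> \<Sigma>p" and eq: "m \<circ> p = m' \<circ> p'"
    by blast
  obtain k where k: "k \<in> up.unip" "k \<circ> m' = id" "m' \<circ> k = id" using up.unip_inv[OF m'] by blast
  define q where "q = k \<circ> m"
  have qu: "q \<in> up.unip" unfolding q_def by (rule up.unip_comp[OF k(1) m])
  have qp: "q (p v) = p' v" for v
    using fun_cong[OF eq, of v] fun_cong[OF k(2), of "p' v"] by (simp add: q_def)
  note pa = automorphismsD[OF P_group_automorphism[OF p]]
  let ?b = "up.W {..0}"
  \<comment> \<open>An injective linear map of a finite-dimensional space into itself is onto; this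
    takes the place of closure of P under inverses.\<close>
  have "inj_on p (span ?b)" using pa(2) by (auto simp: bij_def inj_on_def)
  then have "dim (p ` ?b) = dim ?b" using dim_image_eq[OF pa(1)] by blast
  moreover have "p ` ?b \<subseteq> ?b" using P_group_preserves[OF p] by blast
  ultimately have "p ` ?b = ?b"
    using subspace_dim_equal[OF linear_subspace_image[OF pa(1) up.subspace_W] up.subspace_W] by simp
  moreover have "\<xi> \<in> ?b" using up.W_mono[OF up.xi_W0, of "{..0}"] by simp
  ultimately obtain w where w: "w \<in> ?b" "p w = \<xi>" by (metis imageE)
  have "q \<xi> \<in> ?b" using qp[of w] P_group_preserves[OF p' w(1)] w(2) by simp
  then have 1: "q \<xi> - \<xi> \<in> ?b" using \<open>\<xi> \<in> ?b\<close> by (rule up.W_diff)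
  have "up.raise up.\<epsilon> (\<lambda>v. q v - v)" using qu by (simp add: up.unip_def)
  from up.raiseD[OF this, of \<xi> 0 up.\<epsilon>] have 2: "q \<xi> - \<xi> \<in> up.F up.\<epsilon>"
    using up.W_mono[OF up.xi_W0, of "{0..}"] by simp
  have "q \<xi> - \<xi> = 0" by (rule up.W_Int[OF 1 2]) (use up.eps_pos in auto)
  then have "q = id" using up.unip_fix[OF qu] by simp
  then have "m' \<circ> (k \<circ> m) = m'" by (simp add: q_def)
  moreover have "m' \<circ> (k \<circ> m) = m" using k(3) by (simp add: comp_assoc[symmetric])
  ultimately show "m' = m" by simp
qed

lemma coord_br_a: "K \<in> \<aa> \<Longrightarrow> \<alpha> \<in> rts \<Longrightarrow> coord \<alpha> (br K v) = \<alpha> K * coord \<alpha> v"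
  unfolding coord_def
  by (subst br_antisym) (simp add: B_simps B_invariant X_eig[OF root_neg])

lemma span_a_X: "span (\<aa> \<union> X ` rts) = UNIV"
proof -
  have "a_part v + (\<Sum>\<alpha>\<in>rts. coord \<alpha> v *\<^sub>R X \<alpha>) \<in> span (\<aa> \<union> X ` rts)" for v
    by (intro span_add span_sum span_scale) (auto intro: span_base a_part_in_a)
  then show ?thesis unfolding decomposition[symmetric] by blast
qed

text \<open>A weight-preserving bracket homomorphism with positive diagonal is \<open>exp (ad H)\<close>: the logarithms
  of its eigenvalues define a derivation.\<close>

lemma diagonal_in_A:
  assumes Q: "linear Q" "\<And>x y. Q (br x y) = br (Q x) (Q y)" "\<And>H. H \<in> \<aa> \<Longrightarrow> Q H \<in> \<aa>"
    and pos: "\<And>\<alpha>. \<alpha> \<in> rts \<Longrightarrow> coord \<alpha> (Q (X \<alpha>)) > 0"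
  shows "\<exists>Z\<in>\<aa>. Q = Exp br Z"
proof -
  \<comment> \<open>Comparing \<alpha>-coordinates in the image of [H, X \<alpha>] shows that every
    root takes the same value at Q H and at H.\<close>
  have Qa: "Q H = H" if H: "H \<in> \<aa>" for H
  proof -
    have "Q H - H = 0"
    proof (rule br_a_nonzero[OF a_diff[OF Q(3)[OF H] H]])
      fix \<alpha> assume a: "\<alpha> \<in> rts"
      have "br (Q H) (Q (X \<alpha>)) = \<alpha> H *\<^sub>R Q (X \<alpha>)"
        using Q(2)[of H "X \<alpha>"] by (simp add: X_eig[OF a H] linear_cmul[OF Q(1)])
      from arg_cong[OF this, of "coord \<alpha>"] have "\<alpha> (Q H) * coord \<alpha> (Q (X \<alpha>)) = \<alpha> H * coord \<alpha> (Q (X \<alpha>))"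
        by (simp add: coord_br_a[OF Q(3)[OF H] a] coord_simps)
      then have "\<alpha> (Q H) = \<alpha> H" using pos[OF a] by simp
      moreover have "\<alpha> (Q H - H) = \<alpha> (Q H) + \<alpha> (- H)"
        using dualD(1)[OF root_dual[OF a] Q(3)[OF H] a_neg[OF H]] by simp
      ultimately show "\<alpha> (Q H - H) = 0" using root_minus[OF a H] by simp
    qed
    then show ?thesis by simp
  qed
  define \<mu> where "\<mu> = (\<lambda>\<alpha>. coord \<alpha> (Q (X \<alpha>)))"
  have QX: "Q (X \<alpha>) = \<mu> \<alpha> *\<^sub>R X \<alpha>" if a: "\<alpha> \<in> rts" for \<alpha>
  proof -
    have "br H (Q (X \<alpha>)) = \<alpha> H *\<^sub>R Q (X \<alpha>)" if "H \<in> \<aa>" for H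
      using Q(2)[of H "X \<alpha>"] by (simp add: X_eig[OF a that] linear_cmul[OF Q(1)] Qa[OF that])
    then have "Q (X \<alpha>) \<in> span {X \<alpha>}" by (simp add: root_space_span[OF a, symmetric] root_space_def)
    then obtain k where k: "Q (X \<alpha>) = k *\<^sub>R X \<alpha>" by (auto simp: span_singleton)
    then have "\<mu> \<alpha> = k" by (simp add: \<mu>_def coord_simps coord_X[OF a a])
    with k show ?thesis by simp
  qed
  have chi_pos: "\<mu> \<alpha> > 0" if "\<alpha> \<in> rts" for \<alpha> using pos[OF that] by (simp add: \<mu>_def)
  define D where "D = (\<lambda>v. \<Sum>\<alpha>\<in>rts. (ln (\<mu> \<alpha>) * coord \<alpha> v) *\<^sub>R X \<alpha>)"
  have linD: "linear D" unfolding D_def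
    by (intro linear_compose_sum ballI linearI) (simp_all add: coord_simps(1,2) algebra_simps)
  have Da: "D H = 0" if "H \<in> \<aa>" for H unfolding D_def using that by (simp add: coord_a)
  have DX: "D (X \<alpha>) = ln (\<mu> \<alpha>) *\<^sub>R X \<alpha>" if "\<alpha> \<in> rts" for \<alpha>
  proof -
    have "D (X \<alpha>) = (\<Sum>\<beta>\<in>rts. if \<beta> = \<alpha> then ln (\<mu> \<alpha>) *\<^sub>R X \<alpha> else 0)"
      unfolding D_def using that by (intro sum.cong) (auto simp: coord_X)
    then show ?thesis using finite_roots that by simp
  qed
  \<comment> \<open>Where the bracket is nonzero, \<mu> is multiplicative, so ln \<mu> is additive.
    For \<beta> = -\<alpha> the bracket lies in \<aa>, where Q is the identity, and the product of
    the two eigenvalues is 1.\<close>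
  have DXX: "D (br (X \<alpha>) (X \<beta>)) = (ln (\<mu> \<alpha>) + ln (\<mu> \<beta>)) *\<^sub>R br (X \<alpha>) (X \<beta>)"
    if a: "\<alpha> \<in> rts" and b: "\<beta> \<in> rts" for \<alpha> \<beta>
  proof -
    have rs: "br (X \<alpha>) (X \<beta>) \<in> root_space br \<aa> (\<alpha> + \<beta>)" by (rule root_space_br[OF X_root[OF a] X_root[OF b]])
    have Qb: "Q (br (X \<alpha>) (X \<beta>)) = (\<mu> \<alpha> * \<mu> \<beta>) *\<^sub>R br (X \<alpha>) (X \<beta>)"
      by (simp add: Q(2) QX[OF a] QX[OF b])
    consider "br (X \<alpha>) (X \<beta>) = 0" | "br (X \<alpha>) (X \<beta>) \<noteq> 0" "\<alpha> + \<beta> = 0" | "br (X \<alpha>) (X \<beta>) \<noteq> 0" "\<alpha> + \<beta> \<in> rts"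
      using root_space_cases[OF rs root_dual_ops(1)[OF a b]] by blast
    then show ?thesis
    proof cases
      case 1
      then show ?thesis by (simp add: linear_0[OF linD])
    next
      case 2
      then have "\<beta> = - \<alpha>" by (simp add: add_eq_0_iff)
      then have h: "br (X \<alpha>) (X \<beta>) \<in> \<aa>" using br_X_in_a[OF a] by simp
      have "(\<mu> \<alpha> * \<mu> \<beta>) *\<^sub>R br (X \<alpha>) (X \<beta>) = 1 *\<^sub>R br (X \<alpha>) (X \<beta>)" using Qb Qa[OF h] by simp
      then have "\<mu> \<alpha> * \<mu> \<beta> = 1" using 2(1) scaleR_cancel_right by blast
      then have "ln (\<mu> \<alpha>) + ln (\<mu> \<beta>) = 0"
        using ln_mult_pos[OF chi_pos[OF a] chi_pos[OF b]] by simp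
      then show ?thesis by (simp add: Da[OF h])
    next
      case 3
      then obtain k where k: "br (X \<alpha>) (X \<beta>) = k *\<^sub>R X (\<alpha> + \<beta>)" "k \<noteq> 0"
        using rs unfolding root_space_span[OF 3(2)] by (auto simp: span_singleton)
      have "(\<mu> (\<alpha> + \<beta>) * k) *\<^sub>R X (\<alpha> + \<beta>) = (\<mu> \<alpha> * \<mu> \<beta> * k) *\<^sub>R X (\<alpha> + \<beta>)"
        using Qb unfolding k(1) by (simp add: linear_cmul[OF Q(1)] QX[OF 3(2)] mult.commute)
      then have "\<mu> (\<alpha> + \<beta>) = \<mu> \<alpha> * \<mu> \<beta>" using X_nonzero[OF 3(2)] k(2) by simp
      then have "ln (\<mu> (\<alpha> + \<beta>)) = ln (\<mu> \<alpha>) + ln (\<mu> \<beta>)"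
        using ln_mult_pos[OF chi_pos[OF a] chi_pos[OF b]] by simp
      then show ?thesis unfolding k(1) by (simp add: linear_cmul[OF linD] DX[OF 3(2)] mult.commute)
    qed
  qed
  have der: "D (br x y) = br (D x) y + br x (D y)" for x y
  proof (rule bilinear_eq[of "\<lambda>x y. D (br x y)" "\<lambda>x y. br (D x) y + br x (D y)" UNIV "\<aa> \<union> X ` rts" UNIV "\<aa> \<union> X ` rts"])
    show "bilinear (\<lambda>x y. D (br x y))"
      unfolding bilinear_def
      by (auto intro!: linearI simp: br_add_left br_add_right linear_add[OF linD] linear_cmul[OF linD])
    show "bilinear (\<lambda>x y. br (D x) y + br x (D y))"
      unfolding bilinear_def
      by (auto intro!: linearI simp: br_add_left br_add_right linear_add[OF linD] linear_cmul[OF linD] algebra_simps)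
    fix x y assume "x \<in> \<aa> \<union> X ` rts" "y \<in> \<aa> \<union> X ` rts"
    then consider "x \<in> \<aa>" "y \<in> \<aa>" | \<beta> where "x \<in> \<aa>" "\<beta> \<in> rts" "y = X \<beta>"
      | \<alpha> where "\<alpha> \<in> rts" "x = X \<alpha>" "y \<in> \<aa>" | \<alpha> \<beta> where "\<alpha> \<in> rts" "x = X \<alpha>" "\<beta> \<in> rts" "y = X \<beta>"
      by blast
    then show "D (br x y) = br (D x) y + br x (D y)"
    proof cases
      case 1
      then show ?thesis by (simp add: a_abelian Da linear_0[OF linD])
    next
      case 2
      then show ?thesis by (simp add: X_eig Da DX linear_cmul[OF linD])
    next
      case 3
      have "br x y = - (\<alpha> y *\<^sub>R X \<alpha>)" using X_eig[OF 3(1,3)] by (subst br_antisym) (simp add: 3(2))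
      then show ?thesis using 3(1,3) X_eig[OF 3(1,3)] br_antisym[of "X \<alpha>" y]
        by (simp add: 3(2) Da DX linear_cmul[OF linD] linear_neg[OF linD])
    next
      case 4
      then show ?thesis using DXX[OF 4(1,3)] by (simp add: DX scaleR_left_distrib)
    qed
  qed (use span_a_X in auto)
  obtain Z where Z: "\<And>x. D x = br Z x" using derivation_inner[OF linD der] by blast
  have Za: "Z \<in> \<aa>"
  proof (rule a_centralizer)
    fix H assume "H \<in> \<aa>"
    then show "br H Z = 0" using Z[of H] Da[of H] by (subst br_antisym) simp
  qed
  have "Q v = Exp br Z v" for v
  proof (rule linear_eq_on_span[OF Q(1) Exp_linear, of "\<aa> \<union> X ` rts"])
    show "v \<in> span (\<aa> \<union> X ` rts)" by (simp add: span_a_X)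
    fix x assume "x \<in> \<aa> \<union> X ` rts"
    then show "Q x = Exp br Z x"
    proof
      assume "x \<in> X ` rts"
      then obtain \<alpha> where a: "\<alpha> \<in> rts" "x = X \<alpha>" by blast
      have "br Z (X \<alpha>) = ln (\<mu> \<alpha>) *\<^sub>R X \<alpha>" using Z[of "X \<alpha>"] DX[OF a(1)] by simp
      then show ?thesis using chi_pos[OF a(1)] by (simp add: a(2) QX[OF a(1)] Exp_eig[OF \<open>br Z (X \<alpha>) = _\<close>])
    qed (simp add: Qa Exp_a_fix[OF Za])
  qed
  then show ?thesis using Za by blast
qed

text \<open>The weight-preserving part of Q still preserves brackets, because the remaining terms
  have lower weight, and is exp (ad Z) by \<open>diagonal_in_A\<close>. Removing it leaves a lower
  unipotent automorphism. The inverse of Q is thus obtained directly as a product of the form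
  required in P, with \<open>id\<close> as component in M.\<close>

lemma lower_in_P:
  assumes Q: "Q \<in> automorphisms" "\<And>h x. x \<in> up.W {h} \<Longrightarrow> Q x \<in> up.W {..h}"
    and pos: "\<And>\<alpha>. \<alpha> \<in> rts \<Longrightarrow> coord \<alpha> (Q (X \<alpha>)) > 0"
  shows "\<exists>p\<in>P_group br \<theta> \<aa> \<Sigma>p. Q \<circ> p = id"
proof -
  note Qa = automorphismsD[OF Q(1)]
  define Q0 where "Q0 = (\<lambda>v. \<Sum>h\<in>weights \<xi>. wproj \<xi> h (Q (wproj \<xi> h v)))"
  have lin0: "linear Q0" unfolding Q0_def
    using linear_compose[OF linear_compose[OF up.pi_linear Qa(1)] up.pi_linear]
    by (intro linear_compose_sum ballI) (simp add: o_def)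
  have proj: "wproj \<xi> k x = (if k = h then x else 0)" if "x \<in> up.W {h}" for k h x
  proof (cases "k = h")
    case True
    have "wproj \<xi> h x = x" by (rule up.eq_by_pi) (use that in \<open>auto simp: up.W_def up.pi_pi\<close>)
    then show ?thesis using True by simp
  qed (use that in \<open>simp add: up.W_def\<close>)
  have Q0x: "Q0 x = wproj \<xi> h (Q x)" if x: "x \<in> up.W {h}" for h x
  proof (cases "h \<in> weights \<xi>")
    case True
    have "Q0 x = (\<Sum>k\<in>weights \<xi>. if k = h then wproj \<xi> h (Q x) else 0)"
      unfolding Q0_def by (intro sum.cong) (auto simp: proj[OF x] linear_0[OF Qa(1)])
    then show ?thesis using True up.fin by simp
  next
    case False
    then have "x = 0" using proj[OF x, of h] up.pi_out by simp
    then show ?thesis by (simp add: linear_0[OF lin0] linear_0[OF Qa(1)])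
  qed
  have Q0W: "Q0 x \<in> up.W {h}" if "x \<in> up.W {h}" for h x
    unfolding Q0x[OF that] by (rule up.pi_in_W)
  have low: "Q x - Q0 x \<in> up.W {..<h}" if x: "x \<in> up.W {h}" for h x
    using Q(2)[OF x] unfolding up.W_def Q0x[OF x] by (auto simp: up.pi_diff up.pi_pi)
  have br0: "Q0 (br x y) = br (Q0 x) (Q0 y)" for x y
  proof (rule up.bracket_hom_by_pi[OF lin0])
    fix a b x y assume x: "x \<in> up.W {a}" and y: "y \<in> up.W {b}"
    have xy: "br x y \<in> up.W {a + b}" by (rule up.W_br[OF x y]) auto
    have "Q (br x y) - br (Q0 x) (Q0 y) = br (Q x - Q0 x) (Q y) + br (Q0 x) (Q y - Q0 y)"
      by (simp add: Qa(3) br_diff_left br_diff_right)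
    moreover have "br (Q x - Q0 x) (Q y) \<in> up.W {..<a + b}"
      by (rule up.W_br[OF low[OF x] Q(2)[OF y]]) auto
    moreover have "br (Q0 x) (Q y - Q0 y) \<in> up.W {..<a + b}"
      by (rule up.W_br[OF Q0W[OF x] low[OF y]]) auto
    ultimately have "Q (br x y) - br (Q0 x) (Q0 y) \<in> up.W {..<a + b}" by (simp add: up.W_add)
    then have "wproj \<xi> (a + b) (Q (br x y) - br (Q0 x) (Q0 y)) = 0" by (simp add: up.W_def)
    moreover have "br (Q0 x) (Q0 y) \<in> up.W {a + b}" by (rule up.W_br[OF Q0W[OF x] Q0W[OF y]]) auto
    ultimately show "Q0 (br x y) = br (Q0 x) (Q0 y)"
      using proj[of "br (Q0 x) (Q0 y)" "a + b" "a + b"] by (simp add: Q0x[OF xy] up.pi_diff)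
  qed
  have "\<exists>Z\<in>\<aa>. Q0 = Exp br Z"
  proof (rule diagonal_in_A[OF lin0 br0])
    show "Q0 H \<in> \<aa>" if "H \<in> \<aa>" for H using Q0W[of H 0] that by (simp add: up_W0)
    show "coord \<alpha> (Q0 (X \<alpha>)) > 0" if "\<alpha> \<in> rts" for \<alpha>
      using pos[OF that] by (simp add: Q0x[OF X_up[OF that]] coord_wproj[OF that])
  qed
  then obtain Z where Z: "Z \<in> \<aa>" "Q0 = Exp br Z" by blast
  define U where "U = Q \<circ> Exp br (- Z)"
  have Ua: "U \<in> automorphisms" unfolding U_def by (intro automorphisms_comp Q Exp_automorphism)
  have Ux: "U x - x \<in> up.W {..<h}" if x: "x \<in> up.W {h}" for h x
  proof -
    define x' where "x' = Exp br (- Z) x"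
    have x': "x' \<in> up.W {h}" unfolding x'_def
      by (rule fixing_preserves[OF Exp_automorphism Exp_a_fix[OF a_neg[OF Z(1)] xi(1)] x])
    have "Q0 x' = x" unfolding x'_def Z(2) by (rule Exp_minus_cancel)
    then show ?thesis using low[OF x'] by (simp add: U_def x'_def)
  qed
  have "down.raise down.\<epsilon> (\<lambda>v. U v - v)"
  proof (rule down.raise_by_pi)
    show "linear (\<lambda>v. U v - v)"
      by (intro linear_compose_sub automorphismsD(1)[OF Ua] linear_id[unfolded id_def])
    fix h v assume "v \<in> down.W {h}"
    then have "U v - v \<in> up.W {..< - h}" by (intro Ux) (simp add: down_iff)
    moreover have "uminus ` {h<..} = {..< - h}"
      by (auto intro!: image_eqI[of _ uminus "- _"])
    ultimately show "U v - v \<in> down.W {h<..}" by (simp add: down_iff)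
  qed
  then have "U \<in> down.unip" using Ua by (simp add: down.unip_def)
  then obtain u where u: "u \<in> down.unip" "U \<circ> u = id" using down.unip_inv by blast
  have "id \<in> M_group br \<theta> \<aa>" by (simp add: M_group_def K_group_def int_group.one)
  then have "id \<circ> Exp br (- Z) \<circ> u \<in> P_group br \<theta> \<aa> \<Sigma>p"
    unfolding P_group_def N_group_down using u(1) a_neg[OF Z(1)] by blast
  moreover have "Q \<circ> (id \<circ> Exp br (- Z) \<circ> u) = id"
    using u(2) by (simp add: U_def comp_assoc)
  ultimately show ?thesis by blast
qed

end

section \<open>Derivatives along curves in N\<close>

lemma has_vector_derivative_at_0_iff:
  fixes f :: "real \<Rightarrow> 'a::euclidean_space"
  shows "(f has_vector_derivative d) (at 0) \<longleftrightarrow> ((\<lambda>t. (1 / t) *\<^sub>R (f t - f 0)) \<longlongrightarrow> d) (at 0)"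
proof -
  have "((\<lambda>t. f t \<bullet> b) has_real_derivative d \<bullet> b) (at 0)
      \<longleftrightarrow> ((\<lambda>t. ((1 / t) *\<^sub>R (f t - f 0)) \<bullet> b) \<longlongrightarrow> d \<bullet> b) (at 0)" for b
    by (simp add: DERIV_def inner_diff_left)
  moreover have "(f has_vector_derivative d) (at 0)
      \<longleftrightarrow> (\<forall>b\<in>Basis. ((\<lambda>t. f t \<bullet> b) has_real_derivative d \<bullet> b) (at 0))"
    using has_vector_derivative_inner_Basis[of f d 0 UNIV]
      bounded_linear.has_vector_derivative[OF bounded_linear_inner_left, of f d "at 0"]
    by (auto simp: has_real_derivative_iff_has_vector_derivative)
  ultimately show ?thesis by (subst tendsto_componentwise_iff) simp
qed

lemma real_polynomial_function_derivative:
  assumes "real_polynomial_function p"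
  shows "\<exists>p'. (\<forall>x. (p has_derivative p' x) (at x)) \<and> (\<forall>v. real_polynomial_function (\<lambda>x. p' x v))"
  using assms
proof (induction rule: real_polynomial_function.induct)
  case (linear f)
  then show ?case
    by (intro exI[of _ "\<lambda>x. f"]) (auto intro: bounded_linear_imp_has_derivative real_polynomial_function.intros)
next
  case (const c)
  show ?case
    by (intro exI[of _ "\<lambda>x v. 0"]) (auto intro: real_polynomial_function.intros)
next
  case (add f g)
  then obtain f' g' where "\<forall>x. (f has_derivative f' x) (at x)" "\<forall>v. real_polynomial_function (\<lambda>x. f' x v)"
    "\<forall>x. (g has_derivative g' x) (at x)" "\<forall>v. real_polynomial_function (\<lambda>x. g' x v)" by blast
  then show ?case
    by (intro exI[of _ "\<lambda>x v. f' x v + g' x v"])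
       (auto intro: has_derivative_add real_polynomial_function.intros)
next
  case (mult f g)
  then obtain f' g' where "\<forall>x. (f has_derivative f' x) (at x)" "\<forall>v. real_polynomial_function (\<lambda>x. f' x v)"
    "\<forall>x. (g has_derivative g' x) (at x)" "\<forall>v. real_polynomial_function (\<lambda>x. g' x v)" by blast
  with mult.hyps show ?case
    by (intro exI[of _ "\<lambda>x v. f x * g' x v + f' x v * g x"] conjI allI has_derivative_mult
          real_polynomial_function.intros(3,4)) auto
qed

lemma real_polynomial_function_Ck_on: "real_polynomial_function p \<Longrightarrow> Ck_on k S p"
proof (induction k arbitrary: p)
  case 0
  then show ?case
    by (simp add: continuous_on_polymonial_function real_polynomial_function_eq)
next
  case (Suc k)
  obtain p' where p': "\<And>x. (p has_derivative p' x) (at x)" "\<And>v. real_polynomial_function (\<lambda>x. p' x v)"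
    using real_polynomial_function_derivative[OF Suc.prems] by blast
  then show ?case using Suc.IH
    by (auto intro!: exI[of _ p'] intro: has_derivative_at_withinI)
qed

lemma Ck_on_cong:
  assumes "Ck_on k S f" "\<And>x. x \<in> S \<Longrightarrow> g x = f x"
  shows "Ck_on k S g"
proof (cases k)
  case 0
  then have "continuous_on S f" using assms(1) by simp
  then have "continuous_on S g" by (rule continuous_on_eq) (rule assms(2)[symmetric])
  then show ?thesis using 0 by simp
next
  case (Suc j)
  then obtain f' where f': "\<And>x. x \<in> S \<Longrightarrow> (f has_derivative f' x) (at x within S)"
      "\<forall>v\<in>S. Ck_on j S (\<lambda>x. f' x v)"
    using assms(1) by auto
  have "(g has_derivative f' x) (at x within S)" if "x \<in> S" for x
    by (rule has_derivative_transform[OF that assms(2) f'(1)[OF that]])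
  then show ?thesis unfolding Suc Ck_on.simps using f'(2) by blast
qed

section \<open>Exponentials for small times\<close>

context lie_algebra
begin

lemma Exp_near_identity:
  assumes "\<delta> > 0"
  shows "\<forall>\<^sub>F t in at 0. \<forall>v. norm (Exp br (t *\<^sub>R x) v - v) \<le> \<delta> * norm v"
proof -
  define s where "s = (\<lambda>t. \<Sum>b\<in>Basis. norm (Exp br (t *\<^sub>R x) b - b))"
  have "((\<lambda>t. Exp br (t *\<^sub>R x) b) \<longlongrightarrow> Exp br (0 *\<^sub>R x) b) (at 0)" for b
    using has_vector_derivative_continuous[OF Exp_has_vector_derivative[of x b 0]]
    by (simp add: continuous_within)
  then have "((\<lambda>t. norm (Exp br (t *\<^sub>R x) b - b)) \<longlongrightarrow> 0) (at 0)" for b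
    using tendsto_norm_zero[OF LIM_zero] by fastforce
  then have "(s \<longlongrightarrow> 0) (at 0)" unfolding s_def
    using tendsto_sum[of Basis "\<lambda>b t. norm (Exp br (t *\<^sub>R x) b - b)" "\<lambda>b. 0"] by simp
  then have "\<forall>\<^sub>F t in at 0. s t < \<delta>" using assms by (rule order_tendstoD)
  then show ?thesis
  proof (rule eventually_mono, intro allI)
    fix t v assume t: "s t < \<delta>"
    let ?g = "Exp br (t *\<^sub>R x)"
    have "?g v - v = (\<Sum>b\<in>Basis. (v \<bullet> b) *\<^sub>R (?g b - b))"
    proof -
      have "?g v = ?g (\<Sum>b\<in>Basis. (v \<bullet> b) *\<^sub>R b)" by (simp add: euclidean_representation)
      also have "\<dots> = (\<Sum>b\<in>Basis. (v \<bullet> b) *\<^sub>R ?g b)"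
        by (simp add: linear_sum[OF Exp_linear] linear_cmul[OF Exp_linear])
      finally show ?thesis by (simp add: scaleR_diff_right sum_subtractf euclidean_representation)
    qed
    then have "norm (?g v - v) \<le> (\<Sum>b\<in>Basis. norm ((v \<bullet> b) *\<^sub>R (?g b - b)))"
      using norm_sum by metis
    also have "\<dots> \<le> (\<Sum>b\<in>Basis. norm v * norm (?g b - b))"
      by (intro sum_mono) (auto intro!: mult_right_mono Basis_le_norm)
    also have "\<dots> = norm v * s t" by (simp add: s_def sum_distrib_left)
    also have "\<dots> \<le> \<delta> * norm v" using mult_right_mono[OF less_imp_le[OF t] norm_ge_zero[of v]] by (simp add: mult.commute)
    finally show "norm (?g v - v) \<le> \<delta> * norm v" .
  qed
qed

text \<open>The base point w t moves with t and is only known to converge; expanding it in the basis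
  separates its limit from the difference quotients at fixed vectors.\<close>

lemma Exp_difference_quotient:
  assumes w: "(w \<longlongrightarrow> v) (at 0)"
  shows "((\<lambda>t. (1 / t) *\<^sub>R (Exp br (t *\<^sub>R x) (w t) - w t)) \<longlongrightarrow> br x v) (at 0)"
proof -
  have q: "((\<lambda>t. (1 / t) *\<^sub>R (Exp br (t *\<^sub>R x) b - b)) \<longlongrightarrow> br x b) (at 0)" for b
    using Exp_has_vector_derivative[of x b 0] unfolding has_vector_derivative_at_0_iff by simp
  have e: "(1 / t) *\<^sub>R (Exp br (t *\<^sub>R x) (w t) - w t)
      = (\<Sum>b\<in>Basis. (w t \<bullet> b) *\<^sub>R ((1 / t) *\<^sub>R (Exp br (t *\<^sub>R x) b - b)))" for t
  proof -
    have "Exp br (t *\<^sub>R x) (w t) = Exp br (t *\<^sub>R x) (\<Sum>b\<in>Basis. (w t \<bullet> b) *\<^sub>R b)"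
      by (simp add: euclidean_representation)
    also have "\<dots> = (\<Sum>b\<in>Basis. (w t \<bullet> b) *\<^sub>R Exp br (t *\<^sub>R x) b)"
      by (simp add: linear_sum[OF Exp_linear] linear_cmul[OF Exp_linear])
    moreover have "w t = (\<Sum>b\<in>Basis. (w t \<bullet> b) *\<^sub>R b)" by (simp add: euclidean_representation)
    ultimately have "Exp br (t *\<^sub>R x) (w t) - w t = (\<Sum>b\<in>Basis. (w t \<bullet> b) *\<^sub>R (Exp br (t *\<^sub>R x) b - b))"
      by (simp add: scaleR_diff_right sum_subtractf euclidean_representation)
    then show ?thesis by (simp add: scaleR_sum_right mult.commute)
  qed
  have "((\<lambda>t. \<Sum>b\<in>Basis. (w t \<bullet> b) *\<^sub>R ((1 / t) *\<^sub>R (Exp br (t *\<^sub>R x) b - b)))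
      \<longlongrightarrow> (\<Sum>b\<in>Basis. (v \<bullet> b) *\<^sub>R br x b)) (at 0)"
    by (intro tendsto_sum tendsto_scaleR tendsto_inner tendsto_const w q)
  moreover have "(\<Sum>b\<in>Basis. (v \<bullet> b) *\<^sub>R br x b) = br x v"
    by (simp only: br_scale_right[symmetric] br_sum_right[symmetric] euclidean_representation)
  ultimately show ?thesis by (simp only: e)
qed

end

section \<open>The N-component of a small exponential\<close>

context positive_rooted
begin

lemma local_decomposition:
  assumes "\<eta> > 0"
  shows "\<forall>\<^sub>F t in at 0. \<exists>Q p. Exp br (t *\<^sub>R W) \<circ> Q \<in> up.unip \<and> p \<in> P_group br \<theta> \<aa> \<Sigma>p \<and> Q \<circ> p = id \<and>
    Q \<xi> \<in> up.W {..0} \<and> up.pr {..0} (Exp br (t *\<^sub>R W) (Q \<xi>)) = \<xi> \<and> norm (Q \<xi> - \<xi>) \<le> \<eta> * norm \<xi>"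
proof -
  have "\<exists>c>0. \<forall>v. \<bar>coord \<alpha> v\<bar> \<le> c * norm v" for \<alpha>
    using linear_bounded_pos[OF coord_linear[of \<alpha>]] unfolding real_norm_def by blast
  then obtain c where c: "\<And>\<alpha>. c \<alpha> > 0" "\<And>\<alpha> v. \<bar>coord \<alpha> v\<bar> \<le> c \<alpha> * norm v" by metis
  \<comment> \<open>K exceeds each product of a coordinate's norm bound with the norm of its root
    vector. With \<eta>' K \<le> 1 the diagonal entries of Q differ from 1 by less than 1 and stay
    positive.\<close>
  define K where "K = 1 + (\<Sum>\<alpha>\<in>rts. c \<alpha> * norm (X \<alpha>))"
  have Kb: "c \<alpha> * norm (X \<alpha>) < K" if "\<alpha> \<in> rts" for \<alpha>
    using member_le_sum[OF that _ finite_roots, of "\<lambda>\<alpha>. c \<alpha> * norm (X \<alpha>)"] c(1)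
    by (simp add: K_def less_imp_le)
  have K: "K > 0"
    using sum_nonneg[of rts "\<lambda>\<alpha>. c \<alpha> * norm (X \<alpha>)"] c(1) by (simp add: K_def less_imp_le add_pos_nonneg)
  define \<eta>' where "\<eta>' = min \<eta> (1 / K)"
  have e: "\<eta>' > 0" "\<eta>' \<le> \<eta>" "\<eta>' * K \<le> 1"
    using assms K by (auto simp: \<eta>'_def min_def field_simps)
  obtain \<delta> where d: "\<delta> > 0" and fac: "\<And>g. g \<in> automorphisms \<Longrightarrow> (\<And>v. norm (g v - v) \<le> \<delta> * norm v) \<Longrightarrow>
      \<exists>Q\<in>automorphisms. g \<circ> Q \<in> up.unip \<and>
        (\<forall>h. \<forall>x\<in>up.W {h}. Q x \<in> up.W {..h} \<and> up.pr {..h} (g (Q x)) = x) \<and>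
        (\<forall>h. \<forall>x\<in>up.W {h}. norm (Q x - x) \<le> \<eta>' * norm x)"
    using up.triangular_factor[OF e(1)] by metis
  show ?thesis
    using Exp_near_identity[OF d, of W]
  proof (rule eventually_mono)
    fix t assume t: "\<forall>v. norm (Exp br (t *\<^sub>R W) v - v) \<le> \<delta> * norm v"
    obtain Q where Q: "Q \<in> automorphisms" "Exp br (t *\<^sub>R W) \<circ> Q \<in> up.unip"
      "\<And>h x. x \<in> up.W {h} \<Longrightarrow> Q x \<in> up.W {..h} \<and> up.pr {..h} (Exp br (t *\<^sub>R W) (Q x)) = x"
      "\<And>h x. x \<in> up.W {h} \<Longrightarrow> norm (Q x - x) \<le> \<eta>' * norm x"
      using fac[OF Exp_automorphism, of "t *\<^sub>R W"] t by blast
    have "\<exists>p\<in>P_group br \<theta> \<aa> \<Sigma>p. Q \<circ> p = id"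
    proof (rule lower_in_P[OF Q(1)])
      show "Q x \<in> up.W {..h}" if "x \<in> up.W {h}" for h x using Q(3)[OF that] by blast
      fix \<alpha> assume a: "\<alpha> \<in> rts"
      have "\<bar>coord \<alpha> (Q (X \<alpha>) - X \<alpha>)\<bar> \<le> c \<alpha> * (\<eta>' * norm (X \<alpha>))"
        using c(2)[of \<alpha> "Q (X \<alpha>) - X \<alpha>"] mult_left_mono[OF Q(4)[OF X_up[OF a]], of "c \<alpha>"] c(1)[of \<alpha>] by linarith
      also have "\<dots> = \<eta>' * (c \<alpha> * norm (X \<alpha>))" by simp
      also have "\<dots> < \<eta>' * K" using Kb[OF a] e(1) by simp
      finally have "\<bar>coord \<alpha> (Q (X \<alpha>)) - 1\<bar> < 1" using e(3) by (simp add: coord_simps coord_X[OF a a])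
      then show "coord \<alpha> (Q (X \<alpha>)) > 0" by linarith
    qed
    then obtain p where p: "p \<in> P_group br \<theta> \<aa> \<Sigma>p" "Q \<circ> p = id" by blast
    have "norm (Q \<xi> - \<xi>) \<le> \<eta> * norm \<xi>"
      using Q(4)[OF up.xi_W0] mult_right_mono[OF e(2) norm_ge_zero[of \<xi>]] by linarith
    then show "\<exists>Q p. Exp br (t *\<^sub>R W) \<circ> Q \<in> up.unip \<and> p \<in> P_group br \<theta> \<aa> \<Sigma>p \<and> Q \<circ> p = id \<and>
        Q \<xi> \<in> up.W {..0} \<and> up.pr {..0} (Exp br (t *\<^sub>R W) (Q \<xi>)) = \<xi> \<and> norm (Q \<xi> - \<xi>) \<le> \<eta> * norm \<xi>"
      using Q(2) Q(3)[OF up.xi_W0] p by blast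
  qed
qed

definition N_curve :: "'g \<Rightarrow> real \<Rightarrow> 'g \<Rightarrow> 'g" where
  "N_curve W t = N_part br \<theta> \<aa> \<Sigma>p (Exp br (t *\<^sub>R W))"

lemma id_unip: "id \<in> up.unip"
  unfolding up.unip_def using automorphisms_id by (simp add: up.raise_def)

lemma id_P: "id \<in> P_group br \<theta> \<aa> \<Sigma>p"
proof -
  have "id \<in> M_group br \<theta> \<aa>" by (simp add: M_group_def K_group_def int_group.one)
  moreover have "id \<in> N_group br \<aa> (uminus ` \<Sigma>p)"
    unfolding N_group_down down.unip_def using automorphisms_id by (simp add: down.raise_def)
  moreover have "id = id \<circ> Exp br 0 \<circ> id" by simp
  ultimately show ?thesis unfolding P_group_def using a_0 by blast
qed

lemma N_curve_0: "N_curve W 0 = id"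
  unfolding N_curve_def using N_part_eq[OF id_unip id_P] by simp

lemma N_curve_eventually:
  assumes "\<eta> > 0"
  shows "\<forall>\<^sub>F t in at 0. N_curve W t \<in> up.unip \<and> (\<exists>p\<in>P_group br \<theta> \<aa> \<Sigma>p. Exp br (t *\<^sub>R W) = N_curve W t \<circ> p) \<and>
    (\<exists>w\<in>up.W {..0}. N_curve W t \<xi> = Exp br (t *\<^sub>R W) w \<and> up.pr {..0} (N_curve W t \<xi>) = \<xi> \<and> norm (w - \<xi>) \<le> \<eta> * norm \<xi>)"
  using local_decomposition[OF assms, of W]
proof (rule eventually_mono)
  fix t assume "\<exists>Q p. Exp br (t *\<^sub>R W) \<circ> Q \<in> up.unip \<and> p \<in> P_group br \<theta> \<aa> \<Sigma>p \<and> Q \<circ> p = id \<and>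
    Q \<xi> \<in> up.W {..0} \<and> up.pr {..0} (Exp br (t *\<^sub>R W) (Q \<xi>)) = \<xi> \<and> norm (Q \<xi> - \<xi>) \<le> \<eta> * norm \<xi>"
  then obtain Q p where Q: "Exp br (t *\<^sub>R W) \<circ> Q \<in> up.unip" "p \<in> P_group br \<theta> \<aa> \<Sigma>p" "Q \<circ> p = id"
    "Q \<xi> \<in> up.W {..0}" "up.pr {..0} (Exp br (t *\<^sub>R W) (Q \<xi>)) = \<xi>" "norm (Q \<xi> - \<xi>) \<le> \<eta> * norm \<xi>" by blast
  have e: "Exp br (t *\<^sub>R W) = (Exp br (t *\<^sub>R W) \<circ> Q) \<circ> p" using Q(3) by (simp add: comp_assoc)
  then have "N_curve W t = Exp br (t *\<^sub>R W) \<circ> Q" unfolding N_curve_def using N_part_eq[OF Q(1,2)] by metis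
  then show "N_curve W t \<in> up.unip \<and> (\<exists>p\<in>P_group br \<theta> \<aa> \<Sigma>p. Exp br (t *\<^sub>R W) = N_curve W t \<circ> p) \<and>
    (\<exists>w\<in>up.W {..0}. N_curve W t \<xi> = Exp br (t *\<^sub>R W) w \<and> up.pr {..0} (N_curve W t \<xi>) = \<xi> \<and> norm (w - \<xi>) \<le> \<eta> * norm \<xi>)"
    using Q e by auto
qed

text \<open>The orbit point is exp(tW) w(t) with w(t) of nonpositive weights and tending to \<xi>.
  Projection to positive weights annihilates w(t), which turns the difference quotient of the orbit
  into that of exp(tW) at w(t); convergence of w suffices.\<close>

lemma N_curve_derivative: "((\<lambda>t. N_curve W t \<xi>) has_vector_derivative up.pr {0<..} (br W \<xi>)) (at 0)"
proof -
  define w where "w = (\<lambda>t. Exp br (- (t *\<^sub>R W)) (N_curve W t \<xi>))"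
  have w: "\<forall>\<^sub>F t in at 0. w t \<in> up.W {..0} \<and> N_curve W t \<xi> = Exp br (t *\<^sub>R W) (w t) \<and>
      up.pr {..0} (N_curve W t \<xi>) = \<xi> \<and> norm (w t - \<xi>) \<le> \<eta> * norm \<xi>" if "\<eta> > 0" for \<eta>
    using N_curve_eventually[OF that, of W]
  proof (rule eventually_mono, elim conjE bexE)
    fix t v assume v: "v \<in> up.W {..0}" "N_curve W t \<xi> = Exp br (t *\<^sub>R W) v" "up.pr {..0} (N_curve W t \<xi>) = \<xi>"
      "norm (v - \<xi>) \<le> \<eta> * norm \<xi>"
    have "w t = v" unfolding w_def v(2) by (rule Exp_minus_cancel)
    then show "w t \<in> up.W {..0} \<and> N_curve W t \<xi> = Exp br (t *\<^sub>R W) (w t) \<and>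
      up.pr {..0} (N_curve W t \<xi>) = \<xi> \<and> norm (w t - \<xi>) \<le> \<eta> * norm \<xi>" using v by simp
  qed
  have "(w \<longlongrightarrow> \<xi>) (at 0)"
  proof (rule tendstoI)
    fix e :: real assume e: "e > 0"
    define \<eta> where "\<eta> = e / (norm \<xi> + 1)"
    have n: "norm \<xi> + 1 > 0" by (simp add: add_nonneg_pos)
    have \<eta>: "\<eta> > 0" "\<eta> * norm \<xi> < e" using e n by (auto simp: \<eta>_def field_simps)
    show "\<forall>\<^sub>F t in at 0. dist (w t) \<xi> < e"
      using w[OF \<eta>(1)] by (rule eventually_mono) (use \<eta>(2) in \<open>auto simp: dist_norm\<close>)
  qed
  then have "((\<lambda>t. (1 / t) *\<^sub>R (Exp br (t *\<^sub>R W) (w t) - w t)) \<longlongrightarrow> br W \<xi>) (at 0)"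
    by (rule Exp_difference_quotient)
  then have lim: "((\<lambda>t. up.pr {0<..} ((1 / t) *\<^sub>R (Exp br (t *\<^sub>R W) (w t) - w t))) \<longlongrightarrow> up.pr {0<..} (br W \<xi>)) (at 0)"
    using bounded_linear.tendsto up.pr_linear linear_conv_bounded_linear by blast
  have eq: "\<forall>\<^sub>F t in at 0. up.pr {0<..} ((1 / t) *\<^sub>R (Exp br (t *\<^sub>R W) (w t) - w t)) = (1 / t) *\<^sub>R (N_curve W t \<xi> - N_curve W 0 \<xi>)"
    using w[OF zero_less_one]
  proof (rule eventually_mono, elim conjE)
    fix t assume t: "w t \<in> up.W {..0}" "N_curve W t \<xi> = Exp br (t *\<^sub>R W) (w t)" "up.pr {..0} (N_curve W t \<xi>) = \<xi>"
    have c: "{0<..} \<inter> {..0} = ({} :: real set)" "{..0} \<inter> {0<..} = ({} :: real set)" "{..0} \<union> {0<..} = (UNIV :: real set)" by auto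
    have "N_curve W t \<xi> - \<xi> = up.pr {0<..} (N_curve W t \<xi>)"
      using up.pr_compl[OF c(2,3), of "N_curve W t \<xi>"] unfolding t(3) by (metis add_diff_cancel_left')
    also have "\<dots> = up.pr {0<..} (Exp br (t *\<^sub>R W) (w t) - w t)"
      using up.pr_0[OF t(1) c(1)] by (simp add: t(2) linear_diff[OF up.pr_linear])
    finally show "up.pr {0<..} ((1 / t) *\<^sub>R (Exp br (t *\<^sub>R W) (w t) - w t)) = (1 / t) *\<^sub>R (N_curve W t \<xi> - N_curve W 0 \<xi>)"
      by (simp add: N_curve_0 linear_cmul[OF up.pr_linear])
  qed
  show ?thesis unfolding has_vector_derivative_at_0_iff
    by (rule Lim_transform_eventually[OF lim eq])
qed

section \<open>Derivatives of smooth functions through the chart\<close>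

definition comp_on :: "('g \<Rightarrow> real) set \<Rightarrow> 'g \<Rightarrow> 'g" where
  "comp_on \<Phi> v = (\<Sum>\<alpha>\<in>\<Phi>. coord \<alpha> v *\<^sub>R X \<alpha>)"

lemma comp_on_linear: "linear (comp_on \<Phi>)"
  unfolding comp_on_def by (intro linear_compose_sum ballI linearI) (simp_all add: coord_simps(1,2) algebra_simps)

lemma comp_on_span: "comp_on \<Phi> v \<in> span (X ` \<Phi>)"
  unfolding comp_on_def by (intro span_sum span_scale span_base) auto

lemma comp_on_F:
  assumes "\<Phi> \<subseteq> \<Sigma>p" "v \<in> up.F r"
  shows "comp_on \<Phi> v \<in> up.F r"
  unfolding comp_on_def
proof (intro up.W_sum)
  fix \<alpha> assume "\<alpha> \<in> \<Phi>"
  then have a: "\<alpha> \<in> rts" using assms(1) pos_roots(1) by blast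
  show "coord \<alpha> v *\<^sub>R X \<alpha> \<in> up.F r"
  proof (cases "\<alpha> \<xi> \<ge> r")
    case True
    then show ?thesis using up.W_mono[OF X_up[OF a], of "{r..}"] by (simp add: up.W_scale)
  next
    case False
    then have "coord \<alpha> v = 0" using assms(2) a by (simp add: up_iff)
    then show ?thesis by simp
  qed
qed

lemma finite_Sigma: "finite \<Sigma>p" "finite \<Sigma>0" "finite \<Sigma>h"
proof -
  show "finite \<Sigma>p" using finite_roots pos_roots(1) by (meson finite_subset subsetI)
  then show "finite \<Sigma>0" "finite \<Sigma>h" using Sigma_partition(1) by (auto intro: finite_subset)
qed

lemma sum_Sigma: "(\<Sum>\<alpha>\<in>\<Sigma>p. f \<alpha>) = f \<omega> + (\<Sum>\<alpha>\<in>\<Sigma>h. f \<alpha>) + (\<Sum>\<alpha>\<in>\<Sigma>0. f \<alpha>)"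
  for f :: "('g \<Rightarrow> real) \<Rightarrow> 'b::comm_monoid_add"
proof -
  have "\<Sigma>p = insert \<omega> (\<Sigma>h \<union> \<Sigma>0)" using Sigma_partition(1) by auto
  then have "(\<Sum>\<alpha>\<in>\<Sigma>p. f \<alpha>) = (\<Sum>\<alpha>\<in>insert \<omega> (\<Sigma>h \<union> \<Sigma>0). f \<alpha>)" by (rule sum.cong) simp
  then show ?thesis using Sigma_partition(2-4) finite_Sigma(2,3)
    by (simp add: sum.union_disjoint Int_commute add.assoc)
qed

lemma comp_on_pos: "v \<in> up.F up.\<epsilon> \<Longrightarrow> comp_on \<Sigma>p v = v"
proof -
  assume v: "v \<in> up.F up.\<epsilon>"
  have z: "\<And>\<alpha>. \<alpha> \<in> rts \<Longrightarrow> \<not> \<alpha> \<xi> > 0 \<Longrightarrow> coord \<alpha> v = 0" and p: "a_part v = 0"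
    using v unfolding up.F_eps up_iff by auto
  have "\<not> \<alpha> \<xi> > 0" if "\<alpha> \<in> rts - \<Sigma>p" for \<alpha>
    using that xi(3) by blast
  then have z': "\<forall>\<alpha>\<in>rts - \<Sigma>p. coord \<alpha> v *\<^sub>R X \<alpha> = 0" using z by simp
  have s: "\<Sigma>p \<subseteq> rts" using pos_roots(1) by blast
  have "(\<Sum>\<alpha>\<in>rts. coord \<alpha> v *\<^sub>R X \<alpha>) = comp_on \<Sigma>p v"
    unfolding comp_on_def by (rule sum.mono_neutral_right[OF finite_roots s z'])
  then show ?thesis using decomposition[of v] p by simp
qed

lemma X_F: "\<alpha> \<in> \<Sigma>p \<Longrightarrow> X \<alpha> \<in> up.F up.\<epsilon>"
  unfolding up.F_eps by (rule up.W_mono[OF X_up]) (use pos_roots[of \<alpha>] in auto)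

lemma span_X_F: "\<Phi> \<subseteq> \<Sigma>p \<Longrightarrow> v \<in> span (X ` \<Phi>) \<Longrightarrow> v \<in> up.F up.\<epsilon>"
  using span_minimal[OF _ up.subspace_W, of "X ` \<Phi>"] X_F by blast

abbreviation "smooth \<equiv> smooth_N br \<aa> \<Sigma>p \<omega> X"

text \<open>In the chart, derivatives of smooth functions along curves in \<open>N\<close> depend linearly on the
  derivative of the orbit of \<open>\<xi>\<close>, because the chart coordinates are polynomials in \<open>m \<xi>\<close>.\<close>

lemma smooth_curve_derivative:
  assumes f: "f \<in> smooth" and n: "n \<in> up.unip"
  obtains \<Lambda> where "linear \<Lambda>"
    "\<And>m d. \<lbrakk>m 0 = n; \<forall>\<^sub>F t in at 0. m t \<in> up.unip; ((\<lambda>t. m t \<xi>) has_vector_derivative d) (at 0)\<rbrakk>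
      \<Longrightarrow> DERIV (\<lambda>t. f (m t)) 0 :> \<Lambda> d"
proof -
  have sub: "{\<omega>} \<subseteq> \<Sigma>p" "\<Sigma>h \<subseteq> \<Sigma>p" "\<Sigma>0 \<subseteq> \<Sigma>p" using Sigma_partition(1) by auto
  define P1 where "P1 = comp_on {\<omega>}"
  define P2 where "P2 = comp_on \<Sigma>h"
  define P3 where "P3 = comp_on \<Sigma>0"
  have P: "linear P1" "linear P2" "linear P3" by (simp_all add: P1_def P2_def P3_def comp_on_linear)
  have Psum: "P1 v + P2 v + P3 v = v" if "v \<in> up.F up.\<epsilon>" for v
    using comp_on_pos[OF that] by (simp add: P1_def P2_def P3_def comp_on_def sum_Sigma)
  define e where "e = (\<lambda>Y. Exp br (P1 Y) \<circ> Exp br (P2 Y) \<circ> Exp br (P3 Y))"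
  obtain \<psi> where psi: "polynomial_function \<psi>"
    "\<And>m. m \<in> up.unip \<Longrightarrow> \<psi> (m \<xi>) \<in> up.F up.\<epsilon> \<and> m = e (\<psi> (m \<xi>))"
    unfolding e_def
    by (rule up.chart_inverse[OF P comp_on_F[OF sub(1), folded P1_def] comp_on_F[OF sub(2), folded P2_def]
          comp_on_F[OF sub(3), folded P3_def] Psum]) blast+
  define S where "S = span {X \<omega>} \<times> span (X ` \<Sigma>h) \<times> span (X ` \<Sigma>0)"
  define Fc where "Fc = (\<lambda>(z, y, x). f (Exp br z \<circ> Exp br y \<circ> Exp br x))"
  have "Ck_on (Suc 0) S Fc" using f unfolding smooth_N_def S_def Fc_def by blast
  then obtain F' where F': "\<And>x. x \<in> S \<Longrightarrow> (Fc has_derivative F' x) (at x within S)" by auto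
  define q where "q = (\<lambda>Y. (P1 Y, P2 Y, P3 Y))"
  have qS: "q Y \<in> S" for Y
    unfolding q_def S_def P1_def P2_def P3_def
    using comp_on_span[of "{\<omega>}" Y] comp_on_span by simp
  have linq: "bounded_linear q" unfolding q_def
    using P by (intro bounded_linear_Pair) (simp_all add: linear_conv_bounded_linear)
  have "\<psi> differentiable at (n \<xi>)" using psi(1) by (rule differentiable_at_polynomial_function)
  then obtain \<psi>' where psi': "(\<psi> has_derivative \<psi>') (at (n \<xi>))" unfolding differentiable_def by blast
  define s0 where "s0 = q (\<psi> (n \<xi>))"
  have lin: "bounded_linear (F' s0)" using F'[OF qS] unfolding s0_def by (rule has_derivative_bounded_linear)
  define \<Lambda> where "\<Lambda> = (\<lambda>d. F' s0 (q (\<psi>' d)))"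
  have "bounded_linear \<Lambda>" unfolding \<Lambda>_def
    by (intro bounded_linear_compose[OF lin] bounded_linear_compose[OF linq] has_derivative_bounded_linear[OF psi'])
  then have L: "linear \<Lambda>" by (rule bounded_linear.linear)
  show thesis
  proof (rule that[OF L])
    fix m d assume m: "m 0 = n" "\<forall>\<^sub>F t in at 0. m t \<in> up.unip" "((\<lambda>t. m t \<xi>) has_vector_derivative d) (at 0)"
    \<comment> \<open>The value at t = 0 is n, so the condition passes from a punctured to a full
      neighbourhood, from which an open T is taken.\<close>
    from m(2) have "\<forall>\<^sub>F t in nhds 0. m t \<in> up.unip" using m(1) n by (simp add: eventually_nhds_conv_at)
    then obtain T where T: "open T" "0 \<in> T" "\<And>t. t \<in> T \<Longrightarrow> m t \<in> up.unip" unfolding eventually_nhds by blast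
    define s where "s = (\<lambda>t. q (\<psi> (m t \<xi>)))"
    have "((\<lambda>t. m t \<xi>) has_derivative (\<lambda>t. t *\<^sub>R d)) (at 0)" using m(3) by (simp add: has_vector_derivative_def)
    then have "((\<lambda>t. \<psi> (m t \<xi>)) has_derivative (\<lambda>t. \<psi>' (t *\<^sub>R d))) (at 0)"
      by (rule has_derivative_compose) (simp add: m(1) psi')
    then have "(s has_derivative (\<lambda>t. q (\<psi>' (t *\<^sub>R d)))) (at 0)"
      unfolding s_def by (rule bounded_linear.has_derivative[OF linq])
    then have s': "(s has_derivative (\<lambda>t. q (\<psi>' (t *\<^sub>R d)))) (at 0 within T)"
      by (rule has_derivative_at_withinI)
    \<comment> \<open>\<open>Fc\<close> is differentiable within S, so the chain rule is applied
      within T; the curve s stays in S.\<close>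
    have "(Fc has_derivative F' s0) (at (s 0) within s ` T)"
      using has_derivative_subset[OF F'[OF qS[of "\<psi> (n \<xi>)"]], of "s ` T"] qS
      by (auto simp: s_def s0_def m(1))
    from diff_chain_within[OF s' this]
    have "((\<lambda>t. Fc (s t)) has_derivative (\<lambda>t. \<Lambda> (t *\<^sub>R d))) (at 0 within T)"
      by (simp add: o_def \<Lambda>_def)
    moreover have "Fc (s t) = f (m t)" if "t \<in> T" for t
    proof -
      have "m t = e (\<psi> (m t \<xi>))" using psi(2)[OF T(3)[OF that]] by blast
      then have "f (m t) = f (e (\<psi> (m t \<xi>)))" by (rule arg_cong)
      then show ?thesis by (simp add: Fc_def s_def q_def e_def)
    qed
    ultimately have "((\<lambda>t. f (m t)) has_derivative (\<lambda>t. \<Lambda> (t *\<^sub>R d))) (at 0 within T)"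
      using has_derivative_transform[OF T(2), of "\<lambda>t. f (m t)" "\<lambda>t. Fc (s t)"] by simp
    then show "DERIV (\<lambda>t. f (m t)) 0 :> \<Lambda> d"
      using at_within_open[OF T(2,1)] by (simp add: has_field_derivative_def linear_cmul[OF L] mult.commute[of _ "\<Lambda> d"])
  qed
qed

end

section \<open>The vector fields on N and the coefficient of Z\<close>

context positive_rooted
begin

lemma unip_automorphism: "n \<in> up.unip \<Longrightarrow> n \<in> automorphisms"
  by (simp add: up.unip_def)

text \<open>As k inverts n, exp(tV) n = n exp(t k V): the curve through n is n applied to the curve
  through the identity for W = k V.\<close>

lemma tau_derivative:
  assumes n: "n \<in> up.unip" and k: "n \<circ> k = id"
    and \<Lambda>: "\<And>m d. \<lbrakk>m 0 = n; \<forall>\<^sub>F t in at 0. m t \<in> up.unip; ((\<lambda>t. m t \<xi>) has_vector_derivative d) (at 0)\<rbrakk>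
      \<Longrightarrow> DERIV (\<lambda>t. f (m t)) 0 :> \<Lambda> d"
  shows "tau br \<theta> \<aa> \<Sigma>p V f n = \<Lambda> (n (up.pr {0<..} (br (k V) \<xi>)))"
proof -
  define W where "W = k V"
  note na = automorphismsD[OF unip_automorphism[OF n]]
  have conj: "Exp br (t *\<^sub>R V) \<circ> n = n \<circ> Exp br (t *\<^sub>R W)" for t
  proof -
    have "n (t *\<^sub>R W) = t *\<^sub>R V" using fun_cong[OF k, of V] by (simp add: W_def linear_cmul[OF na(1)])
    then show ?thesis using automorphism_Exp[OF unip_automorphism[OF n], of "t *\<^sub>R W"] by (auto simp: fun_eq_iff)
  qed
  define m where "m = (\<lambda>t. n \<circ> N_curve W t)"
  have ev: "\<forall>\<^sub>F t in at 0. m t \<in> up.unip \<and> N_part br \<theta> \<aa> \<Sigma>p (Exp br (t *\<^sub>R V) \<circ> n) = m t"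
    using N_curve_eventually[OF zero_less_one, of W]
  proof (rule eventually_mono, elim conjE bexE)
    fix t p assume t: "N_curve W t \<in> up.unip" "p \<in> P_group br \<theta> \<aa> \<Sigma>p" "Exp br (t *\<^sub>R W) = N_curve W t \<circ> p"
    have mu: "m t \<in> up.unip" unfolding m_def by (rule up.unip_comp[OF n t(1)])
    have "Exp br (t *\<^sub>R V) \<circ> n = m t \<circ> p" unfolding conj t(3) m_def by (simp add: comp_assoc)
    then show "m t \<in> up.unip \<and> N_part br \<theta> \<aa> \<Sigma>p (Exp br (t *\<^sub>R V) \<circ> n) = m t"
      using N_part_eq[OF mu t(2)] mu by simp
  qed
  have m0: "m 0 = n" by (simp add: m_def N_curve_0)
  have "((\<lambda>t. m t \<xi>) has_vector_derivative n (up.pr {0<..} (br W \<xi>))) (at 0)"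
    unfolding m_def o_def
    using bounded_linear.has_vector_derivative[OF _ N_curve_derivative, of n W] na(1)
    by (simp add: linear_conv_bounded_linear)
  then have D: "DERIV (\<lambda>t. f (m t)) 0 :> \<Lambda> (n (up.pr {0<..} (br W \<xi>)))"
    using ev by (intro \<Lambda> m0) (auto elim: eventually_mono)
  have "N_part br \<theta> \<aa> \<Sigma>p (Exp br (0 *\<^sub>R V) \<circ> n) = n"
    using N_part_eq[OF n id_P] by simp
  then have "\<forall>\<^sub>F t in nhds 0. f (N_part br \<theta> \<aa> \<Sigma>p (Exp br (t *\<^sub>R V) \<circ> n)) = f (m t)"
    using ev by (auto simp: eventually_nhds_conv_at m0 elim: eventually_mono)
  from DERIV_cong_ev[OF refl this refl, THEN iffD2, OF D]
  have "DERIV (\<lambda>t. f (N_part br \<theta> \<aa> \<Sigma>p (Exp br (t *\<^sub>R V) \<circ> n))) 0 :> \<Lambda> (n (up.pr {0<..} (br W \<xi>)))" .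
  then show ?thesis unfolding tau_def W_def by (rule DERIV_imp_deriv)
qed

lemma left_invariant_derivative:
  assumes n: "n \<in> up.unip" and Y: "Y \<in> up.F up.\<epsilon>"
    and \<Lambda>: "\<And>m d. \<lbrakk>m 0 = n; \<forall>\<^sub>F t in at 0. m t \<in> up.unip; ((\<lambda>t. m t \<xi>) has_vector_derivative d) (at 0)\<rbrakk>
      \<Longrightarrow> DERIV (\<lambda>t. f (m t)) 0 :> \<Lambda> d"
  shows "left_invariant br Y f n = \<Lambda> (n (br Y \<xi>))"
proof -
  note na = automorphismsD[OF unip_automorphism[OF n]]
  have "DERIV (\<lambda>t. f (n \<circ> Exp br (t *\<^sub>R Y))) 0 :> \<Lambda> (n (br Y \<xi>))"
  proof (rule \<Lambda>)
    show "n \<circ> Exp br (0 *\<^sub>R Y) = n" by simp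
    show "\<forall>\<^sub>F t in at 0. n \<circ> Exp br (t *\<^sub>R Y) \<in> up.unip"
      by (intro always_eventually allI up.unip_comp n up.Exp_unip up.W_scale Y)
    have "((\<lambda>t. Exp br (t *\<^sub>R Y) \<xi>) has_vector_derivative br Y \<xi>) (at 0)"
      using Exp_has_vector_derivative[of Y \<xi> 0] by simp
    then show "((\<lambda>t. (n \<circ> Exp br (t *\<^sub>R Y)) \<xi>) has_vector_derivative n (br Y \<xi>)) (at 0)"
      using bounded_linear.has_vector_derivative[of n] na(1) by (simp add: linear_conv_bounded_linear)
  qed
  then show ?thesis unfolding left_invariant_def by (rule DERIV_imp_deriv)
qed

text \<open>The part of W with nonpositive weights drops out, which leaves the same brackets with
  \<xi> that give the derivatives of left-invariant fields.\<close>

lemma pr_br_xi: "up.pr {0<..} (br W \<xi>) = (\<Sum>\<alpha>\<in>\<Sigma>p. coord \<alpha> W *\<^sub>R br (X \<alpha>) \<xi>)"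
proof -
  have c: "{0<..} \<inter> {..0} = ({} :: real set)" "{0<..} \<union> {..0} = (UNIV :: real set)" by auto
  define u where "u = up.pr {0<..} W"
  define l where "l = up.pr {..0} W"
  have W: "W = u + l" unfolding u_def l_def by (rule up.pr_compl[OF c])
  have u: "u \<in> up.W {0<..}" and l: "l \<in> up.W {..0}" unfolding u_def l_def by (rule up.pr_in_W)+
  have bu: "br u \<xi> \<in> up.W {0<..}" by (rule up.W_br[OF u up.xi_W0]) auto
  have bl: "br l \<xi> \<in> up.W {..0}" by (rule up.W_br[OF l up.xi_W0]) auto
  have "up.pr {0<..} (br W \<xi>) = br u \<xi>"
    unfolding W by (simp add: br_add_left linear_add[OF up.pr_linear] up.pr_id[OF bu] up.pr_0[OF bl c(1)])
  also have "u = comp_on \<Sigma>p u" using comp_on_pos[of u] u by (simp add: up.F_eps)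
  also have "comp_on \<Sigma>p u = comp_on \<Sigma>p W"
  proof -
    have "coord \<alpha> l = 0" if "\<alpha> \<in> \<Sigma>p" for \<alpha> using l pos_roots[OF that] by (auto simp: up_iff)
    then show ?thesis unfolding comp_on_def W by (simp add: coord_simps(1))
  qed
  finally show ?thesis by (simp add: comp_on_def br_sum_left)
qed

text \<open>Supplies test functions: matrix coefficients are polynomial on the chart domain, where
  the exponentials are truncated series.\<close>

lemma polynomial_test_smooth:
  assumes "linear (l :: 'g \<Rightarrow> real)"
  shows "(\<lambda>m. l (m v)) \<in> smooth"
  unfolding smooth_N_def
proof (intro CollectI allI)
  fix k
  let ?S = "span {X \<omega>} \<times> span (X ` \<Sigma>h) \<times> span (X ` \<Sigma>0)"
  define g where "g = (\<lambda>s :: 'g \<times> 'g \<times> 'g. up.nexp (fst s) (up.nexp (fst (snd s)) (up.nexp (snd (snd s)) v)))"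
  have lin: "polynomial_function h" if "bounded_linear h" for h :: "'g \<times> 'g \<times> 'g \<Rightarrow> 'g"
    using that by (rule polynomial_function_bounded_linear)
  have "polynomial_function g" unfolding g_def
    by (intro up.polynomial_nexp polynomial_function_const lin bounded_linear_fst
          bounded_linear_fst_comp bounded_linear_snd_comp bounded_linear_snd)
  moreover have "polynomial_function l"
    using assms linear_conv_bounded_linear polynomial_function_bounded_linear by blast
  ultimately have "polynomial_function (l \<circ> g)" by (rule polynomial_function_compose)
  then have "Ck_on k ?S (l \<circ> g)" by (intro real_polynomial_function_Ck_on) (simp add: real_polynomial_function_eq)
  then show "Ck_on k ?S (\<lambda>(z, y, x). l ((Exp br z \<circ> Exp br y \<circ> Exp br x) v))"
  proof (rule Ck_on_cong)
    fix s assume "s \<in> ?S"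
    then obtain z y x where s: "s = (z, y, x)" "z \<in> span (X ` {\<omega>})" "y \<in> span (X ` \<Sigma>h)" "x \<in> span (X ` \<Sigma>0)"
      by auto
    have "{\<omega>} \<subseteq> \<Sigma>p" "\<Sigma>h \<subseteq> \<Sigma>p" "\<Sigma>0 \<subseteq> \<Sigma>p"
      using omega_pos(2) by (auto simp: sigma_half_iff sigma_zero_iff)
    then have "z \<in> up.F up.\<epsilon>" "y \<in> up.F up.\<epsilon>" "x \<in> up.F up.\<epsilon>"
      using s(2-4) span_X_F by blast+
    then show "(case s of (z, y, x) \<Rightarrow> l ((Exp br z \<circ> Exp br y \<circ> Exp br x) v)) = (l \<circ> g) s"
      by (simp add: s(1) g_def up.Exp_nexp)
  qed
qed

text \<open>At n the field \<open>tau V\<close> has the coordinates of the positive part of W = n^-1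
  V in the left-invariant frame, so the coefficient of Z is B W (X (-\<omega>)); applying n to both
  arguments gives the claim.\<close>

lemma Z_coeff_eq:
  assumes n: "n \<in> up.unip"
  shows "Z_coeff br \<theta> \<aa> \<Sigma>p \<omega> X V n = B V (n (X (- \<omega>)))"
proof -
  obtain k where k: "k \<in> up.unip" "k \<circ> n = id" "n \<circ> k = id" using up.unip_inv[OF n] by blast
  note na = automorphismsD[OF unip_automorphism[OF n]]
  define W where "W = k V"
  have expand: "tau br \<theta> \<aa> \<Sigma>p V f n = coord \<omega> W * left_invariant br (X \<omega>) f n
       + (\<Sum>\<alpha>\<in>\<Sigma>h. coord \<alpha> W * left_invariant br (X \<alpha>) f n)
       + (\<Sum>\<beta>\<in>\<Sigma>0. coord \<beta> W * left_invariant br (X \<beta>) f n)" if f: "f \<in> smooth" for f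
  proof (rule smooth_curve_derivative[OF f n])
    fix \<Lambda> assume L: "linear \<Lambda>"
      "\<And>m d. \<lbrakk>m 0 = n; \<forall>\<^sub>F t in at 0. m t \<in> up.unip; ((\<lambda>t. m t \<xi>) has_vector_derivative d) (at 0)\<rbrakk>
      \<Longrightarrow> DERIV (\<lambda>t. f (m t)) 0 :> \<Lambda> d"
    have "tau br \<theta> \<aa> \<Sigma>p V f n = \<Lambda> (n (\<Sum>\<alpha>\<in>\<Sigma>p. coord \<alpha> W *\<^sub>R br (X \<alpha>) \<xi>))"
      using tau_derivative[OF n k(3) L(2), where V = V] by (simp add: pr_br_xi W_def)
    also have "\<dots> = (\<Sum>\<alpha>\<in>\<Sigma>p. coord \<alpha> W * \<Lambda> (n (br (X \<alpha>) \<xi>)))"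
      by (simp add: linear_sum[OF na(1)] linear_cmul[OF na(1)] linear_sum[OF L(1)] linear_cmul[OF L(1)])
    also have "\<dots> = (\<Sum>\<alpha>\<in>\<Sigma>p. coord \<alpha> W * left_invariant br (X \<alpha>) f n)"
      by (intro sum.cong refl) (simp add: left_invariant_derivative[OF n X_F L(2)])
    finally show "tau br \<theta> \<aa> \<Sigma>p V f n = coord \<omega> W * left_invariant br (X \<omega>) f n
       + (\<Sum>\<alpha>\<in>\<Sigma>h. coord \<alpha> W * left_invariant br (X \<alpha>) f n)
       + (\<Sum>\<beta>\<in>\<Sigma>0. coord \<beta> W * left_invariant br (X \<beta>) f n)" by (simp add: sum_Sigma)
  qed
  have "Z_coeff br \<theta> \<aa> \<Sigma>p \<omega> X V n = coord \<omega> W"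
    unfolding Z_coeff_def
  proof (rule the_equality)
    show "\<exists>r s. \<forall>f\<in>smooth. tau br \<theta> \<aa> \<Sigma>p V f n = coord \<omega> W * left_invariant br (X \<omega>) f n
       + (\<Sum>\<alpha>\<in>\<Sigma>h. r \<alpha> * left_invariant br (X \<alpha>) f n)
       + (\<Sum>\<beta>\<in>\<Sigma>0. s \<beta> * left_invariant br (X \<beta>) f n)"
      using expand by (intro exI[of _ "\<lambda>\<alpha>. coord \<alpha> W"]) blast
    fix q assume "\<exists>r s. \<forall>f\<in>smooth. tau br \<theta> \<aa> \<Sigma>p V f n = q * left_invariant br (X \<omega>) f n
       + (\<Sum>\<alpha>\<in>\<Sigma>h. r \<alpha> * left_invariant br (X \<alpha>) f n)
       + (\<Sum>\<beta>\<in>\<Sigma>0. s \<beta> * left_invariant br (X \<beta>) f n)"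
    then obtain r s where rs: "\<And>f. f \<in> smooth \<Longrightarrow> tau br \<theta> \<aa> \<Sigma>p V f n = q * left_invariant br (X \<omega>) f n
       + (\<Sum>\<alpha>\<in>\<Sigma>h. r \<alpha> * left_invariant br (X \<alpha>) f n)
       + (\<Sum>\<beta>\<in>\<Sigma>0. s \<beta> * left_invariant br (X \<beta>) f n)" by blast
    \<comment> \<open>A test function that isolates the coefficient of Z: the derivative at n of m
      \<mapsto> B (n^-1 m H_\<omega>) (X (-\<omega>)) along X \<alpha> is -\<alpha>(H_\<omega>) B (X
      \<alpha>) (X (-\<omega>)), that is -\<kappa> for \<alpha> = \<omega> and 0 for every other
      root.\<close>
    define l where "l = (\<lambda>v. B (k v) (X (- \<omega>)))"
    have l: "linear l" unfolding l_def
      using linear_compose[OF automorphismsD(1)[OF unip_automorphism[OF k(1)]] B_linear_left] by (simp add: o_def)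
    define f where "f = (\<lambda>m :: 'g \<Rightarrow> 'g. l (m (Hv \<omega>)))"
    have f: "f \<in> smooth" unfolding f_def by (rule polynomial_test_smooth[OF l])
    note Hw = Hvec_in_a[OF omega_root]
    have li: "left_invariant br (X \<alpha>) f n = (if \<alpha> = \<omega> then - \<kappa> else 0)" if a: "\<alpha> \<in> rts" for \<alpha>
    proof -
      have "((\<lambda>t. Exp br (t *\<^sub>R X \<alpha>) (Hv \<omega>)) has_vector_derivative br (X \<alpha>) (Hv \<omega>)) (at 0)"
        using Exp_has_vector_derivative[of "X \<alpha>" "Hv \<omega>" 0] by simp
      then have "((\<lambda>t. B (Exp br (t *\<^sub>R X \<alpha>) (Hv \<omega>)) (X (- \<omega>))) has_vector_derivative B (br (X \<alpha>) (Hv \<omega>)) (X (- \<omega>))) (at 0)"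
        using bounded_linear.has_vector_derivative B_linear_left linear_conv_bounded_linear by blast
      moreover have "f (n \<circ> Exp br (t *\<^sub>R X \<alpha>)) = B (Exp br (t *\<^sub>R X \<alpha>) (Hv \<omega>)) (X (- \<omega>))" for t
        using fun_cong[OF k(2), of "Exp br (t *\<^sub>R X \<alpha>) (Hv \<omega>)"] by (simp add: f_def l_def)
      ultimately have "left_invariant br (X \<alpha>) f n = B (br (X \<alpha>) (Hv \<omega>)) (X (- \<omega>))"
        unfolding left_invariant_def
        by (intro DERIV_imp_deriv) (simp add: has_real_derivative_iff_has_vector_derivative)
      also have "\<dots> = - \<alpha> (Hv \<omega>) * B (X \<alpha>) (X (- \<omega>))"
        by (subst br_antisym) (simp add: X_eig[OF a Hw] B_simps)
      finally show ?thesis using B_X[OF a root_neg[OF omega_root]] by (auto simp: \<kappa>_def)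
    qed
    have z: "(\<Sum>\<alpha>\<in>\<Sigma>h. r \<alpha> * left_invariant br (X \<alpha>) f n) = 0" "(\<Sum>\<beta>\<in>\<Sigma>0. r \<beta> * left_invariant br (X \<beta>) f n) = 0" for r
    proof -
      have "left_invariant br (X \<alpha>) f n = 0" if "\<alpha> \<in> \<Sigma>h \<union> \<Sigma>0" for \<alpha>
      proof -
        have "\<alpha> \<in> rts" "\<alpha> \<noteq> \<omega>"
          using that Sigma_partition(2,3) pos_roots(1) by (auto simp: sigma_half_iff sigma_zero_iff)
        then show ?thesis using li by simp
      qed
      then show "(\<Sum>\<alpha>\<in>\<Sigma>h. r \<alpha> * left_invariant br (X \<alpha>) f n) = 0"
        "(\<Sum>\<beta>\<in>\<Sigma>0. r \<beta> * left_invariant br (X \<beta>) f n) = 0" by simp_all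
    qed
    have "coord \<omega> W * - \<kappa> = q * - \<kappa>"
      using rs[OF f] unfolding expand[OF f] li[OF omega_root] z by simp
    then show "q = coord \<omega> W" using kappa_pos by simp
  qed
  also have "coord \<omega> W = B (n W) (n (X (- \<omega>)))"
    using B_automorphism[OF unip_automorphism[OF n]] by (simp add: coord_def)
  also have "n W = V" using fun_cong[OF k(3), of V] by (simp add: W_def)
  finally show ?thesis .
qed

text \<open>The displacement of X \<omega> lies above the height of \<omega>, which is the greatest
  weight.\<close>

lemma unip_fixes_X_omega:
  assumes "n \<in> up.unip"
  shows "n (X \<omega>) = X \<omega>"
proof -
  have "up.raise up.\<epsilon> (\<lambda>v. n v - v)" using assms by (simp add: up.unip_def)
  then have "n (X \<omega>) - X \<omega> \<in> up.F (\<omega> \<xi> + up.\<epsilon>)"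
    by (rule up.raiseD[OF _ up.W_mono[OF X_up[OF omega_root]] refl]) simp
  moreover have "up.F (\<omega> \<xi> + up.\<epsilon>) \<subseteq> {0}"
  proof
    fix v assume v: "v \<in> up.F (\<omega> \<xi> + up.\<epsilon>)"
    have "coord \<alpha> v = 0" if "\<alpha> \<in> rts" for \<alpha>
      using v height_le_omega(1)[OF that] up.eps_pos that by (auto simp: up_iff)
    moreover have "a_part v = 0" using v omega_pos(1) up.eps_pos by (auto simp: up_iff)
    ultimately show "v \<in> {0}" using decomposition[of v] by simp
  qed
  ultimately show ?thesis by auto
qed

text \<open>Relations of the sl(2) triple of \<omega>, transported by n.\<close>

lemma orbit_identity:
  assumes n: "n \<in> up.unip"
  shows "br (n (X (- \<omega>))) (br (n (X (- \<omega>))) (X \<omega>)) = - \<kappa> *\<^sub>R n (X (- \<omega>))"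
    and "B (X \<omega>) (n (X (- \<omega>))) = 1"
proof -
  note na = automorphismsD[OF unip_automorphism[OF n]]
  note nw = root_neg[OF omega_root]
  let ?Y = "X (- \<omega>)"
  have "br (n ?Y) (br (n ?Y) (X \<omega>)) = n (br ?Y (br ?Y (X \<omega>)))"
    using na(3) unip_fixes_X_omega[OF n] by simp
  also have "br ?Y (X \<omega>) = - Hv \<omega>" by (rule br_X_neg[OF omega_root])
  also have "br ?Y (- Hv \<omega>) = br (Hv \<omega>) ?Y" by (subst br_antisym) simp
  also have "\<dots> = - \<kappa> *\<^sub>R ?Y" using X_eig[OF nw Hvec_in_a[OF omega_root]] by (simp add: \<kappa>_def)
  finally show "br (n ?Y) (br (n ?Y) (X \<omega>)) = - \<kappa> *\<^sub>R n ?Y" by (simp only: linear_cmul[OF na(1)])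
  have "B (n (X \<omega>)) (n ?Y) = 1"
    unfolding B_automorphism[OF unip_automorphism[OF n]] by (rule X_norm[OF omega_root])
  then show "B (X \<omega>) (n ?Y) = 1" by (simp add: unip_fixes_X_omega[OF n])
qed

lemma Hvec_sum:
  assumes "\<gamma> \<in> rts" "\<gamma>' \<in> rts" "\<And>i. i \<in> {1..m::nat} \<Longrightarrow> \<delta> i \<in> rts" "\<gamma>' = \<gamma> + (\<Sum>i=1..m. \<delta> i)"
  shows "Hv \<gamma>' = Hv \<gamma> + (\<Sum>i=1..m. Hv (\<delta> i))"
proof (rule Hvec_eqI)
  show "Hv \<gamma> + (\<Sum>i=1..m. Hv (\<delta> i)) \<in> \<aa>"
    using assms(1,3) by (intro a_add a_sum Hvec_in_a)
  fix H assume H: "H \<in> \<aa>"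
  have ap: "(\<Sum>i\<in>I. \<delta> i) H = (\<Sum>i\<in>I. \<delta> i H)" for I :: "nat set"
    by (induction I rule: infinite_finite_induct) auto
  have "(\<Sum>i=1..m. \<delta> i H) = (\<Sum>i=1..m. B H (Hv (\<delta> i)))"
    using assms(3) H by (intro sum.cong) (auto simp: B_Hvec)
  then show "\<gamma>' H = B H (Hv \<gamma> + (\<Sum>i=1..m. Hv (\<delta> i)))"
    using B_Hvec[OF assms(1) H] by (simp add: assms(4) ap B_simps B_sum_right)
qed

end

theorem proposition5:
  fixes br :: "'g::euclidean_space \<Rightarrow> 'g \<Rightarrow> 'g"
    and \<theta> :: "'g \<Rightarrow> 'g"
    and \<aa> :: "'g set"
    and \<Sigma>p R :: "('g \<Rightarrow> real) set"
    and \<omega> :: "'g \<Rightarrow> real"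
    and X :: "('g \<Rightarrow> real) \<Rightarrow> 'g"
    and c :: "('g \<Rightarrow> real) \<Rightarrow> ('g \<Rightarrow> real) \<Rightarrow> real"
  defines "\<Sigma>\<^sub>0 \<equiv> sigma_zero br \<aa> \<Sigma>p \<omega>"
    and "\<Sigma>\<^sub>h \<equiv> sigma_half br \<aa> \<Sigma>p \<omega>"
    and "p \<equiv> Z_coeff br \<theta> \<aa> \<Sigma>p \<omega> X"
    and "HH \<equiv> H_sol br \<aa> \<omega> R"
  assumes "simple_lie br"
    and "cartan_involution br \<theta>"
    and "cartan_subspace br \<theta> \<aa>"
    and "split_form br \<theta> \<aa>"
    and "dim \<aa> > 1"
    and "positive_system br \<aa> \<Sigma>p"
    and "highest_root br \<aa> \<Sigma>p \<omega>"
    and "normalized_root_vectors br \<aa> X"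
    and "structure_constants br \<aa> X c"
    and "half_representatives br \<aa> \<Sigma>p \<omega> R"
  shows "(\<forall>\<gamma>\<in>\<Sigma>\<^sub>h. (\<exists>!H. H_system br \<aa> \<omega> R \<gamma> H) \<and>
            (\<forall>n\<in>N_group br \<aa> \<Sigma>p.
               p (X (- \<gamma>)) n =
                 - (1 / c \<gamma> (\<omega> - \<gamma>)) * p (X (\<omega> - \<gamma>)) n * p (HH \<gamma>) n
                 + 1/3 * (\<Sum>\<alpha> \<in> {\<alpha> \<in> \<Sigma>\<^sub>h. - \<gamma> + \<alpha> \<in> \<Sigma>\<^sub>0 \<union> uminus ` \<Sigma>\<^sub>0}.
                     c \<alpha> (- \<gamma>) / c \<alpha> (\<omega> - \<alpha>) * p (X (\<omega> - \<alpha>)) n * p (X (\<alpha> - \<gamma>)) n)))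
       \<and> (\<forall>\<gamma>\<in>\<Sigma>\<^sub>h \<inter> simple_roots \<Sigma>p. \<forall>\<gamma>'\<in>\<Sigma>\<^sub>h. \<forall>(m::nat) (\<delta> :: nat \<Rightarrow> 'g \<Rightarrow> real).
            (\<forall>i\<in>{1..m}. \<delta> i \<in> \<Sigma>\<^sub>0 \<inter> simple_roots \<Sigma>p) \<and> \<gamma>' = \<gamma> + (\<Sum>i=1..m. \<delta> i) \<longrightarrow>
            HH \<gamma>' = HH \<gamma> - (1/3) *\<^sub>R (\<Sum>i=1..m. Hvec br \<aa> (\<delta> i)))"
proof -
  interpret positive_rooted br \<theta> \<aa> X \<Sigma>p \<omega>
    using assms by unfold_locales (auto simp: simple_lie_def)
  note R = \<open>half_representatives br \<aa> \<Sigma>p \<omega> R\<close> and sc = \<open>structure_constants br \<aa> X c\<close>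
  have HHeq: "HH \<gamma> = - (1 / 3) *\<^sub>R (Hv \<omega> + Hv \<gamma>)" if "\<gamma> \<in> \<Sigma>h" for \<gamma>
    unfolding HH_def by (rule H_sol_eq[OF R that])
  have "\<exists>!H. H_system br \<aa> \<omega> R \<gamma> H" if "\<gamma> \<in> \<Sigma>h" for \<gamma>
    unfolding H_system_iff[OF R that] by blast
  moreover have "p (X (- \<gamma>)) n =
      - (1 / c \<gamma> (\<omega> - \<gamma>)) * p (X (\<omega> - \<gamma>)) n * p (HH \<gamma>) n
      + 1/3 * (\<Sum>\<alpha> \<in> {\<alpha> \<in> \<Sigma>h. - \<gamma> + \<alpha> \<in> \<Sigma>0 \<union> uminus ` \<Sigma>0}.
          c \<alpha> (- \<gamma>) / c \<alpha> (\<omega> - \<alpha>) * p (X (\<omega> - \<alpha>)) n * p (X (\<alpha> - \<gamma>)) n)"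
    if g: "\<gamma> \<in> \<Sigma>h" and n: "n \<in> N_group br \<aa> \<Sigma>p" for \<gamma> n
  proof -
    have n': "n \<in> up.unip" using n by (simp only: N_group_up)
    show ?thesis unfolding p_def Z_coeff_eq[OF n'] HHeq[OF g]
      by (rule cubic_coefficient[OF sc g orbit_identity[OF n']])
  qed
  \<comment> \<open>H(\<gamma>) is affine in H_\<gamma> with slope -1/3, which reduces the claim to
    additivity of \<alpha> \<mapsto> H_\<alpha>.\<close>
  moreover have "HH \<gamma>' = HH \<gamma> - (1/3) *\<^sub>R (\<Sum>i=1..m. Hvec br \<aa> (\<delta> i))"
    if g: "\<gamma> \<in> \<Sigma>h" "\<gamma>' \<in> \<Sigma>h" and d: "\<forall>i\<in>{1..m}. \<delta> i \<in> \<Sigma>0 \<inter> simple_roots \<Sigma>p"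
      and eq: "\<gamma>' = \<gamma> + (\<Sum>i=1..m. \<delta> i)" for \<gamma> \<gamma>' and m :: nat and \<delta>
  proof -
    have "\<delta> i \<in> rts" if "i \<in> {1..m}" for i
      using d that pos_roots(1) by (auto simp: sigma_zero_iff)
    from Hvec_sum[OF half_roots[OF g(1)] half_roots[OF g(2)] this eq]
    have "Hv \<gamma>' = Hv \<gamma> + (\<Sum>i=1..m. Hv (\<delta> i))" .
    then show ?thesis by (simp add: HHeq[OF g(1)] HHeq[OF g(2)] algebra_simps)
  qed
  ultimately show ?thesis unfolding \<Sigma>\<^sub>0_def \<Sigma>\<^sub>h_def by blast
qed

end
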